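(* Let $\mathcal{S}=\{S_m,m\in\mathcal{M}\}$ be a finite collection of linear subspaces of $\mathbb{R}^n$, $\alpha=\min\{N_m/n\,:\,m\in\mathcal{M}\}$, and let $K_1,K_2$ be two numbers satisfying $K_2\ge K_1>1$. Let $\mathrm{pen}^*:\mathcal{M}\to\mathbb{R}_+$ be a penalty function, let $\hat m$ be a minimizer over $m\in\mathcal{M}$ of $$\mathrm{Crit}'_K(m)=\frac n2\log\left(\frac{\|Y-\Pi_mY\|^2}{N_m}\right)+\frac12\mathrm{pen}^*(m),$$ and let $\tilde\theta=\hat\theta_{\hat m}$. If $D_m\le n-5$ for all $m\in\mathcal{M}$, then $$\mathbb{E}[\mathcal{K}(P_\theta,P_{\tilde\theta})]\le\frac{K_1}{K_1-1}\left\{\inf_{m\in\mathcal{M}}\left[\mathbb{E}[\mathcal{K}(P_\theta,P_{\hat\theta_m})]+\frac94(\mathrm{pen}^*(m)\vee D_m)\right]+\Sigma_1+\Sigma_2\right\},\qquad(\ast)$$ where $$\Sigma_1=2.5\,e^{1/(K_2^2\alpha)}\,n\,e^{-n/(4K_2^2)}|\mathcal{M}|^{4/(\alpha n)},\qquad\Sigma_2=\frac{5K_1}{4}\sum_{m\in\mathcal{M}}(D_m+1)\Lambda_m$$ and $$\Lambda_m=\mathsf{Fish}\left[D_m+1,\,N_m-1,\,\frac{N_m-1}{K_1N_m}\cdot\frac{K_2D_m+(K_2-1)\mathrm{pen}^*(m)}{K_2(D_m+1)}\right].$$ In particular, let $\mathcal{L}=\{L_m,m\in\mathcal{M}\}$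 be a sequence of nonnegative weights. If for all $m\in\mathcal{M}$, $\mathrm{pen}^*(m)=\mathrm{pen}^{\mathcal{K}}_{K_1,K_2,\mathcal{L}}(m)$ with $$\mathrm{pen}^{\mathcal{K}}_{K_1,K_2,\mathcal{L}}(m)=\frac{K_2}{K_2-1}\left[\frac{K_1(D_m+1)N_m}{N_m-1}\,\mathsf{EFish}(D_m+1,N_m-1,e^{-L_m})-D_m\right]_+,$$ then the estimator $\tilde\theta$ satisfies $(\ast)$ with $\Sigma_2\le1.25\,K_1\sum_{m\in\mathcal{M}}(D_m+1)e^{-L_m}$.
   Context: Model: $Y=(Y_1,\dots,Y_n)'$ with $Y_i=\mu_i+\sigma\varepsilon_i$, where $\mu\in\mathbb{R}^n$ and $\sigma>0$ are unknown and the $\varepsilon_i$ are i.i.d. standard Gaussian; $\theta=(\mu,\sigma^2)$ and $P_\theta=P_{\mu,\sigma^2}$ is the distribution of $Y$. $\|\cdot\|$ is the Euclidean norm. $\Pi_m$ is the orthogonal projector onto $S_m$, $D_m=\dim S_m$, $N_m=n-D_m$, and $$\hat\theta_m=(\hat\mu_m,\hat\sigma_m^2)=\left(\Pi_mY,\frac{\|Y-\Pi_mY\|^2}{N_m}\right).$$ The Kullback loss is $$\mathcal{K}(P_{\mu,\sigma^2},P_{\nu,\tau^2})=\frac n2\left[\log\left(\frac{\tau^2}{\sigma^2}\right)+\frac{\sigma^2}{\tau^2}-1+\frac{\|\mu-\nu\|^2}{n\tau^2}\right];$$ in $\mathcal{K}(P_\theta,P_{\hat\theta_m})$ the random value $\hat\theta_m$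 is plugged in as the second parameter. For $F_{D,N}$ a Fisher random variable with $D\ge1$ and $N\ge3$ degrees of freedom and $x\ge0$, $\mathsf{Fish}[D,N,x]=\mathbb{E}[(F_{D,N}-x)_+]/\mathbb{E}(F_{D,N})\le1$. For $0<q\le1$, $\mathsf{EFish}[D,N,q]$ is the solution $x\geq 0$ of $\mathsf{Fish}[D,N,x]=q$. $(\cdot)_+$ and $[\cdot]_+$ denote positive parts and $x\vee y=\max\{x,y\}$. *)

theory Defs
  imports "HOL-Probability.Probability"
begin

definition orth_proj :: "'a::euclidean_space set \<Rightarrow> 'a \<Rightarrow> 'a" where
  "orth_proj S y = (THE p. p \<in> S \<and> (\<forall>x\<in>S. orthogonal (y - p) x))"

(* N = n - dim S; the natural-number subtraction never truncates. *)
definition residual_dim :: "(real ^ 'n) set \<Rightarrow> nat" where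
  "residual_dim S = CARD('n) - dim S"

(* A parameter is a pair (mean vector, variance): the second component is
   sigma^2, not sigma. *)
type_synonym 'n param = "(real ^ 'n) \<times> real"

definition estimator :: "(real ^ 'n) set \<Rightarrow> real ^ 'n \<Rightarrow> 'n param" where
  "estimator S y =
     (orth_proj S y, (norm (y - orth_proj S y))\<^sup>2 / real (residual_dim S))"

(* The divergence K(P_(mu,v), P_(nu,w)) of the spherical Gaussian laws
   N(mu, v Id) and N(nu, w Id) on R^n, as a function of the parameters. *)
fun kullback :: "'n::finite param \<Rightarrow> 'n param \<Rightarrow> real" where
  "kullback (\<mu>, v) (\<nu>, w) =
     real CARD('n) / 2 *
       (ln (w / v) + v / w - 1 + (norm (\<mu> - \<nu>))\<^sup>2 / (real CARD('n) * w))"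

definition crit :: "('i \<Rightarrow> (real ^ 'n) set) \<Rightarrow> ('i \<Rightarrow> real) \<Rightarrow> real ^ 'n \<Rightarrow> 'i \<Rightarrow> real" where
  "crit S pen y m =
     real CARD('n) / 2 *
       ln ((norm (y - orth_proj (S m) y))\<^sup>2 / real (residual_dim (S m)))
     + pen m / 2"

definition chi_square :: "nat \<Rightarrow> real measure" where
  "chi_square k =
     distr (\<Pi>\<^sub>M i\<in>{..<k}. density lborel std_normal_density) borel
       (\<lambda>z. \<Sum>i<k. (z i)\<^sup>2)"

definition fisher :: "nat \<Rightarrow> nat \<Rightarrow> real measure" where
  "fisher D N =
     distr (chi_square D \<Otimes>\<^sub>M chi_square N) borel
       (\<lambda>(u, v). (u / real D) / (v / real N))"

(* Meant for D >= 1 and N >= 3, where the mean is finite and positive. *)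
definition Fish :: "nat \<Rightarrow> nat \<Rightarrow> real \<Rightarrow> real" where
  "Fish D N x =
     (LINT f|fisher D N. max 0 (f - x)) / (LINT f|fisher D N. f)"

definition EFish :: "nat \<Rightarrow> nat \<Rightarrow> real \<Rightarrow> real" where
  "EFish D N q = (THE x. 0 \<le> x \<and> Fish D N x = q)"

definition \<alpha>_min :: "'i set \<Rightarrow> ('i \<Rightarrow> (real ^ 'n) set) \<Rightarrow> real" where
  "\<alpha>_min I S = Min ((\<lambda>m. real (residual_dim (S m)) / real CARD('n)) ` I)"

definition \<Sigma>1 :: "real \<Rightarrow> 'i set \<Rightarrow> ('i \<Rightarrow> (real ^ 'n) set) \<Rightarrow> real" where
  "\<Sigma>1 K2 I S =
     2.5 * exp (1 / (K2\<^sup>2 * \<alpha>_min I S)) * real CARD('n)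
       * exp (- real CARD('n) / (4 * K2\<^sup>2))
       * real (card I) powr (4 / (\<alpha>_min I S * real CARD('n)))"

definition \<Lambda> :: "real \<Rightarrow> real \<Rightarrow> (real ^ 'n) set \<Rightarrow> real \<Rightarrow> real" where
  "\<Lambda> K1 K2 S p =
     Fish (dim S + 1) (residual_dim S - 1)
       ((real (residual_dim S) - 1) / (K1 * real (residual_dim S))
        * ((K2 * real (dim S) + (K2 - 1) * p) / (K2 * (real (dim S) + 1))))"

definition \<Sigma>2 ::
  "real \<Rightarrow> real \<Rightarrow> 'i set \<Rightarrow> ('i \<Rightarrow> (real ^ 'n) set) \<Rightarrow> ('i \<Rightarrow> real) \<Rightarrow> real" where
  "\<Sigma>2 K1 K2 I S pen =
     5 * K1 / 4 * (\<Sum>m\<in>I. (real (dim (S m)) + 1) * \<Lambda> K1 K2 (S m) (pen m))"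

definition penK ::
  "real \<Rightarrow> real \<Rightarrow> ('i \<Rightarrow> (real ^ 'n) set) \<Rightarrow> ('i \<Rightarrow> real) \<Rightarrow> 'i \<Rightarrow> real" where
  "penK K1 K2 S L m =
     K2 / (K2 - 1) *
       max 0
         (K1 * (real (dim (S m)) + 1) * real (residual_dim (S m))
            / (real (residual_dim (S m)) - 1)
          * EFish (dim (S m) + 1) (residual_dim (S m) - 1) (exp (- L m))
          - real (dim (S m)))"

end

theory Submission
  imports Defs "HOL-Real_Asymp.Real_Asymp"
begin

text \<open>
  Penalized selection among Gaussian models with unknown variance, for the Kullback loss.
  After division by \<open>\<sigma>\<close> and in an orthonormal basis adapted to a model of dimension \<open>D\<close>, let
  \<open>W\<close> be the squared length of the residual, \<open>N = n - D\<close>, \<open>b\<close> the bias, \<open>Q\<close> the squared length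
  of the projected noise and \<open>R\<close> that of the whole noise. The loss of the model is
  \<open>(n/2) (ln (W/N) + N/W - 1) + (b\<^sup>2 + Q) N / (2 W)\<close>, and the criterion is the logarithmic
  part plus half of the penalty, up to a constant common to all models.

  The bracket in the loss is nonnegative. So out of a fraction \<open>1/K1\<close> of the loss one may pay
  for \<open>d\<close> times \<open>n/2\<close> times the bracket, for any \<open>d \<le> 1/K2 \<le> 1/K1\<close>. With \<open>d = 1 - R/n\<close> the
  terms in \<open>1/W\<close> then add up to at most \<open>K1 U N / (2 V)\<close>, apart from a constant, where \<open>U\<close> is
  the squared length of the noise in the model enlarged by the bias direction and \<open>V\<close> that of
  the rest. The logarithm is left with the weight \<open>1 - d\<close>, and there the minimality of the
  criterion exchanges the selected model for any fixed model \<open>m\<close>. Half of \<open>D\<close> and of a share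
  \<open>1 - 1/K2\<close> of the penalty stay available against \<open>K1 U N / (2 V)\<close>, which is a multiple of a
  Fisher variable; the expected positive part of the difference is bounded by a summand of the
  second remainder term. This is \<open>kullback_pathwise_bound\<close> with \<open>excess_bound\<close>.

  The condition \<open>d \<le> 1/K2\<close> fails for \<open>d = 1 - R/n\<close> when \<open>R < n (1 - 1/K2)\<close>, an event of
  probability at most \<open>exp (- n / (4 K2\<^sup>2))\<close> (\<open>chi_square_lower_tail\<close>). There \<open>N/W\<close> for the
  selected model is bounded by its maximum over all models, and Hoelder's inequality with
  exponent \<open>p = \<alpha> n / 4\<close> applies (\<open>truncated_maximum_bound\<close>). The moments of \<open>N/W\<close> of that
  order are bounded (\<open>ratio_moment\<close>). This gives the first remainder term.

  It remains to see that \<open>(n/2) ln (W/N)\<close> for the fixed model, weighted by \<open>1 - d\<close> and up to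
  the constant above, has no larger mean than the loss of \<open>m\<close> plus \<open>D/2\<close> and a small error
  (\<open>selection_target\<close>). For \<open>1 - d = R/n\<close> one needs the covariance of \<open>R\<close> and \<open>ln W\<close>. By
  Stein's identity it is \<open>2 (N - 2) E (1/W)\<close> (\<open>log_covariance\<close>), and the same identity gives
  \<open>E (1/W) \<ge> 1 / (N - 2 + b\<^sup>2)\<close> (\<open>inverse_moment_lower\<close>), so that the term in \<open>1/W\<close> of the
  loss compensates it.

  Finally \<open>Fish\<close> is decreasing with inverse \<open>EFish\<close>, and the explicit penalty makes its
  argument at least \<open>EFish\<close> at level \<open>exp (- L m)\<close>, which bounds the second remainder term.
\<close>

section \<open>Rotation invariance of the standard Gaussian law\<close>

abbreviation std_gauss :: "real measure" where
  "std_gauss \<equiv> density lborel std_normal_density"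

abbreviation gauss :: "'i set \<Rightarrow> ('i \<Rightarrow> real) measure" where
  "gauss J \<equiv> Pi\<^sub>M J (\<lambda>_. std_gauss)"

lemma prob_space_std_gauss [simp, intro]: "prob_space std_gauss"
  by (rule prob_space_normal_density) simp

lemma sigma_finite_std_gauss [simp, intro]: "sigma_finite_measure std_gauss"
  by (intro prob_space_imp_sigma_finite prob_space_std_gauss)

interpretation std_gauss: prob_space std_gauss by simp
interpretation gauss: product_prob_space "\<lambda>_. std_gauss" UNIV
  by unfold_locales

lemma prob_space_gauss [simp, intro]: "prob_space (gauss J)"
  by (rule prob_space_PiM) simp

lemma sets_gauss [measurable_cong]: "sets (gauss J) = sets (Pi\<^sub>M J (\<lambda>_. borel))"
  by (rule sets_PiM_cong) simp_all

text \<open>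
  The density form is what links independent coordinates to Lebesgue measure, and
  hence to the rotation invariance proved below.
\<close>

lemma gauss_eq_density:
  assumes "finite J"
  shows "gauss J = density (Pi\<^sub>M J (\<lambda>_. lborel)) (\<lambda>x. \<Prod>j\<in>J. ennreal (std_normal_density (x j)))"
proof (rule gauss.PiM_eqI[symmetric])
  interpret L: product_sigma_finite "\<lambda>_::'a. lborel :: real measure" ..
  show "sets (density (Pi\<^sub>M J (\<lambda>_. lborel)) (\<lambda>x. \<Prod>j\<in>J. ennreal (std_normal_density (x j))))
      = sets (gauss J)"
    unfolding sets_gauss sets_density by (rule sets_PiM_cong) simp_all
  fix A :: "'a \<Rightarrow> real set"
  assume A: "\<And>j. j \<in> J \<Longrightarrow> A j \<in> sets std_gauss"
  have A': "j \<in> J \<Longrightarrow> A j \<in> sets borel" for j using A by simp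
  have P: "Pi\<^sub>E J A \<in> sets (Pi\<^sub>M J (\<lambda>_. lborel))"
    using A' assms by (intro sets_PiM_I_finite) simp_all
  have "emeasure (density (Pi\<^sub>M J (\<lambda>_. lborel)) (\<lambda>x. \<Prod>j\<in>J. ennreal (std_normal_density (x j)))) (Pi\<^sub>E J A)
      = (\<integral>\<^sup>+x. (\<Prod>j\<in>J. ennreal (std_normal_density (x j))) * indicator (Pi\<^sub>E J A) x \<partial>Pi\<^sub>M J (\<lambda>_. lborel))"
    using P by (subst emeasure_density) auto
  also have "\<dots> = (\<integral>\<^sup>+x. (\<Prod>j\<in>J. ennreal (std_normal_density (x j)) * indicator (A j) (x j)) \<partial>Pi\<^sub>M J (\<lambda>_. lborel))"
  proof (rule nn_integral_cong)
    fix x :: "'a \<Rightarrow> real" assume x: "x \<in> space (Pi\<^sub>M J (\<lambda>_. lborel))"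
    have "indicator (Pi\<^sub>E J A) x = (\<Prod>j\<in>J. indicator (A j) (x j) :: ennreal)"
    proof (cases "x \<in> Pi\<^sub>E J A")
      case True
      then have "j \<in> J \<Longrightarrow> x j \<in> A j" for j by auto
      with True show ?thesis by simp
    next
      case False
      then obtain j where "j \<in> J" "x j \<notin> A j"
        using x by (auto simp: space_PiM PiE_def extensional_def)
      with False assms show ?thesis by (simp add: prod_zero_iff) (metis indicator_simps(2))
    qed
    then show "(\<Prod>j\<in>J. ennreal (std_normal_density (x j))) * indicator (Pi\<^sub>E J A) x
        = (\<Prod>j\<in>J. ennreal (std_normal_density (x j)) * indicator (A j) (x j))"
      by (simp add: prod.distrib)
  qed
  also have "\<dots> = (\<Prod>j\<in>J. \<integral>\<^sup>+t. ennreal (std_normal_density t) * indicator (A j) t \<partial>lborel)"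
    using A' by (intro L.product_nn_integral_prod assms) auto
  also have "\<dots> = (\<Prod>j\<in>J. emeasure std_gauss (A j))"
    using A' by (intro prod.cong refl) (simp add: emeasure_density)
  finally show "emeasure (density (Pi\<^sub>M J (\<lambda>_. lborel)) (\<lambda>x. \<Prod>j\<in>J. ennreal (std_normal_density (x j)))) (Pi\<^sub>E J A)
    = (\<Prod>j\<in>J. emeasure std_gauss (A j))" .
qed (use assms in simp_all)

lemma nn_integral_lborel_translate:
  fixes f :: "'a::euclidean_space \<Rightarrow> ennreal"
  assumes [measurable]: "f \<in> borel_measurable borel"
  shows "(\<integral>\<^sup>+x. f (x + c) \<partial>lborel) = (\<integral>\<^sup>+x. f x \<partial>lborel)"
proof -
  have "(\<integral>\<^sup>+x. f x \<partial>lborel) = (\<integral>\<^sup>+x. f x \<partial>distr lborel borel ((+) c))"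
    by (simp add: lborel_distr_plus)
  also have "\<dots> = (\<integral>\<^sup>+x. f (c + x) \<partial>lborel)"
    by (subst nn_integral_distr) auto
  finally show ?thesis by (simp add: add.commute)
qed

text \<open>
  Uniqueness of Haar measure in miniature. For the indicator \<open>f\<close> of the unit ball and any \<open>g\<close>,
  Tonelli and translations turn \<open>(\<integral> f) (\<integral> g)\<close> into
  \<open>(\<integral> g \<circ> T) (\<integral> f)\<close>; this rests on the linearity of \<open>T\<close> and on
  \<open>f\<close> being a function of the norm. Cancelling the volume of the ball gives the claim.
\<close>

lemma lborel_orthogonal_transformation:
  fixes T :: "'a::euclidean_space \<Rightarrow> 'a"
  assumes T: "orthogonal_transformation T"
  shows "distr lborel borel T = lborel"
proof -
  have lin: "linear T" and nT: "\<And>x. norm (T x) = norm x" and bT: "bij T"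
    using T by (auto simp: orthogonal_transformation orthogonal_transformation_bij)
  have [measurable]: "T \<in> borel \<rightarrow>\<^sub>M borel"
    using lin by (simp add: borel_measurable_continuous_onI linear_continuous_on linear_conv_bounded_linear)
  define k :: ennreal where "k = emeasure lborel (ball (0::'a) 1)"
  have k0: "k \<noteq> 0"
    unfolding k_def using emeasure_lborel_ball_finite content_ball_pos[of 1 "0::'a"]
    by (auto simp: measure_def)
  have kfin: "k \<noteq> \<infinity>"
    unfolding k_def using emeasure_lborel_ball_finite[of "0::'a" 1] by auto
  define f :: "'a \<Rightarrow> ennreal" where "f = indicator (ball 0 1)"
  have [measurable]: "f \<in> borel_measurable borel" unfolding f_def by (intro borel_measurable_indicator) simp
  have fT: "f (T x) = f x" for x by (simp add: f_def nT indicator_def)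
  have fsym: "f (x - y) = f (y - x)" for x y by (simp add: f_def indicator_def norm_minus_commute)
  have intf: "(\<integral>\<^sup>+x. f x \<partial>lborel) = k" by (simp add: f_def k_def)
  have eq: "(\<integral>\<^sup>+x. g x \<partial>lborel) = (\<integral>\<^sup>+x. g (T x) \<partial>lborel)"
    if [measurable]: "g \<in> borel_measurable borel" for g :: "'a \<Rightarrow> ennreal"
  proof -
    \<comment> \<open>two translations: first y by T x, then x by the preimage of y under T\<close>
    have "k * (\<integral>\<^sup>+y. g y \<partial>lborel) = (\<integral>\<^sup>+x. f (T x) * (\<integral>\<^sup>+y. g y \<partial>lborel) \<partial>lborel)"
      by (simp add: nn_integral_multc fT intf)
    also have "\<dots> = (\<integral>\<^sup>+x. f (T x) * (\<integral>\<^sup>+y. g (y + T x) \<partial>lborel) \<partial>lborel)"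
      by (simp add: nn_integral_lborel_translate)
    also have "\<dots> = (\<integral>\<^sup>+x. (\<integral>\<^sup>+y. f (T x) * g (y + T x) \<partial>lborel) \<partial>lborel)"
      by (simp add: nn_integral_cmult)
    also have "\<dots> = (\<integral>\<^sup>+y. (\<integral>\<^sup>+x. f (T x) * g (y + T x) \<partial>lborel) \<partial>lborel)"
      by (rule pair_sigma_finite.Fubini') (auto intro!: pair_sigma_finite.intro lborel.sigma_finite_measure_axioms)
    also have "\<dots> = (\<integral>\<^sup>+y. (\<integral>\<^sup>+x. f (T x - y) * g (T x) \<partial>lborel) \<partial>lborel)"
    proof (rule nn_integral_cong)
      fix y :: 'a
      obtain c where c: "T c = y" using bT by (metis bij_pointE)
      have Tc: "T (x + - c) = T x - y" for x using lin c by (simp add: linear_diff)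
      show "(\<integral>\<^sup>+x. f (T x) * g (y + T x) \<partial>lborel) = (\<integral>\<^sup>+x. f (T x - y) * g (T x) \<partial>lborel)"
        using nn_integral_lborel_translate[of "\<lambda>x. f (T x) * g (y + T x)" "- c"]
        unfolding Tc by simp
    qed
    also have "\<dots> = (\<integral>\<^sup>+x. (\<integral>\<^sup>+y. f (T x - y) * g (T x) \<partial>lborel) \<partial>lborel)"
      by (rule pair_sigma_finite.Fubini') (auto intro!: pair_sigma_finite.intro lborel.sigma_finite_measure_axioms)
    also have "\<dots> = (\<integral>\<^sup>+x. (\<integral>\<^sup>+y. f (y + - T x) \<partial>lborel) * g (T x) \<partial>lborel)"
      by (subst fsym) (simp add: nn_integral_multc)
    also have "\<dots> = k * (\<integral>\<^sup>+x. g (T x) \<partial>lborel)"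
      by (subst nn_integral_lborel_translate) (simp_all add: intf nn_integral_cmult)
    finally show ?thesis using k0 kfin by (simp add: ennreal_mult_cancel_left)
  qed
  show ?thesis
  proof (rule measure_eqI)
    fix A assume "A \<in> sets (distr lborel borel T)"
    then have [measurable]: "A \<in> sets borel" by simp
    have "emeasure (distr lborel borel T) A = (\<integral>\<^sup>+x. indicator A x \<partial>distr lborel borel T)" by simp
    also have "\<dots> = (\<integral>\<^sup>+x. indicator A (T x) \<partial>lborel)" by (subst nn_integral_distr) auto
    also have "\<dots> = (\<integral>\<^sup>+x. indicator A x \<partial>lborel)" by (rule eq[symmetric]) simp
    finally show "emeasure (distr lborel borel T) A = emeasure lborel A" by simp
  qed simp
qed

definition gauss_vec :: "'a::euclidean_space measure" where
  "gauss_vec = density lborel (\<lambda>x. ennreal ((1 / sqrt (2 * pi)) ^ DIM('a) * exp (- (norm x)\<^sup>2 / 2)))"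

lemma prod_std_normal_density_Basis:
  fixes x :: "'a::euclidean_space"
  shows "(\<Prod>b\<in>Basis. std_normal_density (x \<bullet> b)) = (1 / sqrt (2 * pi)) ^ DIM('a) * exp (- (norm x)\<^sup>2 / 2)"
proof -
  have "(norm x)\<^sup>2 = (\<Sum>b\<in>Basis. (x \<bullet> b)\<^sup>2)"
    by (subst norm_eq_sqrt_inner, subst euclidean_inner) (simp add: power2_eq_square sum_nonneg)
  then have "exp (- (norm x)\<^sup>2 / 2) = (\<Prod>b\<in>Basis. exp (- (x \<bullet> b)\<^sup>2 / 2))"
    by (simp add: exp_sum[symmetric] sum_divide_distrib sum_negf)
  then show ?thesis
    by (simp add: std_normal_density_def prod.distrib prod_dividef divide_simps)
qed

lemma gauss_Basis_distr:
  "distr (gauss (Basis :: 'a::euclidean_space set)) borel (\<lambda>f. \<Sum>b\<in>Basis. f b *\<^sub>R b) = (gauss_vec :: 'a measure)"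
proof -
  let ?s = "\<lambda>f. \<Sum>b\<in>Basis. f b *\<^sub>R b :: 'a"
  have m: "?s \<in> Pi\<^sub>M Basis (\<lambda>_. lborel) \<rightarrow>\<^sub>M borel" by simp
  have "(gauss_vec :: 'a measure) = density (distr (Pi\<^sub>M Basis (\<lambda>_. lborel)) borel ?s)
      (\<lambda>x. ennreal (\<Prod>b\<in>Basis. std_normal_density (x \<bullet> b)))"
    unfolding gauss_vec_def prod_std_normal_density_Basis lborel_eq[symmetric] ..
  also have "\<dots> = distr (density (Pi\<^sub>M Basis (\<lambda>_. lborel))
      (\<lambda>f. ennreal (\<Prod>b\<in>Basis. std_normal_density (?s f \<bullet> b)))) borel ?s"
    by (rule density_distr[OF _ m]) simp
  also have "(\<lambda>f. ennreal (\<Prod>b\<in>Basis. std_normal_density (?s f \<bullet> b)))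
      = (\<lambda>f. \<Prod>b\<in>Basis. ennreal (std_normal_density (f b)))"
    by (rule ext, subst prod_ennreal) (auto intro!: arg_cong[where f=ennreal] prod.cong)
  finally show ?thesis by (subst gauss_eq_density) simp_all
qed

lemma gauss_vec_orthogonal_transformation:
  fixes T :: "'a::euclidean_space \<Rightarrow> 'a"
  assumes T: "orthogonal_transformation T"
  shows "distr gauss_vec borel T = gauss_vec"
proof -
  have lin: "linear T" and nT: "\<And>x. norm (T x) = norm x"
    using T by (auto simp: orthogonal_transformation)
  have m: "T \<in> lborel \<rightarrow>\<^sub>M borel"
    using lin by (simp add: borel_measurable_continuous_onI linear_continuous_on linear_conv_bounded_linear)
  show ?thesis
    unfolding gauss_vec_def
    by (subst (2) lborel_orthogonal_transformation[OF T, symmetric], subst density_distr[OF _ m])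
       (simp_all add: nT)
qed

lemma orthonormal_expansion:
  fixes e :: "nat \<Rightarrow> 'a::euclidean_space"
  assumes e: "\<And>i j. i < DIM('a) \<Longrightarrow> j < DIM('a) \<Longrightarrow> e i \<bullet> e j = (if i = j then 1 else 0)"
  shows "x = (\<Sum>j<DIM('a). (x \<bullet> e j) *\<^sub>R e j)"
    and "(norm x)\<^sup>2 = (\<Sum>j<DIM('a). (x \<bullet> e j)\<^sup>2)"
proof -
  have einj: "inj_on e {..<DIM('a)}"
    using e by (intro inj_onI) (metis lessThan_iff zero_neq_one)
  have "pairwise orthogonal (e ` {..<DIM('a)})" "0 \<notin> e ` {..<DIM('a)}"
    using e unfolding pairwise_def orthogonal_def by (auto) (metis inner_zero_left zero_neq_one)
  then have "independent (e ` {..<DIM('a)})" by (intro pairwise_orthogonal_independent)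
  then have span_e: "span (e ` {..<DIM('a)}) = UNIV"
    by (intro dim_eq_full[THEN iffD1]) (simp add: dim_span dim_eq_card_independent card_image[OF einj])
  have expand: "x = (\<Sum>j<DIM('a). (x \<bullet> e j) *\<^sub>R e j)" for x
  proof -
    have "orthogonal (x - (\<Sum>j<DIM('a). (x \<bullet> e j) *\<^sub>R e j)) y" if "y \<in> e ` {..<DIM('a)}" for y
    proof -
      from that obtain i where i: "i < DIM('a)" "y = e i" by auto
      have "(\<Sum>j<DIM('a). (x \<bullet> e j) *\<^sub>R e j) \<bullet> e i = (\<Sum>j<DIM('a). if j = i then x \<bullet> e i else 0)"
        unfolding inner_sum_left using i by (intro sum.cong) (auto simp: e)
      then show ?thesis using i by (simp add: orthogonal_def inner_diff_left)
    qed
    then have "orthogonal (x - (\<Sum>j<DIM('a). (x \<bullet> e j) *\<^sub>R e j)) y" for y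
      using orthogonal_to_span[of y "e ` {..<DIM('a)}"] span_e by blast
    then show ?thesis by (metis orthogonal_self eq_iff_diff_eq_0)
  qed
  then show "x = (\<Sum>j<DIM('a). (x \<bullet> e j) *\<^sub>R e j)" .
  have "(norm x)\<^sup>2 = (\<Sum>j<DIM('a). (x \<bullet> e j) *\<^sub>R e j) \<bullet> x"
    using expand[of x] by (metis power2_norm_eq_inner)
  also have "\<dots> = (\<Sum>j<DIM('a). (x \<bullet> e j) * (e j \<bullet> x))" by (simp add: inner_sum_left)
  also have "\<dots> = (\<Sum>j<DIM('a). (x \<bullet> e j)\<^sup>2)"
    by (intro sum.cong refl) (metis inner_commute power2_eq_square)
  finally show "(norm x)\<^sup>2 = (\<Sum>j<DIM('a). (x \<bullet> e j)\<^sup>2)" .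
qed

text \<open>
  Rotation invariance: the map that sends coordinates along \<open>e\<close> to coordinates along the standard
  basis is orthogonal, so it preserves Lebesgue measure, and it preserves the norm, so it preserves
  the density.
\<close>

lemma gauss_vec_orthonormal_coordinates:
  fixes e :: "nat \<Rightarrow> 'a::euclidean_space"
  assumes e: "\<And>i j. i < DIM('a) \<Longrightarrow> j < DIM('a) \<Longrightarrow> e i \<bullet> e j = (if i = j then 1 else 0)"
  shows "distr (gauss_vec :: 'a measure) (Pi\<^sub>M {..<DIM('a)} (\<lambda>_. borel)) (\<lambda>x. \<lambda>j\<in>{..<DIM('a)}. x \<bullet> e j)
     = gauss {..<DIM('a)}"
proof -
  let ?n = "DIM('a)"
  obtain h where h: "bij_betw h {..<?n} (Basis :: 'a set)"
    by (metis atLeast0LessThan ex_bij_betw_nat_finite finite_Basis)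
  have hB: "j < ?n \<Longrightarrow> h j \<in> Basis" for j using h by (auto simp: bij_betw_def)
  have hinj: "inj_on h {..<?n}" using h by (simp add: bij_betw_def)
  have hh: "i < ?n \<Longrightarrow> j < ?n \<Longrightarrow> h i \<bullet> h j = (if i = j then 1 else 0)" for i j
    using hB inj_onD[OF hinj] by (auto simp: inner_Basis)
  have expand: "x = (\<Sum>j<DIM('a). (x \<bullet> e j) *\<^sub>R e j)" for x
    by (rule orthonormal_expansion(1)) (rule e)
  \<comment> \<open>T carries the basis e to an enumeration h of the standard basis\<close>
  define T where "T x = (\<Sum>j<?n. (x \<bullet> e j) *\<^sub>R h j)" for x
  have Th: "T x \<bullet> h j = x \<bullet> e j" if "j < ?n" for x j
  proof -
    have "T x \<bullet> h j = (\<Sum>i<?n. if i = j then x \<bullet> e j else 0)"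
      unfolding T_def inner_sum_left using that by (intro sum.cong) (auto simp: hh)
    then show ?thesis using that by simp
  qed
  have T: "orthogonal_transformation T"
    unfolding orthogonal_transformation_def
  proof
    show "linear T" unfolding T_def
      by (intro linear_compose_sum ballI linear_scaleR_left[THEN linear_compose[unfolded o_def], rotated])
         (auto intro!: linearI simp: inner_left_distrib scaleR_left_distrib sum.distrib)
    show "\<forall>v w. T v \<bullet> T w = v \<bullet> w"
    proof (intro allI)
      fix v w
      have "T v \<bullet> T w = (\<Sum>j<?n. (v \<bullet> e j) * (w \<bullet> e j))"
        unfolding T_def[of v] inner_sum_left
        by (intro sum.cong refl) (metis Th inner_commute inner_scaleR_left lessThan_iff)
      also have "\<dots> = v \<bullet> w"
        unfolding arg_cong[where f="\<lambda>u. u \<bullet> w", OF expand[of v]] inner_sum_left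
        by (intro sum.cong refl) (metis inner_commute inner_scaleR_left)
      finally show "T v \<bullet> T w = v \<bullet> w" .
    qed
  qed
  have mT: "T \<in> gauss_vec \<rightarrow>\<^sub>M borel"
    using T by (simp add: gauss_vec_def borel_measurable_continuous_onI linear_continuous_on
        linear_conv_bounded_linear orthogonal_transformation_def)
  have mh: "(\<lambda>x. \<lambda>j\<in>{..<?n}. x \<bullet> h j) \<in> borel \<rightarrow>\<^sub>M Pi\<^sub>M {..<?n} (\<lambda>_. borel)" by measurable
  have "distr (gauss_vec :: 'a measure) (Pi\<^sub>M {..<?n} (\<lambda>_. borel)) (\<lambda>x. \<lambda>j\<in>{..<?n}. x \<bullet> e j)
     = distr (distr gauss_vec borel T) (Pi\<^sub>M {..<?n} (\<lambda>_. borel)) (\<lambda>x. \<lambda>j\<in>{..<?n}. x \<bullet> h j)"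
    by (subst distr_distr[OF mh mT]) (auto simp: o_def Th intro!: distr_cong)
  also have "\<dots> = distr (distr (gauss Basis) borel (\<lambda>f. \<Sum>b\<in>Basis. f b *\<^sub>R b))
      (Pi\<^sub>M {..<?n} (\<lambda>_. borel)) (\<lambda>x. \<lambda>j\<in>{..<?n}. x \<bullet> h j)"
    unfolding gauss_vec_orthogonal_transformation[OF T] gauss_Basis_distr ..
  also have "\<dots> = distr (gauss Basis) (Pi\<^sub>M {..<?n} (\<lambda>_. borel)) (\<lambda>f. \<lambda>j\<in>{..<?n}. f (h j))"
    by (subst distr_distr[OF mh]) (auto simp: o_def hB intro!: distr_cong)
  also have "\<dots> = distr (gauss Basis) (gauss {..<?n}) (\<lambda>f. \<lambda>j\<in>{..<?n}. f (h j))"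
    by (rule distr_cong) (simp_all add: sets_gauss)
  also have "\<dots> = gauss {..<?n}"
    using hB by (intro distr_PiM_reindex hinj) auto
  finally show ?thesis .
qed

section \<open>One-dimensional Gaussian integrals and slicing\<close>

lemma integrable_std_gauss_iff:
  fixes f :: "real \<Rightarrow> real"
  assumes [measurable]: "f \<in> borel_measurable borel"
  shows "integrable std_gauss f \<longleftrightarrow> integrable lborel (\<lambda>y. std_normal_density y * f y)"
proof -
  have "integrable std_gauss f \<longleftrightarrow> integrable lborel (\<lambda>y. std_normal_density y *\<^sub>R f y)"
    by (rule integrable_density) auto
  then show ?thesis unfolding real_scaleR_def .
qed

lemma integral_std_gauss:
  fixes f :: "real \<Rightarrow> real"
  assumes [measurable]: "f \<in> borel_measurable borel"
  shows "integral\<^sup>L std_gauss f = (\<integral>y. std_normal_density y * f y \<partial>lborel)"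
proof -
  have "integral\<^sup>L std_gauss f = (\<integral>y. std_normal_density y *\<^sub>R f y \<partial>lborel)"
    by (rule integral_density) auto
  then show ?thesis unfolding real_scaleR_def .
qed

lemma std_gauss_power_integrable [simp]: "integrable std_gauss (\<lambda>y. y ^ k)"
  by (subst integrable_std_gauss_iff) (simp_all only: integrable_std_normal_moment, measurable)

lemma std_gauss_power2 [simp]: "(\<integral>y. y\<^sup>2 \<partial>std_gauss) = 1"
proof -
  have "(\<integral>y. y\<^sup>2 \<partial>std_gauss) = (\<integral>y. std_normal_density y * y ^ (2 * 1) \<partial>lborel)"
    by (subst integral_std_gauss) simp_all
  also have "\<dots> = 1"
    unfolding integral_std_normal_moment_even by (simp add: fact_numeral)
  finally show ?thesis .
qed

lemma std_gauss_mean [simp]: "(\<integral>y. y \<partial>std_gauss) = 0" "integrable std_gauss (\<lambda>y. y)"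
proof -
  have "(\<integral>y. y \<partial>std_gauss) = (\<integral>y. std_normal_density y * y ^ (2 * 0 + 1) \<partial>lborel)"
    by (subst integral_std_gauss) simp_all
  also have "\<dots> = 0" by (rule integral_std_normal_moment_odd)
  finally show "(\<integral>y. y \<partial>std_gauss) = 0" .
  show "integrable std_gauss (\<lambda>y. y)"
    using std_gauss_power_integrable[of 1] unfolding power_one_right .
qed

lemma std_gauss_integral_affine:
  fixes f :: "real \<Rightarrow> real"
  assumes [measurable]: "f \<in> borel_measurable borel"
  shows "(\<integral>y. f (y + a) \<partial>std_gauss) = (\<integral>z. std_normal_density (z - a) * f z \<partial>lborel)"
    and "(\<integral>y. f (y + a) \<partial>std_gauss) = (\<integral>z. std_normal_density (z + a) * f (- z) \<partial>lborel)"
    and "integrable std_gauss (\<lambda>y. f (y + a)) \<longleftrightarrow> integrable lborel (\<lambda>z. std_normal_density (z - a) * f z)"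
    and "integrable std_gauss (\<lambda>y. f (y + a)) \<longleftrightarrow> integrable lborel (\<lambda>z. std_normal_density (z + a) * f (- z))"
proof -
  have sym: "std_normal_density (- z - a) = std_normal_density (z + a)" for z
    by (simp add: std_normal_density_def power2_eq_square algebra_simps)
  show "(\<integral>y. f (y + a) \<partial>std_gauss) = (\<integral>z. std_normal_density (z - a) * f z \<partial>lborel)"
    using lborel_integral_real_affine[of 1 "\<lambda>y. std_normal_density y * f (y + a)" "- a"]
    by (subst integral_std_gauss) (auto simp: algebra_simps)
  show "(\<integral>y. f (y + a) \<partial>std_gauss) = (\<integral>z. std_normal_density (z + a) * f (- z) \<partial>lborel)"
    using lborel_integral_real_affine[of "-1" "\<lambda>y. std_normal_density y * f (y + a)" "- a"]
    by (subst integral_std_gauss) (auto simp: sym[symmetric] algebra_simps)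
  show "integrable std_gauss (\<lambda>y. f (y + a)) \<longleftrightarrow> integrable lborel (\<lambda>z. std_normal_density (z - a) * f z)"
    using lborel_integrable_real_affine_iff[of 1 "\<lambda>y. std_normal_density y * f (y + a)" "- a"]
    by (subst integrable_std_gauss_iff) (auto simp: algebra_simps)
  show "integrable std_gauss (\<lambda>y. f (y + a)) \<longleftrightarrow> integrable lborel (\<lambda>z. std_normal_density (z + a) * f (- z))"
    using lborel_integrable_real_affine_iff[of "-1" "\<lambda>y. std_normal_density y * f (y + a)" "- a"]
    by (subst integrable_std_gauss_iff) (auto simp: sym[symmetric] algebra_simps)
qed

text \<open>
  The sign of a Gaussian integral can be read off the even part of the integrand. The two lemmas on
  offset radial functions below apply this in the two natural centrings.
\<close>

lemma std_gauss_symmetrize_nonpos: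
  fixes f :: "real \<Rightarrow> real"
  assumes int: "integrable std_gauss f" and le: "\<And>y. f y + f (- y) \<le> 0"
  shows "(\<integral>y. f y \<partial>std_gauss) \<le> 0"
proof -
  have [measurable]: "f \<in> borel_measurable borel" using int by (auto dest: borel_measurable_integrable)
  note I = std_gauss_integral_affine[of f 0, simplified]
  have "2 * (\<integral>y. f y \<partial>std_gauss) = (\<integral>z. std_normal_density z * f z + std_normal_density z * f (- z) \<partial>lborel)"
    using int I by (subst Bochner_Integration.integral_add) auto
  also have "\<dots> = - (\<integral>z. - (std_normal_density z * (f z + f (- z))) \<partial>lborel)"
    by (subst integral_minus) (simp add: distrib_left)
  also have "\<dots> \<le> 0"
    unfolding neg_le_0_iff_le
    by (rule Bochner_Integration.integral_nonneg) (simp add: le mult_nonneg_nonpos)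
  finally show ?thesis by simp
qed

text \<open>
  If \<open>a * y > 0\<close> then \<open>y + a\<close> is further from the origin than \<open>y - a\<close>, so the
  decreasing weight \<open>h\<close> is smaller where \<open>a * y\<close> is positive.
\<close>

lemma std_gauss_offset_radial_decreasing:
  fixes h :: "real \<Rightarrow> real"
  assumes "integrable std_gauss (\<lambda>y. a * y * h ((y + a)\<^sup>2))"
    and h: "\<And>s t. 0 \<le> s \<Longrightarrow> s \<le> t \<Longrightarrow> h t \<le> h s"
  shows "(\<integral>y. a * y * h ((y + a)\<^sup>2) \<partial>std_gauss) \<le> 0"
proof (rule std_gauss_symmetrize_nonpos[OF assms(1)])
  fix y
  have *: "a * y * h ((y + a)\<^sup>2) + a * (- y) * h ((- y + a)\<^sup>2) = (a * y) * (h ((y + a)\<^sup>2) - h ((y - a)\<^sup>2))"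
    by (simp add: algebra_simps power2_commute)
  have "(a * y) * (h ((y + a)\<^sup>2) - h ((y - a)\<^sup>2)) \<le> 0"
  proof (cases "0 \<le> a * y")
    case True
    then have "(y - a)\<^sup>2 \<le> (y + a)\<^sup>2" by (simp add: power2_eq_square algebra_simps)
    from h[OF _ this] True show ?thesis by (simp add: mult_nonneg_nonpos)
  next
    case False
    then have "(y + a)\<^sup>2 \<le> (y - a)\<^sup>2" by (simp add: power2_eq_square algebra_simps)
    from h[OF _ this] False show ?thesis by (simp add: mult_nonpos_nonneg)
  qed
  with * show "a * y * h ((y + a)\<^sup>2) + a * (- y) * h ((- y + a)\<^sup>2) \<le> 0" by simp
qed

text \<open>
  In the variable \<open>z = y + a\<close> the integrand is odd, while the density \<open>\<phi> (z - a)\<close>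
  puts more mass on the half line where \<open>a * z\<close> is positive.
\<close>

lemma std_gauss_offset_radial_nonneg:
  fixes h :: "real \<Rightarrow> real"
  assumes int: "integrable std_gauss (\<lambda>y. a * (y + a) * h ((y + a)\<^sup>2))"
    and [measurable]: "h \<in> borel_measurable borel"
    and h: "\<And>s. 0 \<le> s \<Longrightarrow> 0 \<le> h s"
  shows "0 \<le> (\<integral>y. a * (y + a) * h ((y + a)\<^sup>2) \<partial>std_gauss)"
proof -
  let ?G = "\<lambda>z. a * z * h (z\<^sup>2)"
  have "?G \<in> borel_measurable borel" by measurable
  note I = std_gauss_integral_affine[OF this, of a]
  have "2 * (\<integral>y. ?G (y + a) \<partial>std_gauss)
      = (\<integral>z. std_normal_density (z - a) * ?G z + std_normal_density (z + a) * ?G (- z) \<partial>lborel)"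
    using int I by (subst Bochner_Integration.integral_add) auto
  also have "0 \<le> \<dots>"
  proof (rule Bochner_Integration.integral_nonneg)
    fix z :: real
    have "std_normal_density (z - a) * ?G z + std_normal_density (z + a) * ?G (- z)
       = h (z\<^sup>2) * ((a * z) * (std_normal_density (z - a) - std_normal_density (z + a)))"
      by (simp add: algebra_simps)
    moreover have "0 \<le> (a * z) * (std_normal_density (z - a) - std_normal_density (z + a))"
    proof (cases "0 \<le> a * z")
      case True
      then have "std_normal_density (z + a) \<le> std_normal_density (z - a)"
        by (auto simp: std_normal_density_def power2_eq_square algebra_simps intro!: divide_right_mono)
      with True show ?thesis by simp
    next
      case False
      then have "std_normal_density (z - a) \<le> std_normal_density (z + a)"
        by (auto simp: std_normal_density_def power2_eq_square algebra_simps intro!: divide_right_mono)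
      with False show ?thesis by (simp add: mult_nonpos_nonpos)
    qed
    ultimately show "0 \<le> std_normal_density (z - a) * ?G z + std_normal_density (z + a) * ?G (- z)"
      using h by simp
  qed
  finally show ?thesis by simp
qed

text \<open>
  Chebyshev's association inequality: replacing \<open>G (y\<^sup>2)\<close> by the constant
  \<open>G 1\<close> can only increase the product, and \<open>y\<^sup>2 - 1\<close> has mean zero.
\<close>

lemma std_gauss_radial_covariance_nonpos:
  fixes G :: "real \<Rightarrow> real"
  assumes int: "integrable std_gauss (\<lambda>y. G (y\<^sup>2) * (y\<^sup>2 - 1))"
    and G: "\<And>s t. 0 \<le> s \<Longrightarrow> s \<le> t \<Longrightarrow> G t \<le> G s"
  shows "(\<integral>y. G (y\<^sup>2) * (y\<^sup>2 - 1) \<partial>std_gauss) \<le> 0"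
proof -
  have "(\<integral>y. G (y\<^sup>2) * (y\<^sup>2 - 1) \<partial>std_gauss) \<le> (\<integral>y. G 1 * (y\<^sup>2 - 1) \<partial>std_gauss)"
  proof (rule integral_mono[OF int])
    fix y :: real
    have "(G (y\<^sup>2) - G 1) * (y\<^sup>2 - 1) \<le> 0"
      using G[of 1 "y\<^sup>2"] G[of "y\<^sup>2" 1] by (cases "1 \<le> y\<^sup>2") (auto simp: mult_nonpos_nonneg mult_nonneg_nonpos)
    then show "G (y\<^sup>2) * (y\<^sup>2 - 1) \<le> G 1 * (y\<^sup>2 - 1)" by (simp add: algebra_simps)
  qed simp
  also have "\<dots> = 0" using std_gauss.prob_space by simp
  finally show ?thesis .
qed

text \<open>
  Stein's identity is the fundamental theorem of calculus for \<open>- g \<phi>\<close>, whose derivative is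
  \<open>(y g - g') \<phi>\<close> because \<open>\<phi>' = - y \<phi>\<close>. The growth bound kills the boundary terms; it admits
  \<open>y * ln\<close> of a quadratic polynomial, which is needed for the logarithm of the residual.
\<close>

lemma std_gauss_stein:
  fixes g g' :: "real \<Rightarrow> real"
  assumes der: "\<And>y. (g has_field_derivative g' y) (at y)"
    and cont: "continuous_on UNIV g'"
    and growth: "\<And>y. \<bar>g y\<bar> \<le> C * (1 + y\<^sup>2)\<^sup>2"
    and int: "integrable std_gauss (\<lambda>y. y * g y - g' y)"
  shows "(\<integral>y. y * g y - g' y \<partial>std_gauss) = 0"
proof -
  have contg: "continuous_on UNIV g"
    using der by (intro continuous_at_imp_continuous_on ballI) (auto dest: DERIV_isCont)
  have [measurable]: "g \<in> borel_measurable borel" "g' \<in> borel_measurable borel"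
    using contg cont by (auto intro: borel_measurable_continuous_onI)
  define k where "k = 1 / sqrt (2 * pi)"
  have "k > 0" by (simp add: k_def)
  let ?\<phi> = "\<lambda>y. k * exp (- y\<^sup>2 / 2) :: real"
  let ?F = "\<lambda>y. - (g y * ?\<phi> y)"
  let ?f = "\<lambda>y. ?\<phi> y * (y * g y - g' y)"
  have int': "integrable lborel ?f"
    using int by (subst (asm) integrable_std_gauss_iff) (auto simp: std_normal_density_def k_def)
  have F: "(?F has_vector_derivative ?f y) (at y)" for y
    unfolding has_real_derivative_iff_has_vector_derivative[symmetric]
    by (auto intro!: derivative_eq_intros der simp: algebra_simps)
  have f: "isCont ?f y" for y
    using cont contg by (auto intro!: continuous_intros simp: continuous_on_eq_continuous_at)
  have bnd: "norm (?F y) \<le> \<bar>C\<bar> * ((1 + y\<^sup>2)\<^sup>2 * ?\<phi> y)" for y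
  proof -
    have "norm (?F y) = \<bar>g y\<bar> * ?\<phi> y" using \<open>k > 0\<close> by (simp add: abs_mult)
    also have "\<dots> \<le> (\<bar>C\<bar> * (1 + y\<^sup>2)\<^sup>2) * ?\<phi> y"
      using \<open>k > 0\<close> by (intro mult_right_mono order_trans[OF growth]) auto
    finally show ?thesis by (simp add: mult.assoc)
  qed
  have top: "((\<lambda>y::real. \<bar>C\<bar> * ((1 + y\<^sup>2)\<^sup>2 * ?\<phi> y)) \<longlongrightarrow> 0) at_top"
    using \<open>k > 0\<close> by real_asymp
  have bot: "((\<lambda>y::real. \<bar>C\<bar> * ((1 + y\<^sup>2)\<^sup>2 * ?\<phi> y)) \<longlongrightarrow> 0) at_bot"
    using \<open>k > 0\<close> by real_asymp
  have "(?F \<longlongrightarrow> 0) at_top" "(?F \<longlongrightarrow> 0) at_bot"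
    using bnd by (auto intro!: Lim_null_comparison[OF _ top] Lim_null_comparison[OF _ bot] always_eventually simp del: norm_minus_cancel)
  then have "((?F \<circ> real_of_ereal) \<longlongrightarrow> 0) (at_left \<infinity>)" "((?F \<circ> real_of_ereal) \<longlongrightarrow> 0) (at_right (-\<infinity>))"
    by (auto simp: ereal_tendsto_simps1)
  then have "(LBINT y=-\<infinity>..\<infinity>. ?f y) = 0 - 0"
    using int' F f by (intro interval_integral_FTC_integrable[where F="?F"]) (auto simp: set_integrable_def)
  then show ?thesis
    by (subst integral_std_gauss) (auto simp: interval_lebesgue_integral_def set_lebesgue_integral_def std_normal_density_def k_def)
qed

text \<open>
  Fubini in one coordinate: it lifts the one-dimensional sign statements and Stein's identity to
  product measures.
\<close>

lemma gauss_slice: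
  fixes f :: "('i \<Rightarrow> real) \<Rightarrow> real"
  assumes J: "finite J" "i \<in> J" and f: "integrable (gauss J) f"
  shows "integral\<^sup>L (gauss J) f = (\<integral>x. (\<integral>y. f (x(i:=y)) \<partial>std_gauss) \<partial>gauss (J - {i}))" (is ?eq)
    and "AE x in gauss (J - {i}). integrable std_gauss (\<lambda>y. f (x(i:=y)))" (is ?ae)
proof -
  have ins: "insert i (J - {i}) = J" using J by auto
  show ?eq
    using gauss.product_integral_insert[of "J - {i}" i f, unfolded ins] J f by simp
  have "(\<integral>\<^sup>+x. ennreal \<bar>f x\<bar> \<partial>gauss J) = (\<integral>\<^sup>+x. (\<integral>\<^sup>+y. ennreal \<bar>f (x(i:=y))\<bar> \<partial>std_gauss) \<partial>gauss (J - {i}))"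
    using gauss.product_nn_integral_insert[of "J - {i}" i "\<lambda>x. ennreal \<bar>f x\<bar>", unfolded ins] J f by simp
  moreover have "(\<integral>\<^sup>+x. ennreal \<bar>f x\<bar> \<partial>gauss J) < \<infinity>"
    using f by (simp add: integrable_iff_bounded)
  ultimately have fin: "(\<integral>\<^sup>+x. (\<integral>\<^sup>+y. ennreal \<bar>f (x(i:=y))\<bar> \<partial>std_gauss) \<partial>gauss (J - {i})) \<noteq> \<infinity>"
    by auto
  have fm: "f \<in> borel_measurable (Pi\<^sub>M (insert i (J - {i})) (\<lambda>_. std_gauss))"
    unfolding ins using f by simp
  then have m: "(\<lambda>(x, y). f (x(i:=y))) \<in> borel_measurable (gauss (J - {i}) \<Otimes>\<^sub>M std_gauss)"
    using measurable_compose[OF measurable_add_dim fm] by (simp add: case_prod_beta)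
  have "AE x in gauss (J - {i}). (\<integral>\<^sup>+y. ennreal \<bar>f (x(i:=y))\<bar> \<partial>std_gauss) \<noteq> \<infinity>"
    using m by (intro nn_integral_PInf_AE fin std_gauss.borel_measurable_nn_integral) (auto simp: case_prod_beta)
  then show ?ae
  proof (rule AE_mp, intro AE_I2 impI)
    fix x assume x: "x \<in> space (gauss (J - {i}))"
      and "(\<integral>\<^sup>+y. ennreal \<bar>f (x(i:=y))\<bar> \<partial>std_gauss) \<noteq> \<infinity>"
    moreover have "(\<lambda>y. f (x(i:=y))) \<in> borel_measurable std_gauss"
      using measurable_Pair2[OF m x] by simp
    ultimately show "integrable std_gauss (\<lambda>y. f (x(i:=y)))"
      by (simp add: integrable_iff_bounded less_top)
  qed
qed

lemma gauss_slice_nonpos: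
  fixes f :: "('i \<Rightarrow> real) \<Rightarrow> real"
  assumes "finite J" "i \<in> J" "integrable (gauss J) f"
    and "\<And>x. integrable std_gauss (\<lambda>y. f (x(i:=y))) \<Longrightarrow> (\<integral>y. f (x(i:=y)) \<partial>std_gauss) \<le> 0"
  shows "integral\<^sup>L (gauss J) f \<le> 0"
proof -
  have "0 \<le> (\<integral>x. - (\<integral>y. f (x(i:=y)) \<partial>std_gauss) \<partial>gauss (J - {i}))"
    by (rule integral_nonneg_AE)
       (use gauss_slice(2)[OF assms(1-3)] assms(4) in \<open>auto elim!: eventually_mono\<close>)
  then show ?thesis using gauss_slice(1)[OF assms(1-3)] by simp
qed

lemma gauss_stein:
  fixes f f' :: "('i \<Rightarrow> real) \<Rightarrow> real"
  assumes J: "finite J" "i \<in> J"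
    and der: "\<And>x y. ((\<lambda>y. f (x(i:=y))) has_field_derivative f' (x(i:=y))) (at y)"
    and cont: "\<And>x. continuous_on UNIV (\<lambda>y. f' (x(i:=y)))"
    and growth: "\<And>x. \<exists>C. \<forall>y. \<bar>f (x(i:=y))\<bar> \<le> C * (1 + y\<^sup>2)\<^sup>2"
    and int: "integrable (gauss J) (\<lambda>x. x i * f x)" "integrable (gauss J) f'"
  shows "(\<integral>x. x i * f x \<partial>gauss J) = (\<integral>x. f' x \<partial>gauss J)"
proof -
  let ?d = "\<lambda>x. x i * f x - f' x"
  have id: "integrable (gauss J) ?d" using int by simp
  have 0: "(\<integral>y. ?d (x(i:=y)) \<partial>std_gauss) = 0" if "integrable std_gauss (\<lambda>y. ?d (x(i:=y)))" for x
  proof -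
    obtain C where "\<forall>y. \<bar>f (x(i:=y))\<bar> \<le> C * (1 + y\<^sup>2)\<^sup>2" using growth by blast
    with that show ?thesis
      using std_gauss_stein[OF der cont, of x C] by simp
  qed
  have "(\<integral>x. ?d x \<partial>gauss J) \<le> 0"
    using 0 by (intro gauss_slice_nonpos[OF J id]) simp
  moreover have "(\<integral>x. - ?d x \<partial>gauss J) \<le> 0"
  proof (rule gauss_slice_nonpos[OF J])
    show "integrable (gauss J) (\<lambda>x. - ?d x)" using id by (rule Bochner_Integration.integrable_minus)
    fix x assume "integrable std_gauss (\<lambda>y. - ?d (x(i:=y)))"
    then have "integrable std_gauss (\<lambda>y. - (- ?d (x(i:=y))))" by (rule Bochner_Integration.integrable_minus)
    then have "integrable std_gauss (\<lambda>y. ?d (x(i:=y)))" unfolding minus_minus .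
    from 0[OF this] show "(\<integral>y. - ?d (x(i:=y)) \<partial>std_gauss) \<le> 0" by (subst integral_minus) simp
  qed
  then have "(\<integral>x. ?d x \<partial>gauss J) \<ge> 0" by (subst (asm) integral_minus) simp
  ultimately have "(\<integral>x. ?d x \<partial>gauss J) = 0" by simp
  then show ?thesis using int by simp
qed

lemma gauss_coord_measurable: "i \<in> J \<Longrightarrow> (\<lambda>x. x i) \<in> borel_measurable (gauss J)"
proof -
  assume "i \<in> J"
  then have "(\<lambda>x. x i) \<in> gauss J \<rightarrow>\<^sub>M std_gauss" by measurable
  then show ?thesis by simp
qed

lemma gauss_component:
  fixes f :: "real \<Rightarrow> real"
  assumes "i \<in> J" "integrable std_gauss f"
  shows "integrable (gauss J) (\<lambda>x. f (x i))" "(\<integral>x. f (x i) \<partial>gauss J) = integral\<^sup>L std_gauss f"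
proof -
  have d: "distr (gauss J) std_gauss (\<lambda>x. x i) = std_gauss"
    using assms by (intro distr_PiM_component) auto
  have m: "(\<lambda>x. x i) \<in> gauss J \<rightarrow>\<^sub>M std_gauss" using assms(1) by measurable
  show "integrable (gauss J) (\<lambda>x. f (x i))"
    using assms(2) by (intro integrable_distr[OF m]) (simp add: d)
  show "(\<integral>x. f (x i) \<partial>gauss J) = integral\<^sup>L std_gauss f"
    using assms(2) integral_distr[OF m, of f] by (auto simp: d dest: borel_measurable_integrable)
qed

section \<open>Inverse moments and logarithms of noncentral chi-square variables\<close>

definition offset_sq :: "'i set \<Rightarrow> ('i \<Rightarrow> real) \<Rightarrow> ('i \<Rightarrow> real) \<Rightarrow> real" where
  "offset_sq P a x = (\<Sum>i\<in>P. (x i + a i)\<^sup>2)"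

lemma offset_sq_nonneg [simp]: "0 \<le> offset_sq P a x"
  by (simp add: offset_sq_def sum_nonneg)

lemma offset_sq_update:
  assumes "finite P"
  shows "i \<in> P \<Longrightarrow> offset_sq P a (x(i:=y)) = (y + a i)\<^sup>2 + offset_sq (P - {i}) a x"
    and "i \<notin> P \<Longrightarrow> offset_sq P a (x(i:=y)) = offset_sq P a x"
proof -
  show "i \<in> P \<Longrightarrow> offset_sq P a (x(i:=y)) = (y + a i)\<^sup>2 + offset_sq (P - {i}) a x"
    unfolding offset_sq_def using assms by (subst sum.remove[of P i]) (auto intro!: sum.cong)
  show "i \<notin> P \<Longrightarrow> offset_sq P a (x(i:=y)) = offset_sq P a x"
    unfolding offset_sq_def by (auto intro!: sum.cong)
qed

lemma coord_sq_le_offset_sq: "finite P \<Longrightarrow> i \<in> P \<Longrightarrow> (x i + a i)\<^sup>2 \<le> offset_sq P a x"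
  unfolding offset_sq_def by (rule member_le_sum) auto

lemma abs_le_one_plus_square: "\<bar>z\<bar> \<le> 1 + z\<^sup>2" for z :: real
proof -
  have "0 \<le> (\<bar>z\<bar> - 1)\<^sup>2" by simp
  then show ?thesis by (simp add: power2_diff)
qed

text \<open>
  Adding \<open>t\<close> keeps the logarithm away from its singularity, so that it is dominated by an
  affine function.
\<close>

lemma abs_ln_shift_le:
  fixes w t :: real
  assumes "0 < t" "0 \<le> w"
  shows "\<bar>ln (w + t)\<bar> \<le> \<bar>ln t\<bar> + w / t"
proof -
  have "ln (w + t) = ln (1 + w / t) + ln t"
  proof -
    have "w + t = (1 + w / t) * t" using assms by (simp add: field_simps)
    moreover have "0 < 1 + w / t" using assms by (simp add: add_pos_nonneg)
    ultimately show ?thesis using assms by (simp add: ln_mult)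
  qed
  moreover have "0 \<le> ln (1 + w / t)" "ln (1 + w / t) \<le> w / t"
    using assms by (auto intro: ln_add_one_self_le_self)
  ultimately show ?thesis by linarith
qed

text \<open>
  Under \<open>gauss J\<close>, the function \<open>W\<close> below is a noncentral chi-square variable with
  \<open>card P\<close> degrees of freedom and noncentrality \<open>A2\<close>. Its inverse moments and its logarithm
  are computed through \<open>W + t\<close> with \<open>t > 0\<close>, for which every function involved is smooth and
  dominated by a polynomial; the limit \<open>t \<rightarrow> 0\<close> is taken at the end. In this way no density of
  \<open>W\<close> is needed.
\<close>

locale offset_gauss =
  fixes J P :: "'i set" and a :: "'i \<Rightarrow> real"
  assumes finite_J: "finite J" and P_sub: "P \<subseteq> J"
begin

abbreviation W :: "('i \<Rightarrow> real) \<Rightarrow> real" where "W \<equiv> offset_sq P a"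
abbreviation N :: real where "N \<equiv> real (card P)"
abbreviation A2 :: real where "A2 \<equiv> (\<Sum>i\<in>P. (a i)\<^sup>2)"

lemma finite_P: "finite P" using finite_J P_sub finite_subset by blast

lemma coord_measurable [measurable]: "i \<in> J \<Longrightarrow> (\<lambda>x. x i) \<in> borel_measurable (gauss J)"
  by (rule gauss_coord_measurable)

lemma W_measurable [measurable]: "W \<in> borel_measurable (gauss J)"
  unfolding offset_sq_def using P_sub by (intro borel_measurable_sum) auto

lemma coord_power_integrable: "i \<in> J \<Longrightarrow> integrable (gauss J) (\<lambda>x. (x i + c) ^ k)"
proof -
  assume i: "i \<in> J"
  have "integrable std_gauss (\<lambda>y. (y + c) ^ k)"
    unfolding binomial_ring by (intro Bochner_Integration.integrable_sum) auto
  from gauss_component(1)[OF i this] show ?thesis .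
qed

lemma coord_power_integrable0: "i \<in> J \<Longrightarrow> integrable (gauss J) (\<lambda>x. x i ^ k)"
  using coord_power_integrable[of i 0 k] by simp

lemma coord_integrable: "i \<in> J \<Longrightarrow> integrable (gauss J) (\<lambda>x. x i)"
  using coord_power_integrable0[of i 1] by simp

lemma W_integrable: "integrable (gauss J) W"
  unfolding offset_sq_def using P_sub by (intro Bochner_Integration.integrable_sum coord_power_integrable) auto

lemma sq_W_integrable: "i \<in> J \<Longrightarrow> integrable (gauss J) (\<lambda>x. (x i)\<^sup>2 * W x)"
  unfolding offset_sq_def sum_distrib_left
proof (intro Bochner_Integration.integrable_sum)
  fix k assume i: "i \<in> J" and "k \<in> P"
  then have k: "k \<in> J" using P_sub by auto
  show "integrable (gauss J) (\<lambda>x. (x i)\<^sup>2 * (x k + a k)\<^sup>2)"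
  proof (rule Bochner_Integration.integrable_bound)
    show "integrable (gauss J) (\<lambda>x. x i ^ 4 + (x k + a k) ^ 4)"
      using i k by (intro Bochner_Integration.integrable_add coord_power_integrable coord_power_integrable0)
    show "AE x in gauss J. norm ((x i)\<^sup>2 * (x k + a k)\<^sup>2) \<le> norm (x i ^ 4 + (x k + a k) ^ 4)"
    proof (rule AE_I2)
      fix x :: "'i \<Rightarrow> real"
      have "u * v \<le> u\<^sup>2 + v\<^sup>2" if "0 \<le> u" "0 \<le> v" for u v :: real
        using sum_squares_bound[of u v] mult_nonneg_nonneg[OF that] by linarith
      from this[of "(x i)\<^sup>2" "(x k + a k)\<^sup>2"] show "norm ((x i)\<^sup>2 * (x k + a k)\<^sup>2) \<le> norm (x i ^ 4 + (x k + a k) ^ 4)"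
        by (simp add: power_mult[symmetric])
    qed
  qed (use i k in measurable)
qed

lemma inverse_power_bounds:
  assumes "0 < t"
  shows "0 \<le> 1 / (W x + t) ^ q" "1 / (W x + t) ^ q \<le> (1 / t) ^ q"
    and "W x / (W x + t) ^ Suc q \<le> 1 / (W x + t) ^ q"
    and "0 \<le> W x / (W x + t) ^ q"
proof -
  have p: "0 < W x + t" using assms by (simp add: add_nonneg_pos)
  show "0 \<le> 1 / (W x + t) ^ q" "0 \<le> W x / (W x + t) ^ q" using p by auto
  show "1 / (W x + t) ^ q \<le> (1 / t) ^ q"
    unfolding power_one_over[symmetric] using assms p by (intro power_mono frac_le) auto
  have "W x / (W x + t) ^ Suc q = (W x / (W x + t)) * (1 / (W x + t) ^ q)" by simp
  also have "\<dots> \<le> 1 * (1 / (W x + t) ^ q)"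
    using assms p by (intro mult_right_mono) auto
  finally show "W x / (W x + t) ^ Suc q \<le> 1 / (W x + t) ^ q" by simp
qed

lemma offset_coord_bound:
  assumes t: "0 < t" and i: "i \<in> P"
  shows "\<bar>(x i + a i) / (W x + t) ^ Suc q\<bar> \<le> (1 + 1 / t) * (1 / t) ^ q"
proof -
  have p: "0 < W x + t" using t by (simp add: add_nonneg_pos)
  have "\<bar>x i + a i\<bar> \<le> 1 + (x i + a i)\<^sup>2" by (rule abs_le_one_plus_square)
  also have "\<dots> \<le> 1 + W x" using coord_sq_le_offset_sq[OF finite_P i, of x a] by simp
  also have "\<dots> \<le> (1 + 1 / t) * (W x + t)"
    using t by (simp add: field_simps)
  finally have b: "\<bar>x i + a i\<bar> / (W x + t) \<le> 1 + 1 / t"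
    using p by (simp add: pos_divide_le_eq)
  have "\<bar>(x i + a i) / (W x + t) ^ Suc q\<bar> = (\<bar>x i + a i\<bar> / (W x + t)) * (1 / (W x + t) ^ q)"
    using p by (simp add: abs_mult)
  also have "\<dots> \<le> (1 + 1 / t) * (1 / t) ^ q"
    using p t b inverse_power_bounds[OF t, of x q] by (intro mult_mono) auto
  finally show ?thesis .
qed

lemma inverse_power_integrable:
  assumes t: "0 < t"
  shows "integrable (gauss J) (\<lambda>x. 1 / (W x + t) ^ q)"
    and "integrable (gauss J) (\<lambda>x. W x / (W x + t) ^ Suc q)"
    and "i \<in> P \<Longrightarrow> integrable (gauss J) (\<lambda>x. (x i + a i) / (W x + t) ^ Suc q)"
    and "i \<in> P \<Longrightarrow> j \<in> J \<Longrightarrow> integrable (gauss J) (\<lambda>x. x j * ((x i + a i) / (W x + t) ^ Suc q))"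
    and "i \<in> P \<Longrightarrow> integrable (gauss J) (\<lambda>x. (x i + a i)\<^sup>2 / (W x + t) ^ Suc q)"
    and "j \<in> J \<Longrightarrow> integrable (gauss J) (\<lambda>x. x j ^ k / (W x + t) ^ q)"
proof -
  interpret G: prob_space "gauss J" by simp
  have PJ: "i \<in> P \<Longrightarrow> i \<in> J" for i using P_sub by auto
  show 1: "integrable (gauss J) (\<lambda>x. 1 / (W x + t) ^ q)" for q
    using inverse_power_bounds[OF t] by (intro G.integrable_const_bound[where B = "(1 / t) ^ q"]) auto
  show 2: "integrable (gauss J) (\<lambda>x. W x / (W x + t) ^ Suc q)" for q
  proof (rule Bochner_Integration.integrable_bound[OF 1[of q]])
    show "AE x in gauss J. norm (W x / (W x + t) ^ Suc q) \<le> norm (1 / (W x + t) ^ q)"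
      using inverse_power_bounds[OF t, of _ q] inverse_power_bounds(4)[OF t, of _ "Suc q"]
      by (intro AE_I2) (simp only: real_norm_def abs_of_nonneg)
  qed measurable
  show 3: "integrable (gauss J) (\<lambda>x. (x i + a i) / (W x + t) ^ Suc q)" if "i \<in> P" for i q
    using offset_coord_bound[OF t that] PJ[OF that]
    by (intro G.integrable_const_bound[where B = "(1 + 1 / t) * (1 / t) ^ q"]) (auto simp del: power_Suc)
  show "integrable (gauss J) (\<lambda>x. x j * ((x i + a i) / (W x + t) ^ Suc q))" if "i \<in> P" "j \<in> J"
  proof (rule Bochner_Integration.integrable_bound)
    show "integrable (gauss J) (\<lambda>x. x j * ((1 + 1 / t) * (1 / t) ^ q))"
      using coord_integrable[OF that(2)] by simp
    show "AE x in gauss J. norm (x j * ((x i + a i) / (W x + t) ^ Suc q)) \<le> norm (x j * ((1 + 1 / t) * (1 / t) ^ q))"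
      unfolding norm_mult[of "_ j"] using t offset_coord_bound[OF t that(1), of _ q]
      by (intro AE_I2 mult_left_mono) (auto simp del: power_Suc simp: real_norm_def abs_mult intro: order_trans[OF _ abs_ge_self])
  qed (use that PJ in measurable)
  show "integrable (gauss J) (\<lambda>x. (x i + a i)\<^sup>2 / (W x + t) ^ Suc q)" if "i \<in> P"
  proof (rule Bochner_Integration.integrable_bound[OF 2[of q]])
    show "AE x in gauss J. norm ((x i + a i)\<^sup>2 / (W x + t) ^ Suc q) \<le> norm (W x / (W x + t) ^ Suc q)"
    proof (rule AE_I2)
      fix x
      have p: "0 < W x + t" using t by (simp add: add_nonneg_pos)
      have "(x i + a i)\<^sup>2 / (W x + t) ^ Suc q \<le> W x / (W x + t) ^ Suc q"
        using p coord_sq_le_offset_sq[OF finite_P that] by (intro divide_right_mono) auto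
      moreover have "0 \<le> (x i + a i)\<^sup>2 / (W x + t) ^ Suc q" using p by simp
      ultimately show "norm ((x i + a i)\<^sup>2 / (W x + t) ^ Suc q) \<le> norm (W x / (W x + t) ^ Suc q)"
        unfolding real_norm_def by linarith
    qed
  qed (use that PJ in measurable)
  show "integrable (gauss J) (\<lambda>x. x j ^ k / (W x + t) ^ q)" if "j \<in> J"
  proof (rule Bochner_Integration.integrable_bound)
    show "integrable (gauss J) (\<lambda>x. x j ^ k * (1 / t) ^ q)"
      using coord_power_integrable0[OF that] by simp
    show "AE x in gauss J. norm (x j ^ k / (W x + t) ^ q) \<le> norm (x j ^ k * (1 / t) ^ q)"
    proof (rule AE_I2)
      fix x
      have "norm (x j ^ k / (W x + t) ^ q) = norm (x j ^ k) * norm (1 / (W x + t) ^ q)"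
        by (simp add: norm_divide norm_power norm_mult)
      also have "\<dots> \<le> norm (x j ^ k) * norm ((1 / t) ^ q)"
        using inverse_power_bounds[OF t, of x q] by (intro mult_left_mono) auto
      finally show "norm (x j ^ k / (W x + t) ^ q) \<le> norm (x j ^ k * (1 / t) ^ q)" by (simp add: norm_mult)
    qed
  qed (use that in measurable)
qed

lemma offset_pos: "0 < t \<Longrightarrow> W x + t > 0"
  by (simp add: add_nonneg_pos)

text \<open>
  Stein's identity for the field \<open>(x + a) / (W + t)^(q+1)\<close>, one coordinate at a time; summed over
  \<open>P\<close> it computes the divergence of that field.
\<close>

lemma stein_inverse_power:
  assumes t: "0 < t" and i: "i \<in> P"
  shows "(\<integral>x. x i * ((x i + a i) / (W x + t) ^ Suc q) \<partial>gauss J)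
    = (\<integral>x. 1 / (W x + t) ^ Suc q - 2 * (1 + real q) * ((x i + a i)\<^sup>2 / (W x + t) ^ Suc (Suc q)) \<partial>gauss J)"
proof (rule gauss_stein)
  show "i \<in> J" using i P_sub by auto
  show "((\<lambda>y. ((x(i:=y)) i + a i) / (W (x(i:=y)) + t) ^ Suc q) has_field_derivative
      1 / (W (x(i:=y)) + t) ^ Suc q - 2 * (1 + real q) * (((x(i:=y)) i + a i)\<^sup>2 / (W (x(i:=y)) + t) ^ Suc (Suc q))) (at y)" for x y
  proof -
    define c where "c = offset_sq (P - {i}) a x + t"
    have c: "c > 0" unfolding c_def using t by (simp add: add_nonneg_pos)
    have Wc: "W (x(i:=y)) + t = (y + a i)\<^sup>2 + c" for y
      unfolding c_def offset_sq_update(1)[OF finite_P i] by simp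
    have pos: "(y + a i)\<^sup>2 + c > 0" for y using c by (simp add: add_nonneg_pos)
    have "((\<lambda>y. (y + a i) / ((y + a i)\<^sup>2 + c) ^ Suc q) has_field_derivative
       ((1 * ((y + a i)\<^sup>2 + c) ^ Suc q - (y + a i) * (real (Suc q) * ((y + a i)\<^sup>2 + c) ^ q * (2 * (y + a i)))) /
        (((y + a i)\<^sup>2 + c) ^ Suc q * ((y + a i)\<^sup>2 + c) ^ Suc q))) (at y)"
      using pos[of y] by (auto intro!: derivative_eq_intros simp del: power_Suc simp: power2_eq_square)
    moreover have "((1 * ((y + a i)\<^sup>2 + c) ^ Suc q - (y + a i) * (real (Suc q) * ((y + a i)\<^sup>2 + c) ^ q * (2 * (y + a i)))) /
        (((y + a i)\<^sup>2 + c) ^ Suc q * ((y + a i)\<^sup>2 + c) ^ Suc q))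
      = 1 / ((y + a i)\<^sup>2 + c) ^ Suc q - 2 * (1 + real q) * ((y + a i)\<^sup>2 / ((y + a i)\<^sup>2 + c) ^ Suc (Suc q))"
    proof -
      define w where "w = (y + a i)\<^sup>2 + c"
      have w: "w \<noteq> 0" using pos[of y] by (simp add: w_def)
      show ?thesis unfolding w_def[symmetric] using w
        by (simp add: divide_simps power2_eq_square) (simp add: algebra_simps)
    qed
    ultimately show ?thesis unfolding Wc by simp
  qed
  show "continuous_on UNIV (\<lambda>y. 1 / (W (x(i:=y)) + t) ^ Suc q - 2 * (1 + real q) * (((x(i:=y)) i + a i)\<^sup>2 / (W (x(i:=y)) + t) ^ Suc (Suc q)))" for x
    using t unfolding offset_sq_update(1)[OF finite_P i]
    by (auto intro!: continuous_intros simp del: power_Suc) (metis add.assoc add_nonneg_pos offset_sq_nonneg add_nonneg_nonneg zero_le_power2 less_irrefl)+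
  show "\<exists>C. \<forall>y. \<bar>((x(i:=y)) i + a i) / (W (x(i:=y)) + t) ^ Suc q\<bar> \<le> C * (1 + y\<^sup>2)\<^sup>2" for x
  proof (intro exI allI)
    fix y
    have "\<bar>((x(i:=y)) i + a i) / (W (x(i:=y)) + t) ^ Suc q\<bar> \<le> (1 + 1 / t) * (1 / t) ^ q * 1"
      using offset_coord_bound[OF t i, of "x(i:=y)" q] by simp
    also have "\<dots> \<le> (1 + 1 / t) * (1 / t) ^ q * (1 + y\<^sup>2)\<^sup>2"
      using t by (intro mult_left_mono) auto
    finally show "\<bar>((x(i:=y)) i + a i) / (W (x(i:=y)) + t) ^ Suc q\<bar> \<le> (1 + 1 / t) * (1 / t) ^ q * (1 + y\<^sup>2)\<^sup>2" .
  qed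
  show "integrable (gauss J) (\<lambda>x. x i * ((x i + a i) / (W x + t) ^ Suc q))"
    using i P_sub by (intro inverse_power_integrable t) auto
  show "integrable (gauss J) (\<lambda>x. 1 / (W x + t) ^ Suc q - 2 * (1 + real q) * ((x i + a i)\<^sup>2 / (W x + t) ^ Suc (Suc q)))"
    using i by (intro Bochner_Integration.integrable_diff integrable_mult_right inverse_power_integrable t) auto
qed (rule finite_J)

lemma sum_offset_sq_quotient: "(\<Sum>i\<in>P. (x i + a i)\<^sup>2 / r) = W x / r"
  by (simp add: offset_sq_def sum_divide_distrib)

lemma stein_inverse_power_sum:
  assumes t: "0 < t"
  shows "(\<Sum>i\<in>P. \<integral>x. x i * ((x i + a i) / (W x + t) ^ Suc q) \<partial>gauss J)
    = N * (\<integral>x. 1 / (W x + t) ^ Suc q \<partial>gauss J) - 2 * (1 + real q) * (\<integral>x. W x / (W x + t) ^ Suc (Suc q) \<partial>gauss J)"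
proof -
  note int = inverse_power_integrable[OF t]
  let ?c = "\<integral>x. 1 / (W x + t) ^ Suc q \<partial>gauss J"
  let ?v = "\<lambda>i. \<integral>x. (x i + a i)\<^sup>2 / (W x + t) ^ Suc (Suc q) \<partial>gauss J"
  have "(\<integral>x. x i * ((x i + a i) / (W x + t) ^ Suc q) \<partial>gauss J) = ?c - 2 * (1 + real q) * ?v i"
    if i: "i \<in> P" for i
    unfolding stein_inverse_power[OF t i]
    by (subst Bochner_Integration.integral_diff[OF int(1) integrable_mult_right[OF int(5)[OF i]]])
       (simp only: integral_mult_right_zero)
  then have "(\<Sum>i\<in>P. \<integral>x. x i * ((x i + a i) / (W x + t) ^ Suc q) \<partial>gauss J)
      = N * ?c - 2 * (1 + real q) * (\<Sum>i\<in>P. ?v i)"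
    by (simp add: sum_subtractf sum_distrib_left del: power_Suc)
  also have "(\<Sum>i\<in>P. ?v i) = (\<integral>x. W x / (W x + t) ^ Suc (Suc q) \<partial>gauss J)"
    by (subst Bochner_Integration.integral_sum[symmetric, OF int(5)]) (simp_all only: sum_offset_sq_quotient)
  finally show ?thesis .
qed

text \<open>
  The left-hand side is the one of the preceding lemma, rewritten with \<open>x = (x + a) - a\<close>.
  Comparing the two right-hand sides is what produces all bounds on inverse moments.
\<close>

lemma stein_sum_decomposition:
  assumes t: "0 < t"
  shows "(\<Sum>i\<in>P. \<integral>x. x i * ((x i + a i) / (W x + t) ^ Suc q) \<partial>gauss J)
      = (\<integral>x. W x / (W x + t) ^ Suc q \<partial>gauss J)
        - (\<Sum>i\<in>P. \<integral>x. a i * ((x i + a i) / (W x + t) ^ Suc q) \<partial>gauss J)"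
proof -
  note int = inverse_power_integrable[OF t]
  let ?v = "\<lambda>i. \<integral>x. (x i + a i)\<^sup>2 / (W x + t) ^ Suc q \<partial>gauss J"
  have eq: "x i * ((x i + a i) / (W x + t) ^ Suc q)
      = (x i + a i)\<^sup>2 / (W x + t) ^ Suc q - a i * ((x i + a i) / (W x + t) ^ Suc q)" for x i
    by (simp only: times_divide_eq_right diff_divide_distrib[symmetric])
       (simp add: power2_eq_square algebra_simps del: power_Suc)
  have "(\<integral>x. x i * ((x i + a i) / (W x + t) ^ Suc q) \<partial>gauss J)
      = ?v i - (\<integral>x. a i * ((x i + a i) / (W x + t) ^ Suc q) \<partial>gauss J)" if i: "i \<in> P" for i
    unfolding eq by (rule Bochner_Integration.integral_diff[OF int(5)[OF i] integrable_mult_right[OF int(3)[OF i]]])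
  then have "(\<Sum>i\<in>P. \<integral>x. x i * ((x i + a i) / (W x + t) ^ Suc q) \<partial>gauss J)
     = (\<Sum>i\<in>P. ?v i) - (\<Sum>i\<in>P. \<integral>x. a i * ((x i + a i) / (W x + t) ^ Suc q) \<partial>gauss J)"
    by (simp only: sum_subtractf cong: sum.cong)
  also have "(\<Sum>i\<in>P. ?v i) = (\<integral>x. W x / (W x + t) ^ Suc q \<partial>gauss J)"
    by (subst Bochner_Integration.integral_sum[symmetric, OF int(5)]) (simp_all only: sum_offset_sq_quotient)
  finally show ?thesis .
qed

text \<open>
  The shifted coordinate \<open>x i + a i\<close> is on average on the side of \<open>a i\<close>, for any weight that
  depends on it through its square. This gives upper bounds for the inverse moments: noncentrality only decreases them.
\<close>

lemma drift_nonneg: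
  assumes t: "0 < t" and i: "i \<in> P"
  shows "0 \<le> (\<integral>x. a i * ((x i + a i) / (W x + t) ^ Suc q) \<partial>gauss J)"
proof -
  have iJ: "i \<in> J" using i P_sub by auto
  have "(\<integral>x. - (a i * ((x i + a i) / (W x + t) ^ Suc q)) \<partial>gauss J) \<le> 0"
  proof (rule gauss_slice_nonpos[OF finite_J iJ])
    show "integrable (gauss J) (\<lambda>x. - (a i * ((x i + a i) / (W x + t) ^ Suc q)))"
      using i by (intro Bochner_Integration.integrable_minus integrable_mult_right inverse_power_integrable t)
    fix x assume I: "integrable std_gauss (\<lambda>y. - (a i * (((x(i:=y)) i + a i) / (W (x(i:=y)) + t) ^ Suc q)))"
    define h where "h s = 1 / (\<bar>s\<bar> + (offset_sq (P - {i}) a x + t)) ^ Suc q" for s :: real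
    have eq: "a i * (((x(i:=y)) i + a i) / (W (x(i:=y)) + t) ^ Suc q) = a i * (y + a i) * h ((y + a i)\<^sup>2)" for y
      unfolding h_def offset_sq_update(1)[OF finite_P i] by (simp add: add.assoc)
    have I': "integrable std_gauss (\<lambda>y. a i * (y + a i) * h ((y + a i)\<^sup>2))"
      using Bochner_Integration.integrable_minus[OF I] unfolding eq minus_minus .
    have m: "h \<in> borel_measurable borel" unfolding h_def by measurable
    have "0 \<le> (\<integral>y. a i * (y + a i) * h ((y + a i)\<^sup>2) \<partial>std_gauss)"
      by (rule std_gauss_offset_radial_nonneg[OF I' m]) (use t in \<open>auto simp: h_def\<close>)
    then show "(\<integral>y. - (a i * (((x(i:=y)) i + a i) / (W (x(i:=y)) + t) ^ Suc q)) \<partial>std_gauss) \<le> 0"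
      unfolding eq by (subst integral_minus) simp
  qed
  then show ?thesis by (subst (asm) integral_minus) simp
qed

text \<open>
  The recursion of the central chi-square moments, as an inequality. The left-hand
  coefficient is \<open>N\<close> from the divergence minus \<open>2 (q + 1)\<close> from differentiating the
  power.
\<close>

lemma inverse_moment_step:
  assumes t: "0 < t"
  shows "(N - 2 * real (Suc q)) * (\<integral>x. 1 / (W x + t) ^ Suc q \<partial>gauss J) \<le> (\<integral>x. 1 / (W x + t) ^ q \<partial>gauss J)"
proof -
  note int = inverse_power_integrable[OF t]
  let ?c = "\<integral>x. 1 / (W x + t) ^ Suc q \<partial>gauss J"
  let ?w = "\<lambda>q. \<integral>x. W x / (W x + t) ^ Suc q \<partial>gauss J"
  have w1: "?w (Suc q) \<le> ?c"
    using inverse_power_bounds(3)[OF t, of _ "Suc q"] by (intro integral_mono int)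
  have w0: "?w q \<le> (\<integral>x. 1 / (W x + t) ^ q \<partial>gauss J)"
    using inverse_power_bounds(3)[OF t, of _ q] by (intro integral_mono int)
  have "0 \<le> (\<Sum>i\<in>P. \<integral>x. a i * ((x i + a i) / (W x + t) ^ Suc q) \<partial>gauss J)"
    by (intro sum_nonneg drift_nonneg t)
  then have "N * ?c - 2 * (1 + real q) * ?w (Suc q) \<le> ?w q"
    using stein_inverse_power_sum[OF t, of q] stein_sum_decomposition[OF t, of q] by linarith
  moreover have "2 * (1 + real q) * ?w (Suc q) \<le> 2 * (1 + real q) * ?c"
    using w1 by (intro mult_left_mono) auto
  ultimately have "N * ?c - 2 * (1 + real q) * ?c \<le> (\<integral>x. 1 / (W x + t) ^ q \<partial>gauss J)"
    using w0 by linarith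
  then show ?thesis by (simp add: left_diff_distrib del: power_Suc)
qed

lemma inverse_moment_shift_bound:
  assumes t: "0 < t" and q: "2 * real q < N"
  shows "(\<integral>x. 1 / (W x + t) ^ q \<partial>gauss J) \<le> (\<Prod>j=1..q. 1 / (N - 2 * real j))"
  using q
proof (induction q)
  case 0
  interpret G: prob_space "gauss J" by simp
  show ?case using G.prob_space by simp
next
  case (Suc q)
  let ?c = "\<lambda>q. \<integral>x. 1 / (W x + t) ^ q \<partial>gauss J"
  have pos: "0 < N - 2 * real (Suc q)" using Suc.prems by simp
  have "(N - 2 * real (Suc q)) * ?c (Suc q) \<le> ?c q" by (rule inverse_moment_step[OF t])
  also have "\<dots> \<le> (\<Prod>j=1..q. 1 / (N - 2 * real j))" using Suc by simp
  finally have "?c (Suc q) \<le> (\<Prod>j=1..q. 1 / (N - 2 * real j)) / (N - 2 * real (Suc q))"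
    using pos by (subst pos_le_divide_eq) (simp_all add: mult.commute del: power_Suc)
  then show ?case by (simp del: power_Suc)
qed

lemma AE_W_pos:
  assumes "P \<noteq> {}"
  shows "AE x in gauss J. 0 < W x"
proof -
  obtain i where i: "i \<in> P" using assms by auto
  then have iJ: "i \<in> J" using P_sub by auto
  have "AE y in std_gauss. y \<noteq> - a i"
    by (subst AE_density) (auto intro: AE_mp[OF AE_lborel_singleton[of "- a i"]])
  then have "AE x in gauss J. x i \<noteq> - a i"
    using iJ by (intro AE_PiM_component[where P = "\<lambda>y. y \<noteq> - a i"]) auto
  then show ?thesis
  proof eventually_elim
    case (elim x)
    then have "0 < (x i + a i)\<^sup>2" by (simp add: add_eq_0_iff2)
    then show ?case using coord_sq_le_offset_sq[OF finite_P i, of x a] by linarith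
  qed
qed

text \<open>
  Monotone convergence as \<open>t = 1 / (k + 1)\<close> decreases to zero: uniform bounds on the shifted
  moments give integrability, convergence and the bound for the moment itself.
\<close>

lemma shift_limit:
  fixes g :: "('i \<Rightarrow> real) \<Rightarrow> real"
  assumes P: "P \<noteq> {}" and [measurable]: "g \<in> borel_measurable (gauss J)" and g: "\<And>x. 0 \<le> g x"
    and int: "\<And>t. 0 < t \<Longrightarrow> integrable (gauss J) (\<lambda>x. g x / (W x + t) ^ q)"
    and bound: "\<And>t. 0 < t \<Longrightarrow> (\<integral>x. g x / (W x + t) ^ q \<partial>gauss J) \<le> B"
  shows "integrable (gauss J) (\<lambda>x. g x / W x ^ q)"
    and "(\<lambda>k. \<integral>x. g x / (W x + 1 / real (Suc k)) ^ q \<partial>gauss J) \<longlonglongrightarrow> (\<integral>x. g x / W x ^ q \<partial>gauss J)"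
    and "(\<integral>x. g x / W x ^ q \<partial>gauss J) \<le> B"
proof -
  let ?f = "\<lambda>k x. g x / (W x + 1 / real (Suc k)) ^ q"
  have t: "0 < 1 / real (Suc k)" for k by simp
  have anti: "?f k x \<le> ?f l x" if "k \<le> l" for k l x
  proof -
    have p: "0 < W x + 1 / real (Suc l)" by (rule offset_pos[OF t])
    have "1 / real (Suc l) \<le> 1 / real (Suc k)" using that by (simp add: frac_le)
    then show ?thesis using p g by (intro divide_left_mono power_mono mult_pos_pos zero_less_power) (auto simp: offset_pos)
  qed
  have "incseq (\<lambda>k. integral\<^sup>L (gauss J) (?f k))"
    by (intro incseq_SucI integral_mono int t anti) simp
  from incseq_convergent[OF this, of B] bound[OF t]
  obtain L where L: "(\<lambda>k. integral\<^sup>L (gauss J) (?f k)) \<longlonglongrightarrow> L" by blast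
  have lim: "AE x in gauss J. (\<lambda>k. ?f k x) \<longlonglongrightarrow> g x / W x ^ q"
    using AE_W_pos[OF P]
  proof eventually_elim
    case (elim x)
    have "(\<lambda>k. W x + 1 / real (Suc k)) \<longlonglongrightarrow> W x + 0"
      by (intro tendsto_add tendsto_const LIMSEQ_Suc[OF lim_1_over_n])
    with elim show ?case by (intro tendsto_divide tendsto_power tendsto_const) auto
  qed
  have mono: "AE x in gauss J. mono (\<lambda>k. ?f k x)" by (intro AE_I2 monoI anti)
  have nn: "\<And>k. AE x in gauss J. 0 \<le> ?f k x"
    using g offset_pos[OF t] by (intro AE_I2 divide_nonneg_nonneg zero_le_power) (auto intro: less_imp_le)
  have m: "(\<lambda>x. g x / W x ^ q) \<in> borel_measurable (gauss J)" by measurable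
  note * = integral_monotone_convergence_nonneg[OF int[OF t] mono nn lim L m]
  show "integrable (gauss J) (\<lambda>x. g x / W x ^ q)" by (rule *(1))
  show "(\<lambda>k. integral\<^sup>L (gauss J) (?f k)) \<longlonglongrightarrow> (\<integral>x. g x / W x ^ q \<partial>gauss J)"
    using L *(2) by simp
  then show "(\<integral>x. g x / W x ^ q \<partial>gauss J) \<le> B"
    by (rule LIMSEQ_le_const2) (use bound[OF t] in auto)
qed

lemma inverse_moment:
  assumes q: "2 * real q < N" and P: "P \<noteq> {}"
  shows "integrable (gauss J) (\<lambda>x. 1 / W x ^ q)"
    and "(\<integral>x. 1 / W x ^ q \<partial>gauss J) \<le> (\<Prod>j=1..q. 1 / (N - 2 * real j))"
  using shift_limit[OF P, of "\<lambda>_. 1" q] inverse_power_integrable(1) inverse_moment_shift_bound[OF _ q] by auto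

text \<open>
  The counterpart of \<open>drift_nonneg\<close> with \<open>x i\<close> in place of \<open>x i + a i\<close>. It has the
  opposite sign and gives the lower bound on \<open>E (1 / W)\<close>.
\<close>

lemma stein_drift:
  assumes t: "0 < t" and i: "i \<in> P"
  shows "(\<integral>x. a i * (x i / (W x + t)) \<partial>gauss J) \<le> 0"
proof (rule gauss_slice_nonpos[OF finite_J])
  show iJ: "i \<in> J" using i P_sub by auto
  show "integrable (gauss J) (\<lambda>x. a i * (x i / (W x + t)))"
    using inverse_power_integrable(6)[OF t iJ, of 1 1] by (intro integrable_mult_right) simp
  fix x assume I: "integrable std_gauss (\<lambda>y. a i * ((x(i:=y)) i / (W (x(i:=y)) + t)))"
  define h where "h s = 1 / (\<bar>s\<bar> + (offset_sq (P - {i}) a x + t))" for s :: real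
  have eq: "a i * ((x(i:=y)) i / (W (x(i:=y)) + t)) = a i * y * h ((y + a i)\<^sup>2)" for y
    unfolding h_def offset_sq_update(1)[OF finite_P i] by (simp add: add.assoc)
  have h: "h v \<le> h u" if "0 \<le> u" "u \<le> v" for u v
  proof -
    have "0 < offset_sq (P - {i}) a x + t" using t by (simp add: add_nonneg_pos)
    with that show ?thesis unfolding h_def by (intro divide_left_mono mult_pos_pos) auto
  qed
  show "(\<integral>y. a i * ((x(i:=y)) i / (W (x(i:=y)) + t)) \<partial>std_gauss) \<le> 0"
    using std_gauss_offset_radial_decreasing[OF I[unfolded eq] h] unfolding eq .
qed

lemma shifted_moment_limits:
  assumes N: "2 < N"
  shows "(\<lambda>k. \<integral>x. 1 / (W x + 1 / real (Suc k)) \<partial>gauss J) \<longlonglongrightarrow> (\<integral>x. 1 / W x \<partial>gauss J)"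
    and "(\<lambda>k. \<integral>x. W x / (W x + 1 / real (Suc k))\<^sup>2 \<partial>gauss J) \<longlonglongrightarrow> (\<integral>x. 1 / W x \<partial>gauss J)"
proof -
  have P: "P \<noteq> {}" using N by auto
  have bound1: "(\<integral>x. 1 / (W x + s) \<partial>gauss J) \<le> 1 / (N - 2)" if "0 < s" for s
    using inverse_moment_shift_bound[OF that, of 1] N by simp
  show "(\<lambda>k. \<integral>x. 1 / (W x + 1 / real (Suc k)) \<partial>gauss J) \<longlonglongrightarrow> (\<integral>x. 1 / W x \<partial>gauss J)"
    using shift_limit(2)[OF P, of "\<lambda>_. 1" 1 "1 / (N - 2)"] inverse_power_integrable(1)[of _ 1] bound1
    by simp
  have "(\<integral>x. W x / (W x + s)\<^sup>2 \<partial>gauss J) \<le> 1 / (N - 2)" if s: "0 < s" for s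
  proof -
    have "(\<integral>x. W x / (W x + s)\<^sup>2 \<partial>gauss J) \<le> (\<integral>x. 1 / (W x + s) \<partial>gauss J)"
      using inverse_power_bounds(3)[OF s, of _ 1] inverse_power_integrable(1,2)[OF s, of 1]
      by (intro integral_mono) (auto simp: numeral_2_eq_2)
    then show ?thesis using bound1[OF s] by simp
  qed
  then have "(\<lambda>k. \<integral>x. W x / (W x + 1 / real (Suc k))\<^sup>2 \<partial>gauss J) \<longlonglongrightarrow> (\<integral>x. W x / (W x)\<^sup>2 \<partial>gauss J)"
    using shift_limit(2)[OF P, of W 2 "1 / (N - 2)"] inverse_power_integrable(2)[of _ 1]
    by (simp add: numeral_2_eq_2)
  moreover have eq: "W x / (W x)\<^sup>2 = 1 / W x" for x by (simp add: power2_eq_square)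
  ultimately show "(\<lambda>k. \<integral>x. W x / (W x + 1 / real (Suc k))\<^sup>2 \<partial>gauss J) \<longlonglongrightarrow> (\<integral>x. 1 / W x \<partial>gauss J)"
    unfolding eq by blast
qed

text \<open>
  Jensen would only give \<open>E (1 / W) \<ge> 1 / (N + A2)\<close>, the reciprocal of the mean of \<open>W\<close>. The
  improvement by \<open>2\<close>
  is needed to compensate the covariance between the noise level and the logarithm of the residual,
  already for a model of dimension zero.
\<close>

lemma inverse_moment_lower:
  assumes N: "2 < N"
  shows "1 \<le> (N - 2 + A2) * (\<integral>x. 1 / W x \<partial>gauss J)"
proof -
  have P: "P \<noteq> {}" using N by auto
  interpret G: prob_space "gauss J" by simp
  let ?t = "\<lambda>k. 1 / real (Suc k)"
  have t: "0 < ?t k" for k by simp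
  define c where "c = (\<integral>x. 1 / W x \<partial>gauss J)"
  define c' where "c' k = (\<integral>x. 1 / (W x + ?t k) \<partial>gauss J)" for k
  define w where "w k = (\<integral>x. W x / (W x + ?t k) \<partial>gauss J)" for k
  define v where "v k = (\<integral>x. W x / (W x + ?t k)\<^sup>2 \<partial>gauss J)" for k
  have lim_c: "c' \<longlonglongrightarrow> c" and lim_v: "v \<longlonglongrightarrow> c"
    using shifted_moment_limits[OF N] by (simp_all only: c_def c'_def[abs_def] v_def[abs_def])
  have lim_w: "w \<longlonglongrightarrow> 1"
  proof -
    have "(\<integral>x. W x / (W x + s) \<partial>gauss J) \<le> 1" if "0 < s" for s
      using inverse_power_bounds(3)[OF that, of _ 0] inverse_power_integrable(2)[OF that, of 0] G.prob_space
        integral_mono[of "gauss J" "\<lambda>x. W x / (W x + s)" "\<lambda>_. 1"] by simp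
    then have "w \<longlonglongrightarrow> (\<integral>x. W x / W x \<partial>gauss J)"
      using shift_limit(2)[OF P, of W 1 1] inverse_power_integrable(2)[of _ 0] by (simp add: w_def[abs_def])
    also have "(\<integral>x. W x / W x \<partial>gauss J) = (\<integral>x. 1 \<partial>gauss J)"
      by (rule integral_cong_AE) (use AE_W_pos[OF P] in \<open>auto elim!: eventually_mono\<close>)
    finally show ?thesis using G.prob_space by simp
  qed
  \<comment> \<open>both expressions for the same Stein sum, with the cross terms a i * x i dropped by their sign\<close>
  have "w k \<le> N * c' k - 2 * v k + A2 * c' k" for k
  proof -
    note int = inverse_power_integrable[OF t[of k]]
    have ix: "integrable (gauss J) (\<lambda>x. a i * (x i / (W x + ?t k)))" if "i \<in> P" for i
      using int(6)[of i 1 1] that P_sub by (intro integrable_mult_right) auto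
    have "(\<integral>x. a i * ((x i + a i) / (W x + ?t k)) \<partial>gauss J) \<le> (a i)\<^sup>2 * c' k" if i: "i \<in> P" for i
    proof -
      have "(\<integral>x. a i * ((x i + a i) / (W x + ?t k)) \<partial>gauss J)
         = (\<integral>x. a i * (x i / (W x + ?t k)) + (a i)\<^sup>2 * (1 / (W x + ?t k)) \<partial>gauss J)"
        by (rule Bochner_Integration.integral_cong) (auto simp: power2_eq_square add_divide_distrib distrib_left)
      also have "\<dots> = (\<integral>x. a i * (x i / (W x + ?t k)) \<partial>gauss J) + (a i)\<^sup>2 * c' k"
        by (subst Bochner_Integration.integral_add[OF ix[OF i] integrable_mult_right[OF int(1)[of 1, unfolded power_one_right]]])
           (simp only: integral_mult_right_zero c'_def)
      finally show ?thesis using stein_drift[OF t[of k] i] by simp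
    qed
    then have "(\<Sum>i\<in>P. \<integral>x. a i * ((x i + a i) / (W x + ?t k)) \<partial>gauss J) \<le> A2 * c' k"
      unfolding sum_distrib_right by (intro sum_mono)
    then show ?thesis
      using stein_sum_decomposition[OF t[of k], of 0] stein_inverse_power_sum[OF t[of k], of 0]
      by (simp add: w_def c'_def v_def power2_eq_square)
  qed
  moreover have "(\<lambda>k. N * c' k - 2 * v k + A2 * c' k) \<longlonglongrightarrow> N * c - 2 * c + A2 * c"
    by (intro tendsto_intros lim_c lim_v)
  ultimately have "1 \<le> N * c - 2 * c + A2 * c"
    using lim_w by (intro LIMSEQ_le[of w]) auto
  then show ?thesis by (simp add: c_def algebra_simps)
qed

text \<open>
  A coordinate outside \<open>P\<close> is independent of \<open>W\<close>; Stein's identity in that coordinate is a short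
  way to say so, as \<open>W\<close> does not depend on it.
\<close>

lemma independent_coordinate_ratio:
  assumes N: "2 < N" and j: "j \<in> J" "j \<notin> P"
  shows "integrable (gauss J) (\<lambda>x. (x j)\<^sup>2 / W x)"
    and "(\<integral>x. (x j)\<^sup>2 / W x \<partial>gauss J) = (\<integral>x. 1 / W x \<partial>gauss J)"
proof -
  have P: "P \<noteq> {}" using N by auto
  have eq: "(\<integral>x. (x j)\<^sup>2 / (W x + t) \<partial>gauss J) = (\<integral>x. 1 / (W x + t) \<partial>gauss J)" if t: "0 < t" for t
  proof -
    note int = inverse_power_integrable[OF t]
    have "(\<integral>x. x j * (x j / (W x + t)) \<partial>gauss J) = (\<integral>x. 1 / (W x + t) \<partial>gauss J)"
    proof (rule gauss_stein[OF finite_J j(1)])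
      show "((\<lambda>y. (x(j:=y)) j / (W (x(j:=y)) + t)) has_field_derivative 1 / (W (x(j:=y)) + t)) (at y)" for x y
        unfolding offset_sq_update(2)[OF finite_P j(2)] using offset_pos[OF t, of x]
        by (auto intro!: derivative_eq_intros)
      show "continuous_on UNIV (\<lambda>y. 1 / (W (x(j:=y)) + t))" for x
        unfolding offset_sq_update(2)[OF finite_P j(2)] by simp
      show "\<exists>C. \<forall>y. \<bar>(x(j:=y)) j / (W (x(j:=y)) + t)\<bar> \<le> C * (1 + y\<^sup>2)\<^sup>2" for x
      proof (intro exI allI)
        fix y :: real
        have "\<bar>y\<bar> \<le> (1 + y\<^sup>2)\<^sup>2"
          using abs_le_one_plus_square[of y] self_le_power[of "1 + y\<^sup>2" 2] by simp
        then show "\<bar>(x(j:=y)) j / (W (x(j:=y)) + t)\<bar> \<le> 1 / (W x + t) * (1 + y\<^sup>2)\<^sup>2"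
          unfolding offset_sq_update(2)[OF finite_P j(2)] using offset_pos[OF t, of x]
          by (simp add: abs_mult divide_right_mono)
      qed
      show "integrable (gauss J) (\<lambda>x. x j * (x j / (W x + t)))"
        using int(6)[OF j(1), of 2 1] by (simp add: power2_eq_square)
      show "integrable (gauss J) (\<lambda>x. 1 / (W x + t))" using int(1)[of 1] by simp
    qed
    then show ?thesis by (simp add: power2_eq_square)
  qed
  have bound1: "(\<integral>x. 1 / (W x + s) \<partial>gauss J) \<le> 1 / (N - 2)" if "0 < s" for s
    using inverse_moment_shift_bound[OF that, of 1] N by simp
  have m: "(\<lambda>x. (x j)\<^sup>2) \<in> borel_measurable (gauss J)" using j by measurable
  have i2: "integrable (gauss J) (\<lambda>x. (x j)\<^sup>2 / (W x + t))" if "0 < t" for t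
    using inverse_power_integrable(6)[OF that j(1), of 2 1] by simp
  note L = shift_limit[OF P m, of 1 "1 / (N - 2)", simplified]
  show "integrable (gauss J) (\<lambda>x. (x j)\<^sup>2 / W x)"
    using i2 eq bound1 by (intro L(1)) auto
  have "(\<lambda>k. \<integral>x. (x j)\<^sup>2 / (W x + 1 / real (Suc k)) \<partial>gauss J) \<longlonglongrightarrow> (\<integral>x. (x j)\<^sup>2 / W x \<partial>gauss J)"
    using i2 eq bound1 shift_limit(2)[OF P m, of 1 "1 / (N - 2)"] by simp
  moreover have "(\<lambda>k. \<integral>x. 1 / (W x + 1 / real (Suc k)) \<partial>gauss J) \<longlonglongrightarrow> (\<integral>x. 1 / W x \<partial>gauss J)"
    using shift_limit(2)[OF P, of "\<lambda>_. 1" 1 "1 / (N - 2)"] inverse_power_integrable(1)[of _ 1] bound1 by simp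
  ultimately show "(\<integral>x. (x j)\<^sup>2 / W x \<partial>gauss J) = (\<integral>x. 1 / W x \<partial>gauss J)"
    by (simp add: eq LIMSEQ_unique)
qed

lemma coord_sq_over_W_integrable:
  assumes N: "2 < N" and j: "j \<in> J"
  shows "integrable (gauss J) (\<lambda>x. (x j)\<^sup>2 / W x)"
proof (cases "j \<in> P")
  case False
  then show ?thesis using independent_coordinate_ratio(1)[OF N j] by simp
next
  case True
  have P: "P \<noteq> {}" using N by auto
  interpret G: prob_space "gauss J" by simp
  show ?thesis
  proof (rule Bochner_Integration.integrable_bound)
    show "integrable (gauss J) (\<lambda>x. 2 + 2 * (a j)\<^sup>2 * (1 / W x))"
      using inverse_moment(1)[of 1] N P by (intro Bochner_Integration.integrable_add integrable_mult_right) auto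
    show "AE x in gauss J. norm ((x j)\<^sup>2 / W x) \<le> norm (2 + 2 * (a j)\<^sup>2 * (1 / W x))"
      using AE_W_pos[OF P]
    proof eventually_elim
      case (elim x)
      have "(x j)\<^sup>2 \<le> 2 * (x j + a j)\<^sup>2 + 2 * (a j)\<^sup>2"
        using sum_squares_bound[of "x j + 2 * a j" "x j + 2 * a j"] zero_le_power2[of "x j + 2 * a j"]
        by (simp add: power2_eq_square algebra_simps)
      also have "\<dots> \<le> 2 * W x + 2 * (a j)\<^sup>2"
        using coord_sq_le_offset_sq[OF finite_P True, of x a] by simp
      finally have "(x j)\<^sup>2 / W x \<le> (2 * W x + 2 * (a j)\<^sup>2) / W x"
        using elim by (intro divide_right_mono) auto
      also have "\<dots> = 2 + 2 * (a j)\<^sup>2 * (1 / W x)" using elim by (simp add: field_simps)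
      finally have "(x j)\<^sup>2 / W x \<le> 2 + 2 * (a j)\<^sup>2 * (1 / W x)" .
      moreover have "0 \<le> (x j)\<^sup>2 / W x" by simp
      ultimately show ?case unfolding real_norm_def by linarith
    qed
  qed (use j in measurable)
qed

lemma ln_shift_integrable:
  assumes t: "0 < t"
  shows "integrable (gauss J) (\<lambda>x. ln (W x + t))"
    and "j \<in> J \<Longrightarrow> integrable (gauss J) (\<lambda>x. (x j)\<^sup>2 * ln (W x + t))"
proof -
  interpret G: prob_space "gauss J" by simp
  have b: "\<bar>ln (W x + t)\<bar> \<le> \<bar>ln t\<bar> + W x / t" for x by (rule abs_ln_shift_le[OF t]) simp
  have nn: "0 \<le> \<bar>ln t\<bar> + W x / t" for x using t by simp
  show "integrable (gauss J) (\<lambda>x. ln (W x + t))"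
  proof (rule Bochner_Integration.integrable_bound)
    show "integrable (gauss J) (\<lambda>x. \<bar>ln t\<bar> + W x / t)" using W_integrable by simp
    show "AE x in gauss J. norm (ln (W x + t)) \<le> norm (\<bar>ln t\<bar> + W x / t)"
      using b nn by (intro AE_I2) (simp only: real_norm_def abs_of_nonneg)
  qed measurable
  show "integrable (gauss J) (\<lambda>x. (x j)\<^sup>2 * ln (W x + t))" if j: "j \<in> J"
  proof (rule Bochner_Integration.integrable_bound)
    have "integrable (gauss J) (\<lambda>x. \<bar>ln t\<bar> * (x j)\<^sup>2 + ((x j)\<^sup>2 * W x) / t)"
      using sq_W_integrable[OF j] coord_power_integrable0[OF j, of 2]
      by (intro Bochner_Integration.integrable_add integrable_mult_right Bochner_Integration.integrable_divide)
    then show "integrable (gauss J) (\<lambda>x. (x j)\<^sup>2 * (\<bar>ln t\<bar> + W x / t))" by (simp add: algebra_simps)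
    show "AE x in gauss J. norm ((x j)\<^sup>2 * ln (W x + t)) \<le> norm ((x j)\<^sup>2 * (\<bar>ln t\<bar> + W x / t))"
      unfolding norm_mult using b nn by (intro AE_I2 mult_left_mono) (simp_all only: real_norm_def abs_of_nonneg abs_ge_zero)
  qed (use j in measurable)
qed

lemma stein_log:
  assumes t: "0 < t" and j: "j \<in> J"
  shows "(\<integral>x. ((x j)\<^sup>2 - 1) * ln (W x + t) \<partial>gauss J)
    = (if j \<in> P then 2 * (\<integral>x. x j * ((x j + a j) / (W x + t) ^ Suc 0) \<partial>gauss J) else 0)"
proof -
  let ?d = "\<lambda>x. if j \<in> P then 2 * (x j * ((x j + a j) / (W x + t) ^ Suc 0)) else 0"
  have id: "integrable (gauss J) ?d"
    using integrable_mult_right[OF inverse_power_integrable(4)[OF t _ j, of j 0], of 2]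
    by (cases "j \<in> P") (simp_all only: if_True if_False integrable_zero)
  have "(\<integral>x. x j * (x j * ln (W x + t)) \<partial>gauss J) = (\<integral>x. ln (W x + t) + ?d x \<partial>gauss J)"
  proof (rule gauss_stein[OF finite_J j])
    show "((\<lambda>y. (x(j:=y)) j * ln (W (x(j:=y)) + t)) has_field_derivative ln (W (x(j:=y)) + t) + ?d (x(j:=y))) (at y)" for x y
    proof (cases "j \<in> P")
      case True
      have "0 < (y + a j)\<^sup>2 + offset_sq (P - {j}) a x + t" using t by (simp add: add_nonneg_pos)
      then show ?thesis
        unfolding offset_sq_update(1)[OF finite_P True] using True
        by (auto intro!: derivative_eq_intros)
    next
      case False
      show ?thesis unfolding offset_sq_update(2)[OF finite_P False] using False by (auto intro!: derivative_eq_intros)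
    qed
    show "continuous_on UNIV (\<lambda>y. ln (W (x(j:=y)) + t) + ?d (x(j:=y)))" for x
    proof (cases "j \<in> P")
      case True
      have "(y + a j)\<^sup>2 + offset_sq (P - {j}) a x + t \<noteq> 0" for y
        using t add_nonneg_pos[of "(y + a j)\<^sup>2 + offset_sq (P - {j}) a x" t] by simp
      then show ?thesis
        unfolding offset_sq_update(1)[OF finite_P True] using True by (auto intro!: continuous_intros)
    next
      case False
      show ?thesis unfolding offset_sq_update(2)[OF finite_P False] using False by simp
    qed
    show "\<exists>C. \<forall>y. \<bar>(x(j:=y)) j * ln (W (x(j:=y)) + t)\<bar> \<le> C * (1 + y\<^sup>2)\<^sup>2" for x
    proof (intro exI allI)
      fix y :: real
      let ?c = "\<bar>ln t\<bar> + (2 + 2 * (a j)\<^sup>2 + W x + offset_sq (P - {j}) a x) / t"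
      have "W (x(j:=y)) \<le> 2 * y\<^sup>2 + 2 * (a j)\<^sup>2 + W x + offset_sq (P - {j}) a x"
      proof (cases "j \<in> P")
        case True
        have "(y + a j)\<^sup>2 \<le> 2 * y\<^sup>2 + 2 * (a j)\<^sup>2"
          using zero_le_power2[of "y - a j"] by (simp add: power2_eq_square algebra_simps)
        then show ?thesis
          unfolding offset_sq_update(1)[OF finite_P True] using offset_sq_nonneg[of P a x] by linarith
      next
        case False
        then show ?thesis unfolding offset_sq_update(2)[OF finite_P False] by simp
      qed
      also have "\<dots> \<le> (2 + 2 * (a j)\<^sup>2 + W x + offset_sq (P - {j}) a x) * (1 + y\<^sup>2)"
        by (simp add: algebra_simps add_nonneg_nonneg)
      finally have "W (x(j:=y)) / t \<le> (2 + 2 * (a j)\<^sup>2 + W x + offset_sq (P - {j}) a x) * (1 + y\<^sup>2) / t"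
        using t by (intro divide_right_mono) auto
      moreover have "\<bar>ln t\<bar> \<le> \<bar>ln t\<bar> * (1 + y\<^sup>2)" by (simp add: algebra_simps)
      moreover have "\<bar>ln (W (x(j:=y)) + t)\<bar> \<le> \<bar>ln t\<bar> + W (x(j:=y)) / t" by (rule abs_ln_shift_le[OF t]) simp
      ultimately have l: "\<bar>ln (W (x(j:=y)) + t)\<bar> \<le> ?c * (1 + y\<^sup>2)" by (simp add: distrib_right)
      have "\<bar>(x(j:=y)) j * ln (W (x(j:=y)) + t)\<bar> \<le> (1 + y\<^sup>2) * (?c * (1 + y\<^sup>2))"
        unfolding abs_mult fun_upd_same using l by (intro mult_mono abs_le_one_plus_square) auto
      then show "\<bar>(x(j:=y)) j * ln (W (x(j:=y)) + t)\<bar> \<le> ?c * (1 + y\<^sup>2)\<^sup>2"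
        by (simp add: power2_eq_square ac_simps)
    qed
    show "integrable (gauss J) (\<lambda>x. x j * (x j * ln (W x + t)))"
      using ln_shift_integrable(2)[OF t j] by (simp add: power2_eq_square mult.assoc)
    show "integrable (gauss J) (\<lambda>x. ln (W x + t) + ?d x)"
      by (intro Bochner_Integration.integrable_add ln_shift_integrable t id)
  qed
  also have "\<dots> = (\<integral>x. ln (W x + t) \<partial>gauss J) + (\<integral>x. ?d x \<partial>gauss J)"
    by (intro Bochner_Integration.integral_add ln_shift_integrable t id)
  also have "(\<integral>x. ?d x \<partial>gauss J) = (if j \<in> P then 2 * (\<integral>x. x j * ((x j + a j) / (W x + t) ^ Suc 0) \<partial>gauss J) else 0)"
    by (cases "j \<in> P") (simp_all only: if_True if_False integral_mult_right_zero integral_zero)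
  finally have "(\<integral>x. (x j)\<^sup>2 * ln (W x + t) \<partial>gauss J) = (\<integral>x. ln (W x + t) \<partial>gauss J)
      + (if j \<in> P then 2 * (\<integral>x. x j * ((x j + a j) / (W x + t) ^ Suc 0) \<partial>gauss J) else 0)"
    by (simp only: power2_eq_square mult.assoc)
  then show ?thesis
    by (simp only: left_diff_distrib mult_1 Bochner_Integration.integral_diff[OF ln_shift_integrable(2)[OF t j] ln_shift_integrable(1)[OF t]])
qed

text \<open>
  Stein's identity applied to \<open>x j * ln W\<close> for each \<open>j\<close> and then once more to the resulting
  \<open>x j * (x j + a j) / W\<close>. Equivalently: the derivative of \<open>E (ln W)\<close> in the noise level is half
  of the mean Laplacian of \<open>ln W\<close>, and the Laplacian of the logarithm of the squared norm is
  \<open>2 (N - 2) / W\<close>.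
\<close>

lemma log_covariance:
  assumes N: "2 < N"
  shows "integrable (gauss J) (\<lambda>x. ln (W x))"
    and "integrable (gauss J) (\<lambda>x. (\<Sum>j\<in>J. (x j)\<^sup>2 - 1) * ln (W x))"
    and "(\<integral>x. (\<Sum>j\<in>J. (x j)\<^sup>2 - 1) * ln (W x) \<partial>gauss J) = 2 * (N - 2) * (\<integral>x. 1 / W x \<partial>gauss J)"
proof -
  have P: "P \<noteq> {}" using N by auto
  let ?t = "\<lambda>k. 1 / real (Suc k)"
  have t: "0 < ?t k" "?t k \<le> 1" for k by auto
  have ln_bound: "\<bar>ln (W x + s)\<bar> \<le> W x + 1 / W x" if "0 < W x" "0 \<le> s" "s \<le> 1" for x s
  proof -
    have "ln (W x + s) \<le> W x + s - 1" using that by (intro ln_le_minus_one) auto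
    moreover have "- ln (W x + s) \<le> - ln (W x)" using that by simp
    moreover have "- ln (W x) = ln (1 / W x)" using that by (simp add: ln_div)
    moreover have "ln (1 / W x) \<le> 1 / W x - 1" using that by (intro ln_le_minus_one) auto
    ultimately show ?thesis using that by (auto simp: abs_le_iff) (smt (verit) divide_pos_pos)+
  qed
  have int1: "integrable (gauss J) (\<lambda>x. 1 / W x)" using inverse_moment(1)[of 1] N P by simp
  have ln_meas: "(\<lambda>x. ln (W x)) \<in> borel_measurable (gauss J)" by measurable
  show "integrable (gauss J) (\<lambda>x. ln (W x))"
  proof (rule Bochner_Integration.integrable_bound[OF _ ln_meas])
    show "integrable (gauss J) (\<lambda>x. W x + 1 / W x)" using W_integrable int1 by simp
    show "AE x in gauss J. norm (ln (W x)) \<le> norm (W x + 1 / W x)"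
      using AE_W_pos[OF P]
    proof eventually_elim
      case (elim x)
      from ln_bound[OF elim, of 0] show ?case unfolding real_norm_def by simp
    qed
  qed
  \<comment> \<open>dominates the shifted logarithms for all shifts up to 1\<close>
  let ?dom = "\<lambda>j x. ((x j)\<^sup>2 * W x + (x j)\<^sup>2 / W x) + (W x + 1 / W x)"
  have coord: "integrable (gauss J) (\<lambda>x. ((x j)\<^sup>2 - 1) * ln (W x))
      \<and> (\<lambda>k. \<integral>x. ((x j)\<^sup>2 - 1) * ln (W x + ?t k) \<partial>gauss J) \<longlonglongrightarrow> (\<integral>x. ((x j)\<^sup>2 - 1) * ln (W x) \<partial>gauss J)"
    if j: "j \<in> J" for j
  proof -
    have m: "(\<lambda>x. ((x j)\<^sup>2 - 1) * ln (W x)) \<in> borel_measurable (gauss J)"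
      "(\<lambda>x. ((x j)\<^sup>2 - 1) * ln (W x + ?t k)) \<in> borel_measurable (gauss J)" for k
      using j by measurable
    have dom: "integrable (gauss J) (?dom j)"
      using sq_W_integrable[OF j] coord_sq_over_W_integrable[OF N j] W_integrable int1
      by (intro Bochner_Integration.integrable_add)
    have lim: "AE x in gauss J. (\<lambda>k. ((x j)\<^sup>2 - 1) * ln (W x + ?t k)) \<longlonglongrightarrow> ((x j)\<^sup>2 - 1) * ln (W x)"
      using AE_W_pos[OF P]
    proof eventually_elim
      case (elim x)
      have "(\<lambda>k. W x + ?t k) \<longlonglongrightarrow> W x + 0"
        by (intro tendsto_add tendsto_const LIMSEQ_Suc[OF lim_1_over_n])
      with elim show ?case by (intro tendsto_mult tendsto_ln tendsto_const) auto
    qed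
    have bnd: "AE x in gauss J. norm (((x j)\<^sup>2 - 1) * ln (W x + ?t k)) \<le> ?dom j x" for k
      using AE_W_pos[OF P]
    proof eventually_elim
      case (elim x)
      have "norm (((x j)\<^sup>2 - 1) * ln (W x + ?t k)) \<le> ((x j)\<^sup>2 + 1) * (W x + 1 / W x)"
        unfolding real_norm_def abs_mult
        by (intro mult_mono ln_bound[OF elim less_imp_le[OF t(1)] t(2)]) (auto simp: abs_le_iff)
      then show ?case by (simp add: algebra_simps)
    qed
    show ?thesis
      using integrable_dominated_convergence[OF m dom lim bnd]
        integral_dominated_convergence[OF m dom lim bnd] by blast
  qed
  show "integrable (gauss J) (\<lambda>x. (\<Sum>j\<in>J. (x j)\<^sup>2 - 1) * ln (W x))"
    unfolding sum_distrib_right using coord by (intro Bochner_Integration.integrable_sum) blast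
  have "(\<Sum>j\<in>J. \<integral>x. ((x j)\<^sup>2 - 1) * ln (W x + ?t k) \<partial>gauss J)
      = 2 * (N * (\<integral>x. 1 / (W x + ?t k) \<partial>gauss J) - 2 * (\<integral>x. W x / (W x + ?t k)\<^sup>2 \<partial>gauss J))" for k
  proof -
    have "(\<Sum>j\<in>J. \<integral>x. ((x j)\<^sup>2 - 1) * ln (W x + ?t k) \<partial>gauss J)
       = (\<Sum>j\<in>P. 2 * (\<integral>x. x j * ((x j + a j) / (W x + ?t k) ^ Suc 0) \<partial>gauss J))"
      using stein_log[OF t(1)] finite_J P_sub by (simp add: sum.If_cases Int_absorb1 del: power_Suc of_nat_Suc)
    then show ?thesis
      using stein_inverse_power_sum[OF t(1)[of k], of 0]
      by (simp add: sum_distrib_left[symmetric] power2_eq_square del: of_nat_Suc)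
  qed
  moreover have "(\<lambda>k. 2 * (N * (\<integral>x. 1 / (W x + ?t k) \<partial>gauss J) - 2 * (\<integral>x. W x / (W x + ?t k)\<^sup>2 \<partial>gauss J)))
    \<longlonglongrightarrow> 2 * (N * (\<integral>x. 1 / W x \<partial>gauss J) - 2 * (\<integral>x. 1 / W x \<partial>gauss J))"
    by (intro tendsto_intros shifted_moment_limits N)
  moreover have "(\<lambda>k. \<Sum>j\<in>J. \<integral>x. ((x j)\<^sup>2 - 1) * ln (W x + ?t k) \<partial>gauss J)
      \<longlonglongrightarrow> (\<Sum>j\<in>J. \<integral>x. ((x j)\<^sup>2 - 1) * ln (W x) \<partial>gauss J)"
    using coord by (intro tendsto_sum) blast
  ultimately have "(\<Sum>j\<in>J. \<integral>x. ((x j)\<^sup>2 - 1) * ln (W x) \<partial>gauss J)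
      = 2 * (N * (\<integral>x. 1 / W x \<partial>gauss J) - 2 * (\<integral>x. 1 / W x \<partial>gauss J))"
    by (simp only: LIMSEQ_unique)
  moreover have "(\<integral>x. (\<Sum>j\<in>J. (x j)\<^sup>2 - 1) * ln (W x) \<partial>gauss J) = (\<Sum>j\<in>J. \<integral>x. ((x j)\<^sup>2 - 1) * ln (W x) \<partial>gauss J)"
    unfolding sum_distrib_right using coord by (intro Bochner_Integration.integral_sum) blast
  ultimately show "(\<integral>x. (\<Sum>j\<in>J. (x j)\<^sup>2 - 1) * ln (W x) \<partial>gauss J) = 2 * (N - 2) * (\<integral>x. 1 / W x \<partial>gauss J)"
    by (simp add: algebra_simps)
qed

end

section \<open>Radial weights, the lower chi-square tail and Fisher laws\<close>

context offset_gauss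
begin

text \<open>
  A decreasing weight of the noise level \<open>R\<close> selects small noise, hence a small residual: the mean
  of \<open>W\<close> under the weight is at most its unweighted mean \<open>N + A2\<close>. Each square
  \<open>(x j)\<^sup>2\<close> is negatively associated with the weight, and the linear terms vanish by
  symmetry.
\<close>

lemma radial_weight_offset_moment:
  fixes G :: "real \<Rightarrow> real"
  assumes G: "\<And>s t. 0 \<le> s \<Longrightarrow> s \<le> t \<Longrightarrow> G t \<le> G s" and G01: "\<And>s. 0 \<le> G s" "\<And>s. 0 \<le> s \<Longrightarrow> G s \<le> 1"
    and [measurable]: "G \<in> borel_measurable borel"
  defines "R \<equiv> \<lambda>x. offset_sq J (\<lambda>_. 0) x"
  shows "(\<integral>x. G (R x) * W x \<partial>gauss J) \<le> (N + A2) * (\<integral>x. G (R x) \<partial>gauss J)"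
    and "integrable (gauss J) (\<lambda>x. G (R x) * W x)" and "integrable (gauss J) (\<lambda>x. G (R x))"
proof -
  interpret G: prob_space "gauss J" by simp
  interpret O: offset_gauss J J "\<lambda>_. 0" by unfold_locales (auto simp: finite_J)
  have [measurable]: "R \<in> borel_measurable (gauss J)" unfolding R_def by (rule O.W_measurable)
  have G_bounded_integrable: "integrable (gauss J) (\<lambda>x. G (R x) * h x)"
    if "integrable (gauss J) h" for h
  proof (rule Bochner_Integration.integrable_bound[OF that])
    show "AE x in gauss J. norm (G (R x) * h x) \<le> norm (h x)"
      using G01 by (intro AE_I2) (simp add: R_def abs_mult mult_left_le_one_le)
  qed (use that in measurable)
  show iG: "integrable (gauss J) (\<lambda>x. G (R x))" using G_bounded_integrable[of "\<lambda>_. 1"] by simp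
  show iW: "integrable (gauss J) (\<lambda>x. G (R x) * W x)" by (rule G_bounded_integrable[OF W_integrable])
  have i2: "integrable (gauss J) (\<lambda>x. G (R x) * ((x j)\<^sup>2 - 1))" if "j \<in> J" for j
    using coord_power_integrable0[OF that, of 2] by (intro G_bounded_integrable) auto
  have i1: "integrable (gauss J) (\<lambda>x. G (R x) * (2 * a j * x j))" if "j \<in> J" for j
    using coord_integrable[OF that] by (intro G_bounded_integrable) auto
  have RU: "R (x(j:=y)) = y\<^sup>2 + offset_sq (J - {j}) (\<lambda>_. 0) x" if "j \<in> J" for x j y
    unfolding R_def using offset_sq_update(1)[OF finite_J that, of "\<lambda>_. 0"] by simp
  have 2: "(\<integral>x. G (R x) * ((x j)\<^sup>2 - 1) \<partial>gauss J) \<le> 0" if j: "j \<in> J" for j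
  proof (rule gauss_slice_nonpos[OF finite_J j i2[OF j]])
    fix x assume "integrable std_gauss (\<lambda>y. G (R (x(j:=y))) * (((x(j:=y)) j)\<^sup>2 - 1))"
    then show "(\<integral>y. G (R (x(j:=y))) * (((x(j:=y)) j)\<^sup>2 - 1) \<partial>std_gauss) \<le> 0"
      unfolding RU[OF j] fun_upd_same
      by (intro std_gauss_radial_covariance_nonpos[where G = "\<lambda>s. G (s + offset_sq (J - {j}) (\<lambda>_. 0) x)"] G) auto
  qed
  have 1: "(\<integral>x. G (R x) * (2 * a j * x j) \<partial>gauss J) \<le> 0" if j: "j \<in> J" for j
  proof (rule gauss_slice_nonpos[OF finite_J j i1[OF j]])
    fix x assume "integrable std_gauss (\<lambda>y. G (R (x(j:=y))) * (2 * a j * (x(j:=y)) j))"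
    then show "(\<integral>y. G (R (x(j:=y))) * (2 * a j * (x(j:=y)) j) \<partial>std_gauss) \<le> 0"
      unfolding RU[OF j] fun_upd_same by (rule std_gauss_symmetrize_nonpos) simp
  qed
  have PJ: "j \<in> P \<Longrightarrow> j \<in> J" for j using P_sub by auto
  have "(\<integral>x. G (R x) * W x \<partial>gauss J)
     = (\<integral>x. (\<Sum>j\<in>P. G (R x) * ((x j)\<^sup>2 - 1) + G (R x) * (2 * a j * x j) + (1 + (a j)\<^sup>2) * G (R x)) \<partial>gauss J)"
    unfolding offset_sq_def sum_distrib_left
    by (intro Bochner_Integration.integral_cong sum.cong refl) (simp add: power2_eq_square algebra_simps)
  also have "\<dots> = (\<Sum>j\<in>P. (\<integral>x. G (R x) * ((x j)\<^sup>2 - 1) \<partial>gauss J) + (\<integral>x. G (R x) * (2 * a j * x j) \<partial>gauss J)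
      + (1 + (a j)\<^sup>2) * (\<integral>x. G (R x) \<partial>gauss J))"
    using i1 i2 iG PJ
    by (subst Bochner_Integration.integral_sum)
       (auto intro!: sum.cong simp: Bochner_Integration.integral_add Bochner_Integration.integrable_add simp del: mult_minus_right)
  also have "\<dots> \<le> (\<Sum>j\<in>P. (1 + (a j)\<^sup>2) * (\<integral>x. G (R x) \<partial>gauss J))"
    using 1 2 PJ by (intro sum_mono) (smt (verit))
  also have "\<dots> = (N + A2) * (\<integral>x. G (R x) \<partial>gauss J)"
    by (simp add: sum_distrib_right[symmetric] sum.distrib)
  finally show "(\<integral>x. G (R x) * W x \<partial>gauss J) \<le> (N + A2) * (\<integral>x. G (R x) \<partial>gauss J)" .
qed

end

lemma std_gauss_exp_square:
  assumes "0 \<le> l"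
  shows "integrable std_gauss (\<lambda>y. exp (- l * y\<^sup>2))"
    and "(\<integral>y. exp (- l * y\<^sup>2) \<partial>std_gauss) = 1 / sqrt (1 + 2 * l)"
proof -
  define s where "s = 1 / sqrt (1 + 2 * l)"
  have s: "0 < s" "s\<^sup>2 = 1 / (1 + 2 * l)" using assms by (auto simp: s_def power_divide)
  have eq: "std_normal_density y * exp (- l * y\<^sup>2) = s * normal_density 0 s y" for y
  proof -
    have "- (y\<^sup>2 / (2 * s\<^sup>2)) = - y\<^sup>2 / 2 + - l * y\<^sup>2"
      using assms unfolding s(2) by (simp add: field_simps)
    moreover have "s * (1 / sqrt (2 * pi * s\<^sup>2)) = 1 / sqrt (2 * pi)"
      using s(1) by (simp add: real_sqrt_mult)
    moreover have "s * normal_density 0 s y = (s * (1 / sqrt (2 * pi * s\<^sup>2))) * exp (- (y\<^sup>2 / (2 * s\<^sup>2)))"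
      by (simp add: normal_density_def)
    ultimately show ?thesis
      unfolding std_normal_density_def by (simp only: exp_add mult.assoc)
  qed
  show "integrable std_gauss (\<lambda>y. exp (- l * y\<^sup>2))"
    by (subst integrable_std_gauss_iff, measurable) (simp only: eq, use s in simp)
  show "(\<integral>y. exp (- l * y\<^sup>2) \<partial>std_gauss) = 1 / sqrt (1 + 2 * l)"
    by (subst integral_std_gauss, measurable) (simp only: eq, use s in \<open>simp add: s_def\<close>)
qed

lemma exp_1_bounds: "5 / 2 \<le> exp (1::real)" "exp (1::real) \<le> 3"
  using exp_lower_Taylor_quadratic[of "1::real"] exp_le by auto

lemma ln_one_plus_lower:
  fixes u :: real
  assumes "0 \<le> u"
  shows "u - u\<^sup>2 / 2 \<le> ln (1 + u)"
proof -
  have "(\<lambda>u. ln (1 + u) - (u - u\<^sup>2 / 2)) 0 \<le> (\<lambda>u. ln (1 + u) - (u - u\<^sup>2 / 2)) u"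
  proof (rule DERIV_nonneg_imp_nondecreasing[OF assms])
    fix v :: real assume v: "0 \<le> v"
    have "((\<lambda>u. ln (1 + u) - (u - u\<^sup>2 / 2)) has_field_derivative (1 / (1 + v) - (1 - v))) (at v)"
      using v by (auto intro!: derivative_eq_intros)
    moreover have "1 / (1 + v) - (1 - v) = v\<^sup>2 / (1 + v)"
      using v by (simp add: field_simps power2_eq_square)
    ultimately show "\<exists>y. ((\<lambda>u. ln (1 + u) - (u - u\<^sup>2 / 2)) has_field_derivative y) (at v) \<and> 0 \<le> y"
      using v by auto
  qed
  then show ?thesis by simp
qed

text \<open>
  Chernoff's bound with parameter \<open>x / 2\<close>: the exponent per degree of freedom is
  \<open>x (1 - x) / 2 - ln (1 + x) / 2\<close>, which is at most \<open>- x\<^sup>2 / 4\<close>.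
\<close>

lemma chi_square_lower_tail:
  assumes J: "finite J" and x: "0 \<le> x"
  shows "measure (gauss J) {z \<in> space (gauss J). offset_sq J (\<lambda>_. 0) z < real (card J) * (1 - x)}
    \<le> exp (- real (card J) * x\<^sup>2 / 4)"
proof -
  interpret G: prob_space "gauss J" by simp
  interpret O: offset_gauss J J "\<lambda>_. 0" by unfold_locales (auto simp: J)
  let ?n = "real (card J)" and ?l = "x / 2"
  let ?R = "offset_sq J (\<lambda>_. 0)"
  have expR: "exp (- ?l * ?R z) = (\<Prod>j\<in>J. exp (- ?l * (z j)\<^sup>2))" for z
    using J by (simp add: offset_sq_def sum_distrib_left exp_sum[symmetric])
  have l: "0 \<le> ?l" using x by simp
  have iR: "integrable (gauss J) (\<lambda>z. exp (- ?l * ?R z))"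
    unfolding expR by (rule gauss.product_integrable_prod[OF J]) (rule std_gauss_exp_square[OF l])
  have eR: "(\<integral>z. exp (- ?l * ?R z) \<partial>gauss J) = (1 / sqrt (1 + 2 * ?l)) ^ card J"
    unfolding expR
    by (subst gauss.product_integral_prod[OF J std_gauss_exp_square(1)[OF l]])
       (simp only: std_gauss_exp_square(2)[OF l] prod_constant)
  have "measure (gauss J) {z \<in> space (gauss J). ?R z < ?n * (1 - x)}
      = (\<integral>z. indicator {z \<in> space (gauss J). ?R z < ?n * (1 - x)} z \<partial>gauss J)"
    by simp
  also have "\<dots> \<le> (\<integral>z. exp (?l * ?n * (1 - x)) * exp (- ?l * ?R z) \<partial>gauss J)"
  proof (rule integral_mono_AE')
    show "AE z in gauss J. indicator {z \<in> space (gauss J). ?R z < ?n * (1 - x)} z \<le> exp (?l * ?n * (1 - x)) * exp (- ?l * ?R z)"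
    proof (rule AE_I2)
      fix z
      show "indicator {z \<in> space (gauss J). ?R z < ?n * (1 - x)} z \<le> exp (?l * ?n * (1 - x)) * exp (- ?l * ?R z)"
      proof (cases "?R z < ?n * (1 - x)")
        case True
        then have "0 \<le> ?l * (?n * (1 - x) - ?R z)" using l by (intro mult_nonneg_nonneg) auto
        then have "1 \<le> exp (?l * ?n * (1 - x)) * exp (- ?l * ?R z)"
          by (simp add: exp_add[symmetric] algebra_simps)
        then show ?thesis by (simp add: indicator_def)
      qed (simp add: indicator_def)
    qed
  qed (use iR in auto)
  also have "\<dots> = exp (?l * ?n * (1 - x)) * (1 / sqrt (1 + x)) ^ card J"
    using eR by simp
  also have "(1 / sqrt (1 + x)) ^ card J = exp (- (?n / 2) * ln (1 + x))"
  proof -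
    have "1 / sqrt (1 + x) = exp (- (1 / 2) * ln (1 + x))"
      using x by (simp add: exp_minus ln_sqrt[symmetric] field_simps)
    then show ?thesis by (simp add: exp_of_nat_mult[symmetric])
  qed
  also have "exp (?l * ?n * (1 - x)) * exp (- (?n / 2) * ln (1 + x)) \<le> exp (- ?n * x\<^sup>2 / 4)"
  proof -
    have "(?n / 2) * (x - x\<^sup>2 / 2) \<le> (?n / 2) * ln (1 + x)"
      by (intro mult_left_mono ln_one_plus_lower x) simp
    moreover have "?l * ?n * (1 - x) = (?n / 2) * (x - x\<^sup>2 / 2) - ?n * x\<^sup>2 / 4"
      by (simp add: field_simps power2_eq_square)
    ultimately have "?l * ?n * (1 - x) + - (?n / 2) * ln (1 + x) \<le> - ?n * x\<^sup>2 / 4"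
      by linarith
    then show ?thesis unfolding exp_add[symmetric] by simp
  qed
  finally show ?thesis .
qed

lemma chi_square_eq_distr:
  assumes "finite K" and "card K = k"
  shows "chi_square k = distr (gauss K) borel (\<lambda>z. \<Sum>i\<in>K. (z i)\<^sup>2)"
proof -
  obtain h where h: "bij_betw h {..<k} K"
    using ex_bij_betw_nat_finite[OF assms(1)] assms(2) by (auto simp: atLeast0LessThan)
  have hK: "i < k \<Longrightarrow> h i \<in> K" for i using h by (auto simp: bij_betw_def)
  have "gauss {..<k} = distr (gauss K) (gauss {..<k}) (\<lambda>\<omega>. \<lambda>n\<in>{..<k}. \<omega> (h n))"
    using h hK by (intro distr_PiM_reindex[symmetric]) (auto simp: bij_betw_def)
  then have "chi_square k = distr (distr (gauss K) (gauss {..<k}) (\<lambda>\<omega>. \<lambda>n\<in>{..<k}. \<omega> (h n))) borel (\<lambda>z. \<Sum>i<k. (z i)\<^sup>2)"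
    unfolding chi_square_def by simp
  also have "\<dots> = distr (gauss K) borel ((\<lambda>z. \<Sum>i<k. (z i)\<^sup>2) \<circ> (\<lambda>\<omega>. \<lambda>n\<in>{..<k}. \<omega> (h n)))"
    using hK by (intro distr_distr) (auto intro!: measurable_restrict measurable_component_singleton borel_measurable_sum)
  also have "(\<lambda>z. \<Sum>i<k. (z i)\<^sup>2) \<circ> (\<lambda>\<omega>. \<lambda>n\<in>{..<k}. \<omega> (h n)) = (\<lambda>z. \<Sum>i\<in>K. (z i)\<^sup>2)"
    by (rule ext) (simp add: sum.reindex_bij_betw[OF h, symmetric])
  finally show ?thesis .
qed

text \<open>
  Sums of squares over disjoint blocks of coordinates are independent, which realises the Fisher law
  inside a single Gaussian vector.
\<close>

lemma fisher_eq_distr: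
  assumes fin: "finite A" "finite B" and dis: "A \<inter> B = {}"
  shows "fisher (card A) (card B) = distr (gauss (A \<union> B)) borel
     (\<lambda>z. ((\<Sum>i\<in>A. (z i)\<^sup>2) / real (card A)) / ((\<Sum>i\<in>B. (z i)\<^sup>2) / real (card B)))"
proof -
  let ?q = "\<lambda>K (z :: 'a \<Rightarrow> real). \<Sum>i\<in>K. (z i)\<^sup>2"
  let ?r = "\<lambda>(u, v). (u / real (card A)) / (v / real (card B)) :: real"
  have mq: "?q K \<in> borel_measurable (gauss L)" if "K \<subseteq> L" for K L :: "'a set"
    using that by (intro borel_measurable_sum borel_measurable_power) (auto intro!: gauss_coord_measurable)
  have sf: "sigma_finite_measure (distr (gauss B) borel (?q B))"
    by (intro prob_space_imp_sigma_finite prob_space.prob_space_distr mq) auto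
  have mr: "?r \<in> borel_measurable (borel \<Otimes>\<^sub>M borel)" by measurable
  have mp: "(\<lambda>(x, y). (?q A x, ?q B y)) \<in> gauss A \<Otimes>\<^sub>M gauss B \<rightarrow>\<^sub>M borel \<Otimes>\<^sub>M borel"
    using mq[of A A] mq[of B B] by measurable
  have "fisher (card A) (card B) = distr (distr (gauss A \<Otimes>\<^sub>M gauss B) (borel \<Otimes>\<^sub>M borel) (\<lambda>(x, y). (?q A x, ?q B y))) borel ?r"
    unfolding fisher_def chi_square_eq_distr[OF fin(1) refl] chi_square_eq_distr[OF fin(2) refl]
    by (subst pair_measure_distr[OF mq mq sf]) auto
  also have "\<dots> = distr (gauss A \<Otimes>\<^sub>M gauss B) borel (?r \<circ> (\<lambda>(x, y). (?q A x, ?q B y)))"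
    by (rule distr_distr[OF mr mp])
  also have "\<dots> = distr (gauss A \<Otimes>\<^sub>M gauss B) borel
      ((\<lambda>z. (?q A z / real (card A)) / (?q B z / real (card B))) \<circ> merge A B)"
    using dis by (intro distr_cong refl) (auto simp: merge_def split: prod.splits intro!: arg_cong2[where f="(/)"] sum.cong)
  also have "\<dots> = distr (distr (gauss A \<Otimes>\<^sub>M gauss B) (gauss (A \<union> B)) (merge A B)) borel
      (\<lambda>z. (?q A z / real (card A)) / (?q B z / real (card B)))"
    by (intro distr_distr[symmetric] borel_measurable_divide mq borel_measurable_const measurable_merge) auto
  also have "distr (gauss A \<Otimes>\<^sub>M gauss B) (gauss (A \<union> B)) (merge A B) = gauss (A \<union> B)"
    by (rule gauss.distr_merge[OF dis fin])
  finally show ?thesis .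
qed

text \<open>
  The mean is \<open>N * E (1 / V)\<close> for a central chi-square \<open>V\<close>, and both bounds on inverse moments
  apply.
\<close>

lemma fisher_mean:
  assumes D: "1 \<le> D" and N: "3 \<le> N"
  shows "integrable (fisher D N) (\<lambda>f. f)"
    and "0 < (\<integral>f. f \<partial>fisher D N)"
    and "(\<integral>f. f \<partial>fisher D N) \<le> real N / (real N - 2)"
    and "AE f in fisher D N. 0 \<le> f"
proof -
  let ?A = "{..<D}" and ?B = "{D..<D + N}"
  have J: "?A \<union> ?B = {..<D + N}" by auto
  interpret O: offset_gauss "{..<D + N}" ?B "\<lambda>_. 0" by unfold_locales auto
  let ?F = "\<lambda>z. ((\<Sum>i\<in>?A. (z i)\<^sup>2) / real D) / ((\<Sum>i\<in>?B. (z i)\<^sup>2) / real N)"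
  have fi: "fisher D N = distr (gauss {..<D + N}) borel ?F"
    using fisher_eq_distr[of ?A ?B] by (simp add: J ivl_disj_int)
  have FW: "?F z = (real N / real D) * (\<Sum>i\<in>?A. (z i)\<^sup>2 / O.W z)" for z
    by (simp add: offset_sq_def sum_divide_distrib[symmetric])
  have mF: "?F \<in> borel_measurable (gauss {..<D + N})"
    unfolding FW by measurable
  have N2: "2 < O.N" using N by simp
  have B: "?B \<noteq> {}" using N by simp
  have c_pos: "0 < (\<integral>z. 1 / O.W z \<partial>gauss {..<D + N})"
  proof -
    have "0 < (O.N - 2) * (\<integral>z. 1 / O.W z \<partial>gauss {..<D + N})"
      using O.inverse_moment_lower[OF N2] by simp
    then show ?thesis by (rule zero_less_mult_pos) (use N2 in simp)
  qed
  have iF: "integrable (gauss {..<D + N}) ?F"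
    unfolding FW using O.coord_sq_over_W_integrable[OF N2]
    by (intro integrable_mult_right Bochner_Integration.integrable_sum) auto
  have eF: "(\<integral>z. ?F z \<partial>gauss {..<D + N}) = real N * (\<integral>z. 1 / O.W z \<partial>gauss {..<D + N})"
  proof -
    have "(\<integral>z. ?F z \<partial>gauss {..<D + N}) = (real N / real D) * (\<Sum>i\<in>?A. \<integral>z. (z i)\<^sup>2 / O.W z \<partial>gauss {..<D + N})"
      unfolding FW integral_mult_right_zero using O.coord_sq_over_W_integrable[OF N2]
      by (subst Bochner_Integration.integral_sum) auto
    also have "(\<Sum>i\<in>?A. \<integral>z. (z i)\<^sup>2 / O.W z \<partial>gauss {..<D + N}) = (\<Sum>i\<in>?A. \<integral>z. 1 / O.W z \<partial>gauss {..<D + N})"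
      by (intro sum.cong refl O.independent_coordinate_ratio(2)[OF N2]) auto
    finally show ?thesis using D by simp
  qed
  have mid: "(\<lambda>f. f) \<in> borel_measurable (borel :: real measure)" by simp
  show "integrable (fisher D N) (\<lambda>f. f)"
    unfolding fi using integrable_distr_eq[OF mF mid] iF by simp
  have e: "(\<integral>f. f \<partial>fisher D N) = real N * (\<integral>z. 1 / O.W z \<partial>gauss {..<D + N})"
    unfolding fi using integral_distr[OF mF mid] eF by simp
  show "0 < (\<integral>f. f \<partial>fisher D N)" unfolding e using c_pos N by simp
  have c_le: "(\<integral>z. 1 / O.W z \<partial>gauss {..<D + N}) \<le> 1 / (real N - 2)"
    using O.inverse_moment(2)[of 1] N2 B by simp
  show "(\<integral>f. f \<partial>fisher D N) \<le> real N / (real N - 2)"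
    unfolding e using mult_left_mono[OF c_le, of "real N"] by simp
  show "AE f in fisher D N. 0 \<le> f"
    unfolding fi by (subst AE_distr_iff[OF mF]) (auto simp: sum_nonneg)
qed

lemma prob_space_fisher: "prob_space (fisher D N)"
proof -
  have "fisher D N = distr (gauss ({..<D} \<union> {D..<D + N})) borel
     (\<lambda>z. ((\<Sum>i\<in>{..<D}. (z i)\<^sup>2) / real D) / ((\<Sum>i\<in>{D..<D + N}. (z i)\<^sup>2) / real N))"
    using fisher_eq_distr[of "{..<D}" "{D..<D + N}"] by (simp add: ivl_disj_int)
  also have "prob_space \<dots>"
    by (intro prob_space.prob_space_distr borel_measurable_divide borel_measurable_sum borel_measurable_power
        borel_measurable_const gauss_coord_measurable) auto
  finally show ?thesis .
qed

text \<open>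
  \<open>Fish D N\<close> decreases continuously from 1 at 0 to 0 at infinity, and two equal values at distinct
  points force the value 0, because the variable then almost surely does not exceed the smaller point.
  So every level in \<open>{0<..1}\<close> is attained at exactly one nonnegative point, which is what makes
  \<open>EFish\<close> meaningful.
\<close>

lemma Fish_properties:
  assumes D: "1 \<le> D" and N: "3 \<le> N"
  shows Fish_excess_integrable: "integrable (fisher D N) (\<lambda>f. max 0 (f - x))"
    and Fish_mult_mean: "(\<integral>f. max 0 (f - x) \<partial>fisher D N) = Fish D N x * (\<integral>f. f \<partial>fisher D N)"
    and Fish_nonneg: "0 \<le> Fish D N x"
    and Fish_antimono: "x \<le> y \<Longrightarrow> Fish D N y \<le> Fish D N x"
    and Fish_0: "Fish D N 0 = 1"
    and Fish_continuous: "continuous_on UNIV (Fish D N)"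
    and Fish_tendsto_0: "(\<lambda>k. Fish D N (real k)) \<longlonglongrightarrow> 0"
    and Fish_strict: "x < y \<Longrightarrow> Fish D N x = Fish D N y \<Longrightarrow> Fish D N x = 0"
proof -
  note F = fisher_mean[OF D N]
  interpret F: prob_space "fisher D N" by (rule prob_space_fisher)
  let ?m = "\<integral>f. f \<partial>fisher D N"
  have [measurable_cong]: "sets (fisher D N) = sets borel" by (simp add: fisher_def)
  show int: "integrable (fisher D N) (\<lambda>f. max 0 (f - x))" for x
    using F(1) by (intro integrable_max) auto
  show mm: "(\<integral>f. max 0 (f - x) \<partial>fisher D N) = Fish D N x * ?m" for x
    using F(2) by (simp add: Fish_def)
  show "0 \<le> Fish D N x"
    unfolding Fish_def using F(2) by (intro divide_nonneg_pos Bochner_Integration.integral_nonneg) auto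
  have am: "Fish D N y \<le> Fish D N x" if "x \<le> y" for x y
    unfolding Fish_def using F(2) that by (intro divide_right_mono integral_mono int) auto
  then show "x \<le> y \<Longrightarrow> Fish D N y \<le> Fish D N x" .
  have "(\<integral>f. max 0 (f - 0) \<partial>fisher D N) = ?m"
    by (rule integral_cong_AE) (use F(4) in \<open>auto elim!: eventually_mono\<close>)
  then show "Fish D N 0 = 1" unfolding Fish_def using F(2) by simp
  have lip: "\<bar>Fish D N x - Fish D N y\<bar> \<le> (1 / ?m) * \<bar>x - y\<bar>" for x y
  proof -
    have "(\<integral>f. max 0 (f - x) \<partial>fisher D N) \<le> (\<integral>f. max 0 (f - y) + \<bar>x - y\<bar> \<partial>fisher D N)" for x y
      by (intro integral_mono int Bochner_Integration.integrable_add) auto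
    then have "(\<integral>f. max 0 (f - x) \<partial>fisher D N) \<le> (\<integral>f. max 0 (f - y) \<partial>fisher D N) + \<bar>x - y\<bar>" for x y
      using int by (subst (asm) Bochner_Integration.integral_add) (auto simp: F.prob_space)
    from this[of x y] this[of y x] show ?thesis
      unfolding Fish_def diff_divide_distrib[symmetric] abs_divide using F(2)
      by (simp add: divide_right_mono abs_le_iff abs_minus_commute)
  qed
  show "continuous_on UNIV (Fish D N)"
  proof (rule lipschitz_on_continuous_on)
    show "(1 / ?m)-lipschitz_on UNIV (Fish D N)"
      by (rule lipschitz_onI) (use lip F(2) in \<open>auto simp: dist_real_def\<close>)
  qed
  have "(\<lambda>k. \<integral>f. max 0 (f - real k) \<partial>fisher D N) \<longlonglongrightarrow> (\<integral>f. 0 \<partial>fisher D N)"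
  proof (rule integral_dominated_convergence[OF _ _ F(1)])
    show "AE f in fisher D N. (\<lambda>k. max 0 (f - real k)) \<longlonglongrightarrow> 0"
    proof (rule AE_I2)
      fix f :: real
      obtain k0 where k0: "f < real k0" using reals_Archimedean2 by blast
      then have "eventually (\<lambda>k. max 0 (f - real k) = 0) sequentially"
        unfolding eventually_sequentially
      proof (intro exI allI impI)
        fix k assume "k0 \<le> k"
        then have "real k0 \<le> real k" by simp
        with k0 show "max 0 (f - real k) = 0" by linarith
      qed
      then show "(\<lambda>k. max 0 (f - real k)) \<longlonglongrightarrow> 0" by (rule tendsto_eventually)
    qed
    show "AE f in fisher D N. norm (max 0 (f - real k)) \<le> f" for k
      using F(4) by eventually_elim auto
  qed measurable
  then have "(\<lambda>k. (\<integral>f. max 0 (f - real k) \<partial>fisher D N) / ?m) \<longlonglongrightarrow> 0 / ?m"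
    using F(2) by (intro tendsto_divide) auto
  then show "(\<lambda>k. Fish D N (real k)) \<longlonglongrightarrow> 0" by (simp add: Fish_def)
  show "Fish D N x = 0" if xy: "x < y" and eq: "Fish D N x = Fish D N y"
  proof -
    have "(\<integral>f. max 0 (f - x) - max 0 (f - y) \<partial>fisher D N) = 0"
      using eq mm int by (subst Bochner_Integration.integral_diff) auto
    then have "AE f in fisher D N. max 0 (f - x) - max 0 (f - y) = 0"
      using xy int by (subst (asm) integral_nonneg_eq_0_iff_AE) auto
    then have "AE f in fisher D N. max 0 (f - x) = 0"
      by eventually_elim (use xy in \<open>auto simp: max_def split: if_splits\<close>)
    then have "(\<integral>f. max 0 (f - x) \<partial>fisher D N) = 0"
      by (simp add: integral_eq_zero_AE)
    then show ?thesis by (simp add: Fish_def)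
  qed
qed

lemma Fish_EFish:
  assumes D: "1 \<le> D" and N: "3 \<le> N" and q: "0 < q" "q \<le> 1"
  shows "Fish D N (EFish D N q) = q"
proof -
  have "eventually (\<lambda>k. Fish D N (real k) < q) sequentially"
    using Fish_tendsto_0[OF D N] q(1) by (rule order_tendstoD)
  then obtain k where k: "Fish D N (real k) < q" by (auto simp: eventually_sequentially)
  have "\<exists>x\<ge>0. x \<le> real k \<and> Fish D N x = q"
    using k q Fish_0[OF D N] Fish_continuous[OF D N]
    by (intro IVT2') (auto elim: continuous_on_subset)
  then obtain x where x: "0 \<le> x" "Fish D N x = q" by blast
  have uniq: "y = x" if "0 \<le> y \<and> Fish D N y = q" for y
  proof (rule ccontr)
    assume "y \<noteq> x"
    then consider "x < y" | "y < x" by linarith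
    then show False
      by cases (use Fish_strict[OF D N, of x y] Fish_strict[OF D N, of y x] x that q(1) in simp_all)
  qed
  have "0 \<le> EFish D N q \<and> Fish D N (EFish D N q) = q"
    unfolding EFish_def by (rule theI[of "\<lambda>x. 0 \<le> x \<and> Fish D N x = q", OF conjI[OF x]]) (rule uniq)
  then show ?thesis by blast
qed

section \<open>The risk of a single model\<close>

lemma has_bochner_integral_gauss_const: "has_bochner_integral (gauss J) (\<lambda>_. c :: real) c"
proof -
  interpret P: prob_space "gauss J" by simp
  have "has_bochner_integral (gauss J) (\<lambda>_. c) (\<integral>x. c \<partial>gauss J)"
    by (rule has_bochner_integral_integrable) simp
  then show ?thesis using P.prob_space by simp
qed

text \<open>
  One model of dimension \<open>D\<close> in \<open>n\<close>-space, seen in an orthonormal basis whose first \<open>D\<close>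
  vectors span the model and whose next vector carries the bias; noise is scaled to variance one and
  \<open>b\<close> is the length of the bias divided by \<open>\<sigma>\<close>, up to sign. The five interpretations give the
  squared lengths that matter: \<open>O.W\<close> of the residual, \<open>V.W\<close> of the residual without the bias
  direction, \<open>R.W\<close> of the noise, \<open>Q.W\<close> of the projected noise and \<open>U.W\<close> of the noise
  projected on the model enlarged by the bias direction.
\<close>

locale gaussian_model =
  fixes n D :: nat and b :: real
  assumes dim_bound: "D + 5 \<le> n"
begin

definition offset :: "nat \<Rightarrow> real" where "offset j = (if j = D then b else 0)"

sublocale O: offset_gauss "{..<n}" "{D..<n}" offset
  by unfold_locales auto

sublocale V: offset_gauss "{..<n}" "{Suc D..<n}" "\<lambda>_. 0"
  by unfold_locales auto

sublocale R: offset_gauss "{..<n}" "{..<n}" "\<lambda>_. 0"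
  by unfold_locales auto

sublocale U: offset_gauss "{..<n}" "{..<Suc D}" "\<lambda>_. 0"
  using dim_bound by unfold_locales auto

sublocale Q: offset_gauss "{..<n}" "{..<D}" "\<lambda>_. 0"
  using dim_bound by unfold_locales auto

abbreviation G :: "(nat \<Rightarrow> real) measure" where "G \<equiv> gauss {..<n}"
abbreviation N :: real where "N \<equiv> real (n - D)"
abbreviation n' :: real where "n' \<equiv> real n"
abbreviation D' :: real where "D' \<equiv> real D"
abbreviation inv_mean :: real where "inv_mean \<equiv> \<integral>x. 1 / O.W x \<partial>G"

lemma N_eq: "n' = N + D'" and N_ge: "5 \<le> N"
  using dim_bound by auto

lemma card_eq: "O.N = N" "V.N = N - 1" "O.A2 = b\<^sup>2"
proof -
  show "O.N = N" by simp
  show "V.N = N - 1" using dim_bound by auto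
  have "O.A2 = (\<Sum>j\<in>{D..<n}. if j = D then b\<^sup>2 else 0)" by (intro sum.cong) (auto simp: offset_def)
  then show "O.A2 = b\<^sup>2" using dim_bound by simp
qed

lemma O_ne: "{D..<n} \<noteq> {}" and V_ne: "{Suc D..<n} \<noteq> {}"
  using dim_bound by auto

lemma AE_pos: "AE x in G. 0 < O.W x" and AE_V_pos: "AE x in G. 0 < V.W x"
  by (rule O.AE_W_pos[OF O_ne], rule V.AE_W_pos[OF V_ne])

lemma inv_mean_lower: "1 \<le> (N - 2 + b\<^sup>2) * inv_mean"
  using O.inverse_moment_lower N_ge unfolding card_eq by simp

lemma inv_mean_nonneg: "0 \<le> inv_mean"
  by (intro Bochner_Integration.integral_nonneg) simp

lemma inverse_integrable: "integrable G (\<lambda>x. 1 / O.W x)"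
  using O.inverse_moment(1)[of 1] O_ne N_ge card_eq by simp

lemma projection_ratio:
  shows "integrable G (\<lambda>x. Q.W x / O.W x)" and "(\<integral>x. Q.W x / O.W x \<partial>G) = D' * inv_mean"
proof -
  have N2: "2 < O.N" using N_ge card_eq by simp
  have eq: "Q.W x / O.W x = (\<Sum>j<D. (x j)\<^sup>2 / O.W x)" for x by (simp add: offset_sq_def sum_divide_distrib)
  have i: "integrable G (\<lambda>x. (x j)\<^sup>2 / O.W x)" "(\<integral>x. (x j)\<^sup>2 / O.W x \<partial>G) = inv_mean" if "j < D" for j
    using O.independent_coordinate_ratio[OF N2, of j] that dim_bound by auto
  show "integrable G (\<lambda>x. Q.W x / O.W x)" unfolding eq using i by (intro Bochner_Integration.integrable_sum) auto
  have "(\<integral>x. Q.W x / O.W x \<partial>G) = (\<Sum>j<D. \<integral>x. (x j)\<^sup>2 / O.W x \<partial>G)"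
    unfolding eq using i by (intro Bochner_Integration.integral_sum) auto
  then show "(\<integral>x. Q.W x / O.W x \<partial>G) = D' * inv_mean" using i by simp
qed

text \<open>
  The Kullback loss of the estimator attached to the model, in these coordinates.
\<close>

definition loss :: "(nat \<Rightarrow> real) \<Rightarrow> real" where
  "loss x = n' / 2 * (ln (O.W x / N) + N / O.W x - 1) + (b\<^sup>2 + Q.W x) * N / (2 * O.W x)"

abbreviation log_mean :: real where "log_mean \<equiv> \<integral>x. ln (O.W x / N) \<partial>G"

lemma log_ratio: "AE x in G. ln (O.W x / N) = ln (O.W x) - ln N"
  using AE_pos by eventually_elim (use N_ge in \<open>simp add: ln_div\<close>)

lemma log_has_integral: "has_bochner_integral G (\<lambda>x. ln (O.W x / N)) ((\<integral>x. ln (O.W x) \<partial>G) - ln N)"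
proof -
  have N2: "2 < O.N" using N_ge card_eq by simp
  have i: "has_bochner_integral G (\<lambda>x. ln (O.W x) - ln N) ((\<integral>x. ln (O.W x) \<partial>G) - ln N)"
    by (intro has_bochner_integral_diff has_bochner_integral_integrable O.log_covariance(1)[OF N2] has_bochner_integral_gauss_const)
  have m: "(\<lambda>x. ln (O.W x / N)) \<in> borel_measurable G" "(\<lambda>x. ln (O.W x) - ln N) \<in> borel_measurable G" by measurable
  show ?thesis using has_bochner_integral_cong_AE[OF m log_ratio] i by blast
qed

lemma log_integrable: "integrable G (\<lambda>x. ln (O.W x / N))" and log_mean_eq: "log_mean = (\<integral>x. ln (O.W x) \<partial>G) - ln N"
  by (rule integrable.intros[OF log_has_integral], rule has_bochner_integral_integral_eq[OF log_has_integral])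

lemma loss_has_integral:
  "has_bochner_integral G loss (n' / 2 * (log_mean - 1) + (n' + b\<^sup>2 + D') * N / 2 * inv_mean)"
proof -
  have eq: "loss = (\<lambda>x. (n' / 2 * ln (O.W x / N) + (- n' / 2)) + ((n' + b\<^sup>2) * N / 2 * (1 / O.W x) + N / 2 * (Q.W x / O.W x)))"
    by (rule ext) (simp add: loss_def algebra_simps add_divide_distrib)
  have "has_bochner_integral G loss ((n' / 2 * log_mean + (- n' / 2)) + ((n' + b\<^sup>2) * N / 2 * inv_mean + N / 2 * (\<integral>x. Q.W x / O.W x \<partial>G)))"
    unfolding eq
    by (intro has_bochner_integral_add has_bochner_integral_mult_right has_bochner_integral_gauss_const
        has_bochner_integral_integrable log_integrable inverse_integrable projection_ratio(1))
  moreover have "(n' / 2 * log_mean + (- n' / 2)) + ((n' + b\<^sup>2) * N / 2 * inv_mean + N / 2 * (D' * inv_mean))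
    = n' / 2 * (log_mean - 1) + (n' + b\<^sup>2 + D') * N / 2 * inv_mean"
    by (simp add: field_simps)
  ultimately show ?thesis unfolding projection_ratio(2) by simp
qed

lemma loss_integrable: "integrable G loss"
  and loss_mean_eq: "(\<integral>x. loss x \<partial>G) = n' / 2 * (log_mean - 1) + (n' + b\<^sup>2 + D') * N / 2 * inv_mean"
  by (rule integrable.intros[OF loss_has_integral], rule has_bochner_integral_integral_eq[OF loss_has_integral])

lemma R_integrable: "integrable G R.W" and R_mean: "(\<integral>x. R.W x \<partial>G) = n'"
proof -
  show "integrable G R.W" by (rule R.W_integrable)
  have i: "integrable G (\<lambda>x. (x j)\<^sup>2)" "(\<integral>x. (x j)\<^sup>2 \<partial>G) = 1" if "j < n" for j
    using gauss_component[of j "{..<n}" "\<lambda>y. y\<^sup>2"] that by auto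
  have "(\<integral>x. R.W x \<partial>G) = (\<Sum>j<n. \<integral>x. (x j)\<^sup>2 \<partial>G)"
    unfolding offset_sq_def using i by (simp add: Bochner_Integration.integral_sum)
  then show "(\<integral>x. R.W x \<partial>G) = n'" using i by simp
qed

lemma centered_log_covariance:
  "has_bochner_integral G (\<lambda>x. (R.W x - n') * ln (O.W x / N)) (2 * (N - 2) * inv_mean)"
proof -
  have N2: "2 < O.N" using N_ge card_eq by simp
  have s: "(\<Sum>j<n. (x j)\<^sup>2 - 1) = R.W x - n'" for x by (simp add: offset_sq_def sum_subtractf)
  have "has_bochner_integral G (\<lambda>x. (R.W x - n') * ln (O.W x)) (2 * (N - 2) * inv_mean)"
    using has_bochner_integral_integrable[OF O.log_covariance(2)[OF N2]]
    unfolding O.log_covariance(3)[OF N2] unfolding s unfolding card_eq .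
  moreover have "has_bochner_integral G (\<lambda>x. ln N * (R.W x - n')) (ln N * (n' - n'))"
    using has_bochner_integral_integrable[OF R_integrable] unfolding R_mean
    by (intro has_bochner_integral_mult_right has_bochner_integral_diff has_bochner_integral_gauss_const)
  ultimately have i: "has_bochner_integral G (\<lambda>x. (R.W x - n') * ln (O.W x) - ln N * (R.W x - n')) (2 * (N - 2) * inv_mean)"
    using has_bochner_integral_diff by fastforce
  have ae: "AE x in G. (R.W x - n') * ln (O.W x / N) = (R.W x - n') * ln (O.W x) - ln N * (R.W x - n')"
    using log_ratio
  proof eventually_elim
    case (elim x)
    show ?case unfolding elim by (simp add: algebra_simps)
  qed
  have m: "(\<lambda>x. (R.W x - n') * ln (O.W x / N)) \<in> borel_measurable G"
    "(\<lambda>x. (R.W x - n') * ln (O.W x) - ln N * (R.W x - n')) \<in> borel_measurable G" by measurable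
  show ?thesis using has_bochner_integral_cong_AE[OF m ae] i by blast
qed

text \<open>
  The first inequality serves the constant multiplier \<open>1 / K2\<close>; in the second the summand
  \<open>2 (N - 2) E (1 / W)\<close> is the covariance of \<open>R\<close> and \<open>ln W\<close>.
\<close>

lemma N_inv_mean: "N \<le> (n' + b\<^sup>2 + D') * N * inv_mean"
  and log_weight_balance: "2 * (N - 2) * inv_mean + N \<le> (n' + b\<^sup>2 + D') * N * inv_mean"
proof -
  have c: "0 \<le> inv_mean" by (rule inv_mean_nonneg)
  have 1: "N \<le> N * ((N - 2 + b\<^sup>2) * inv_mean)" using mult_left_mono[OF inv_mean_lower, of N] by simp
  have "2 * (M - 2) + M * (M - 2 + e) \<le> (M + d + e + d) * M" if "0 \<le> M" "0 \<le> d" for M d e :: real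
    using mult_nonneg_nonneg[OF that] by (simp add: algebra_simps)
  from this[of N D' "b\<^sup>2"] have "2 * (N - 2) + N * (N - 2 + b\<^sup>2) \<le> (n' + b\<^sup>2 + D') * N"
    unfolding N_eq by simp
  from mult_right_mono[OF this c]
  have "2 * (N - 2) * inv_mean + N * ((N - 2 + b\<^sup>2) * inv_mean) \<le> (n' + b\<^sup>2 + D') * N * inv_mean"
    by (simp only: distrib_right mult.assoc)
  with 1 show "2 * (N - 2) * inv_mean + N \<le> (n' + b\<^sup>2 + D') * N * inv_mean" by linarith
  moreover have "0 \<le> 2 * (N - 2) * inv_mean" using N_ge c by simp
  ultimately show "N \<le> (n' + b\<^sup>2 + D') * N * inv_mean" by linarith
qed

text \<open>
  What remains of the loss of the comparison model when the multiplier is exactly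
  \<open>1 - R / n\<close>: the logarithmic part of the loss is weighted by \<open>R / n\<close> instead of 1.
\<close>

definition log_target :: "(nat \<Rightarrow> real) \<Rightarrow> real" where
  "log_target x = R.W x / 2 * (ln (O.W x / N) - 1) + n' / 2"

text \<open>
  Weighting \<open>ln W\<close> by \<open>R / 2\<close> instead of its mean \<open>n / 2\<close> costs the covariance
  \<open>(N - 2) E (1 / W)\<close>; the loss contains \<open>(n + b\<^sup>2 + D) (N / 2) E (1 / W)\<close>, which
  pays for it, up to half the dimension.
\<close>

lemma log_target_mean:
  shows "integrable G log_target" and "(\<integral>x. log_target x \<partial>G) \<le> (\<integral>x. loss x \<partial>G) + D' / 2"
proof -
  have eq: "log_target = (\<lambda>x. 1 / 2 * ((R.W x - n') * ln (O.W x / N)) + n' / 2 * ln (O.W x / N) + (- 1 / 2) * R.W x + n' / 2)"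
    by (rule ext) (simp add: log_target_def algebra_simps diff_divide_distrib)
  have h: "has_bochner_integral G log_target
      (1 / 2 * (2 * (N - 2) * inv_mean) + n' / 2 * log_mean + (- 1 / 2) * n' + n' / 2)"
    unfolding eq using has_bochner_integral_integrable[OF R_integrable] unfolding R_mean
    by (intro has_bochner_integral_add has_bochner_integral_mult_right has_bochner_integral_gauss_const
        centered_log_covariance has_bochner_integral_integrable[OF log_integrable])
  then show "integrable G log_target" by (rule integrable.intros)
  show "(\<integral>x. log_target x \<partial>G) \<le> (\<integral>x. loss x \<partial>G) + D' / 2"
    unfolding loss_mean_eq has_bochner_integral_integral_eq[OF h]
    using log_weight_balance unfolding N_eq by argo
qed


text \<open>
  By how much the relative noise level \<open>r / n\<close> falls below \<open>1 - 1 / K2\<close>. The absolute value only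
  makes the function bounded on the whole line.
\<close>

definition deficit :: "real \<Rightarrow> real \<Rightarrow> real" where
  "deficit K2 r = max 0 (1 - \<bar>r\<bar> / n' - 1 / K2)"

lemma deficit_bounds:
  assumes "1 < K2"
  shows "0 \<le> deficit K2 r" "deficit K2 r \<le> 1" "0 \<le> s \<Longrightarrow> s \<le> t \<Longrightarrow> deficit K2 t \<le> deficit K2 s"
proof -
  show "0 \<le> deficit K2 r" by (simp add: deficit_def)
  have "0 \<le> \<bar>r\<bar> / n'" "0 \<le> 1 / K2" using assms by auto
  then show "deficit K2 r \<le> 1" unfolding deficit_def by linarith
  show "deficit K2 t \<le> deficit K2 s" if "0 \<le> s" "s \<le> t"
  proof -
    have "\<bar>s\<bar> / n' \<le> \<bar>t\<bar> / n'" using that by (intro divide_right_mono) auto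
    then show ?thesis unfolding deficit_def by linarith
  qed
qed

lemma deficit_measurable [measurable]: "deficit K2 \<in> borel_measurable borel"
  unfolding deficit_def by measurable

lemma deficit_weight:
  assumes K2: "1 < K2"
  shows deficit_integrable: "integrable G (\<lambda>x. deficit K2 (R.W x))"
    and deficit_W_integrable: "integrable G (\<lambda>x. deficit K2 (R.W x) * O.W x)"
    and deficit_W_mean: "(\<integral>x. deficit K2 (R.W x) * O.W x \<partial>G) \<le> (N + b\<^sup>2) * (\<integral>x. deficit K2 (R.W x) \<partial>G)"
  using O.radial_weight_offset_moment[of "deficit K2", OF deficit_bounds(3)[OF K2] deficit_bounds(1,2)[OF K2] deficit_measurable]
  unfolding card_eq by auto

lemma deficit_mean_bound:
  assumes K2: "1 < K2"
  shows "(\<integral>x. deficit K2 (R.W x) \<partial>G) \<le> exp (- n' / (4 * K2\<^sup>2))"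
proof -
  interpret P: prob_space G by simp
  let ?A = "{z \<in> space G. R.W z < n' * (1 - 1 / K2)}"
  have n: "0 < n'" using dim_bound by simp
  have "(\<integral>x. deficit K2 (R.W x) \<partial>G) \<le> (\<integral>x. indicator ?A x \<partial>G)"
  proof (rule integral_mono[OF deficit_integrable[OF K2]])
    have "?A \<in> sets G" by measurable
    then show "integrable G (indicator ?A :: _ \<Rightarrow> real)" by (simp add: P.emeasure_eq_measure)
    fix x assume x: "x \<in> space G"
    show "deficit K2 (R.W x) \<le> indicator ?A x"
    proof (cases "R.W x < n' * (1 - 1 / K2)")
      case True
      then show ?thesis using x deficit_bounds(2)[OF K2, of "R.W x"] by (simp add: indicator_def)
    next
      case False
      then have "1 - 1 / K2 \<le> R.W x / n'" using n by (simp add: field_simps)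
      then have "deficit K2 (R.W x) = 0" by (simp add: deficit_def)
      then show ?thesis by simp
    qed
  qed
  also have "\<dots> = measure G ?A" by simp
  also have "\<dots> \<le> exp (- n' * (1 / K2)\<^sup>2 / 4)"
    using chi_square_lower_tail[of "{..<n}" "1 / K2"] K2 by simp
  finally show ?thesis by (simp add: power_divide mult.commute)
qed

text \<open>
  The weight favours small residuals, so by \<open>radial_weight_offset_moment\<close> the weighted mean of
  \<open>W / (N + b\<^sup>2)\<close> is at most one and that of its logarithm nonpositive. What is left is the
  logarithm of \<open>1 + b\<^sup>2 / N\<close>, at most \<open>ln 10 \<le> 3\<close> under the hypothesis.
\<close>

lemma deficit_log_mean:
  assumes K2: "1 < K2" and small: "b\<^sup>2 \<le> 9 * N"
  shows "integrable G (\<lambda>x. deficit K2 (R.W x) * (ln (O.W x / N) - 1))"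
    and "(\<integral>x. deficit K2 (R.W x) * (ln (O.W x / N) - 1) \<partial>G) \<le> 2 * (\<integral>x. deficit K2 (R.W x) \<partial>G)"
proof -
  interpret P: prob_space G by simp
  let ?g = "\<lambda>x. deficit K2 (R.W x)"
  show i: "integrable G (\<lambda>x. ?g x * (ln (O.W x / N) - 1))"
  proof (rule Bochner_Integration.integrable_bound)
    show "integrable G (\<lambda>x. ln (O.W x / N) - 1)" using log_integrable by simp
    show "AE x in G. norm (?g x * (ln (O.W x / N) - 1)) \<le> norm (ln (O.W x / N) - 1)"
      using deficit_bounds(1,2)[OF K2] by (intro AE_I2) (simp add: abs_mult mult_left_le_one_le)
  qed measurable
  define s where "s = N + b\<^sup>2"
  have N0: "0 < N" using N_ge by linarith
  have s: "0 < s" "s / N \<le> 10" "0 < s / N"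
    using N0 small by (auto simp: s_def add_pos_nonneg pos_divide_le_eq)
  have ln_s: "ln (s / N) \<le> 3"
  proof -
    have "(10::real) \<le> (5 / 2) ^ 3" by (simp add: power_divide)
    also have "\<dots> \<le> exp 1 ^ 3" using exp_1_bounds by (intro power_mono) auto
    also have "\<dots> = exp (3::real)" by (simp add: exp_of_nat_mult[symmetric])
    finally have e3: "(10::real) \<le> exp 3" .
    have "ln (s / N) \<le> ln (exp 3)"
      using s(3) order_trans[OF s(2) e3] by (subst ln_le_cancel_iff) simp_all
    then show ?thesis by simp
  qed
  have i2: "integrable G (\<lambda>x. ?g x * O.W x / s + ?g x)"
    using deficit_W_integrable[OF K2] deficit_integrable[OF K2] by simp
  have "(\<integral>x. ?g x * (ln (O.W x / N) - 1) \<partial>G) \<le> (\<integral>x. ?g x * O.W x / s + ?g x \<partial>G)"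
  proof (rule integral_mono_AE[OF i i2])
    show "AE x in G. ?g x * (ln (O.W x / N) - 1) \<le> ?g x * O.W x / s + ?g x"
      using AE_pos
    proof eventually_elim
      case (elim x)
      have "O.W x / N = (O.W x / s) * (s / N)" using s by simp
      moreover have "ln ((O.W x / s) * (s / N)) = ln (O.W x / s) + ln (s / N)"
        by (rule ln_mult_pos[OF divide_pos_pos[OF elim s(1)] s(3)])
      ultimately have "ln (O.W x / N) = ln (O.W x / s) + ln (s / N)" by presburger
      moreover have "ln (O.W x / s) \<le> O.W x / s - 1" using elim s by (intro ln_le_minus_one) auto
      ultimately have "ln (O.W x / N) - 1 \<le> O.W x / s + 1" using ln_s by linarith
      from mult_left_mono[OF this deficit_bounds(1)[OF K2, of "R.W x"]]
      show ?case by (simp add: distrib_left)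
    qed
  qed
  also have "\<dots> = (\<integral>x. ?g x * O.W x \<partial>G) / s + (\<integral>x. ?g x \<partial>G)"
    using deficit_W_integrable[OF K2] deficit_integrable[OF K2] by simp
  also have "(\<integral>x. ?g x * O.W x \<partial>G) / s \<le> (\<integral>x. ?g x \<partial>G)"
    using deficit_W_mean[OF K2] s by (simp add: s_def pos_divide_le_eq mult.commute)
  finally show "(\<integral>x. ?g x * (ln (O.W x / N) - 1) \<partial>G) \<le> 2 * (\<integral>x. ?g x \<partial>G)" by simp
qed

text \<open>
  Since \<open>b\<^sup>2 \<le> 2 (x D + b)\<^sup>2 + 2 (x D)\<^sup>2\<close>, the ratio
  \<open>b\<^sup>2 / W\<close> is at most \<open>2 + 2 (x D)\<^sup>2 / V\<close>, of mean at most 3. So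
  \<open>E (N / W) \<le> 1 / 3\<close> and the tangent bound \<open>ln (W / N) \<ge> 2 - e N / W\<close> applies.
\<close>

lemma log_mean_large_offset:
  assumes large: "9 * N \<le> b\<^sup>2"
  shows "1 \<le> log_mean"
proof -
  interpret P: prob_space G by simp
  have N0: "0 < N" and N5: "5 \<le> N" using N_ge by linarith+
  have V2: "2 < V.N" using N5 unfolding card_eq by linarith
  have DJ: "D \<in> {..<n}" "D \<notin> {Suc D..<n}" using dim_bound by auto
  note ratio = V.independent_coordinate_ratio[OF V2 DJ]
  have "(\<integral>x. 1 / V.W x \<partial>G) \<le> 1 / (V.N - 2)"
    using V.inverse_moment(2)[of 1, OF _ V_ne] V2 by simp
  also have "\<dots> \<le> 1 / 2" using N5 unfolding card_eq by (intro divide_left_mono) auto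
  finally have V_mean: "(\<integral>x. (x D)\<^sup>2 / V.W x \<partial>G) \<le> 1 / 2" unfolding ratio(2) .
  have W_split: "O.W x = (x D + b)\<^sup>2 + V.W x" for x
  proof -
    have "{D..<n} = insert D {Suc D..<n}" using dim_bound by auto
    moreover have "(\<Sum>i\<in>{Suc D..<n}. (x i + offset i)\<^sup>2) = (\<Sum>i\<in>{Suc D..<n}. (x i + 0)\<^sup>2)"
      by (intro sum.cong) (auto simp: offset_def)
    ultimately show ?thesis unfolding offset_sq_def by (simp add: offset_def)
  qed
  have h: "has_bochner_integral G (\<lambda>x. 2 + 2 * ((x D)\<^sup>2 / V.W x)) (2 + 2 * (\<integral>x. (x D)\<^sup>2 / V.W x \<partial>G))"
    by (intro has_bochner_integral_add has_bochner_integral_mult_right has_bochner_integral_gauss_const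
        has_bochner_integral_integrable ratio(1))
  note i = integrable.intros[OF h]
  have "b\<^sup>2 * inv_mean = (\<integral>x. b\<^sup>2 * (1 / O.W x) \<partial>G)" by (rule integral_mult_right_zero[symmetric])
  also have "\<dots> \<le> (\<integral>x. 2 + 2 * ((x D)\<^sup>2 / V.W x) \<partial>G)"
  proof (rule integral_mono_AE[OF _ i])
    show "integrable G (\<lambda>x. b\<^sup>2 * (1 / O.W x))" using inverse_integrable by (rule integrable_mult_right)
    show "AE x in G. b\<^sup>2 * (1 / O.W x) \<le> 2 + 2 * ((x D)\<^sup>2 / V.W x)"
      using AE_pos AE_V_pos
    proof eventually_elim
      case (elim x)
      have "b\<^sup>2 \<le> 2 * (x D + b)\<^sup>2 + 2 * (x D)\<^sup>2"
        using zero_le_power2[of "2 * x D + b"] by (simp add: power2_eq_square algebra_simps)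
      then have "b\<^sup>2 \<le> 2 * O.W x + 2 * (x D)\<^sup>2" using elim W_split[of x] by simp
      then have "b\<^sup>2 / O.W x \<le> (2 * O.W x + 2 * (x D)\<^sup>2) / O.W x" using elim by (intro divide_right_mono) auto
      also have "\<dots> = 2 + 2 * ((x D)\<^sup>2 / O.W x)" using elim by (simp add: add_divide_distrib)
      also have "(x D)\<^sup>2 / O.W x \<le> (x D)\<^sup>2 / V.W x"
        using elim W_split[of x] by (intro divide_left_mono mult_pos_pos) auto
      finally show ?case by simp
    qed
  qed
  also have "\<dots> = 2 + 2 * (\<integral>x. (x D)\<^sup>2 / V.W x \<partial>G)" by (rule has_bochner_integral_integral_eq[OF h])
  finally have "b\<^sup>2 * inv_mean \<le> 3" using V_mean by linarith
  moreover have "9 * N * inv_mean \<le> b\<^sup>2 * inv_mean" using large inv_mean_nonneg by (rule mult_right_mono)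
  ultimately have Nc: "3 * (N * inv_mean) \<le> 1" by linarith
  have h2: "has_bochner_integral G (\<lambda>x. 2 - 3 * N * (1 / O.W x)) (2 - 3 * N * inv_mean)"
    by (intro has_bochner_integral_diff has_bochner_integral_mult_right has_bochner_integral_gauss_const
        has_bochner_integral_integrable inverse_integrable)
  note i2 = integrable.intros[OF h2]
  have "1 \<le> 2 - 3 * (N * inv_mean)" using Nc by linarith
  also have "\<dots> = (\<integral>x. 2 - 3 * N * (1 / O.W x) \<partial>G)"
    unfolding has_bochner_integral_integral_eq[OF h2] by (simp only: mult.assoc)
  also have "\<dots> \<le> log_mean"
  proof (rule integral_mono_AE[OF i2 log_integrable])
    show "AE x in G. 2 - 3 * N * (1 / O.W x) \<le> ln (O.W x / N)"
      using AE_pos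
    proof eventually_elim
      case (elim x)
      define y where "y = N / O.W x"
      have y: "0 < y" unfolding y_def using elim N0 by simp
      have "ln (exp 1 * y) \<le> exp 1 * y - 1" using y by (intro ln_le_minus_one) auto
      moreover have "ln (exp 1 * y) = 1 + ln y" using y by (simp add: ln_mult)
      moreover have "exp 1 * y \<le> 3 * y" using y exp_1_bounds by (intro mult_right_mono) auto
      moreover have "ln (O.W x / N) = - ln y" unfolding y_def using elim N0 by (simp add: ln_div)
      ultimately show ?case unfolding y_def by simp
    qed
  qed
  finally show ?thesis .
qed

text \<open>
  The pathwise comparison allows any multiplier \<open>d\<close> of the noise level with \<open>d \<le> 1 / K2\<close> that
  stays close to \<open>1 - r / n\<close>. Truncating \<open>1 - r / n\<close> at \<open>1 / K2\<close> gives \<open>d\<close> a negative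
  mean, so a large \<open>E (ln W)\<close> would not cancel against the loss. Hence the two cases: for
  \<open>b\<^sup>2 \<le> 9 N\<close> the truncation is harmless, and for larger bias \<open>E (ln (W / N)) \<ge> 1\<close> and
  the constant multiplier \<open>1 / K2\<close> is good enough.
\<close>

lemma selection_target:
  assumes K2: "1 < K2" and p: "0 \<le> p"
  obtains d where "\<And>r. 0 \<le> r \<Longrightarrow> d r \<le> 1 / K2"
    and "\<And>r. 0 \<le> r \<Longrightarrow> 1 - r / n' - d r \<le> deficit K2 r"
    and "integrable G (\<lambda>x. (1 - d (R.W x)) * (n' / 2 * ln (O.W x / N) + p / 2) + d (R.W x) * n' / 2)"
    and "(\<integral>x. (1 - d (R.W x)) * (n' / 2 * ln (O.W x / N) + p / 2) + d (R.W x) * n' / 2 \<partial>G)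
      \<le> (\<integral>x. loss x \<partial>G) + D' / 2 + p + n' * exp (- n' / (4 * K2\<^sup>2))"
proof (cases "b\<^sup>2 \<le> 9 * N")
  case True
  let ?g = "\<lambda>x. deficit K2 (R.W x)"
  define d where "d r = min (1 - r / n') (1 / K2)" for r
  have n: "0 < n'" using dim_bound by simp
  have dg: "d r = 1 - r / n' - deficit K2 r" if "0 \<le> r" for r
    using that unfolding d_def deficit_def by (simp add: min_def max_def)
  let ?e = "\<integral>x. ?g x \<partial>G" and ?l = "\<integral>x. ?g x * (ln (O.W x / N) - 1) \<partial>G"
  have eq: "(1 - d (R.W x)) * (n' / 2 * ln (O.W x / N) + p / 2) + d (R.W x) * n' / 2
    = log_target x + n' / 2 * (?g x * (ln (O.W x / N) - 1)) + p / 2 * (1 / n' * R.W x + ?g x)" for x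
  proof -
    define r where "r = R.W x / n'"
    have R: "R.W x = n' * r" using n by (simp add: r_def)
    show ?thesis unfolding dg[OF offset_sq_nonneg] log_target_def unfolding R using n
      by (simp add: algebra_simps add_divide_distrib diff_divide_distrib)
  qed
  have h: "has_bochner_integral G (\<lambda>x. (1 - d (R.W x)) * (n' / 2 * ln (O.W x / N) + p / 2) + d (R.W x) * n' / 2)
     ((\<integral>x. log_target x \<partial>G) + n' / 2 * ?l + p / 2 * (1 / n' * (\<integral>x. R.W x \<partial>G) + ?e))"
    unfolding eq
    by (intro has_bochner_integral_add has_bochner_integral_mult_right has_bochner_integral_integrable
        log_target_mean deficit_log_mean[OF K2 True] R_integrable deficit_integrable[OF K2])
  have e: "?e \<le> exp (- n' / (4 * K2\<^sup>2))" by (rule deficit_mean_bound[OF K2])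
  have e1: "?e \<le> 1"
  proof -
    have "exp (- n' / (4 * K2\<^sup>2)) \<le> 1" by simp
    with e show ?thesis by linarith
  qed
  have "n' / 2 * ?l \<le> n' / 2 * (2 * ?e)" using deficit_log_mean(2)[OF K2 True] n by (intro mult_left_mono) auto
  also have "\<dots> \<le> n' * exp (- n' / (4 * K2\<^sup>2))" using e n by simp
  finally have l: "n' / 2 * ?l \<le> n' * exp (- n' / (4 * K2\<^sup>2))" .
  have "p / 2 * (1 / n' * (\<integral>x. R.W x \<partial>G) + ?e) \<le> p / 2 * 2"
    unfolding R_mean using p e1 n by (intro mult_left_mono) auto
  then have pp: "p / 2 * (1 / n' * (\<integral>x. R.W x \<partial>G) + ?e) \<le> p" by simp
  show thesis
  proof (rule that[of d])
    show "d r \<le> 1 / K2" for r by (simp add: d_def)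
    show "1 - r / n' - d r \<le> deficit K2 r" if "0 \<le> r" for r using dg[OF that] by simp
    show "integrable G (\<lambda>x. (1 - d (R.W x)) * (n' / 2 * ln (O.W x / N) + p / 2) + d (R.W x) * n' / 2)"
      using h by (rule integrable.intros)
    show "(\<integral>x. (1 - d (R.W x)) * (n' / 2 * ln (O.W x / N) + p / 2) + d (R.W x) * n' / 2 \<partial>G)
      \<le> (\<integral>x. loss x \<partial>G) + D' / 2 + p + n' * exp (- n' / (4 * K2\<^sup>2))"
      unfolding has_bochner_integral_integral_eq[OF h] using log_target_mean(2) l pp by linarith
  qed
next
  case False
  then have L: "1 \<le> log_mean" by (intro log_mean_large_offset) simp
  have n: "0 < n'" using dim_bound by simp
  have k: "0 \<le> 1 / K2" "1 / K2 \<le> 1" using K2 by auto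
  have h: "has_bochner_integral G (\<lambda>x. (1 - 1 / K2) * (n' / 2 * ln (O.W x / N) + p / 2) + 1 / K2 * n' / 2)
     ((1 - 1 / K2) * (n' / 2 * log_mean + p / 2) + 1 / K2 * n' / 2)"
    by (intro has_bochner_integral_add has_bochner_integral_mult_right has_bochner_integral_gauss_const
        has_bochner_integral_integrable log_integrable)
  have "1 / K2 * (n' / 2 * 1) \<le> 1 / K2 * (n' / 2 * log_mean)" using L n k by (intro mult_left_mono) auto
  then have 1: "(1 - 1 / K2) * (n' / 2 * log_mean) + 1 / K2 * n' / 2 \<le> n' / 2 * log_mean"
  proof -
    have "(1 - k) * X + k * c \<le> X" if "k * c \<le> k * X" for k X c :: real
      using that by (simp add: left_diff_distrib)
    from this[of "1 / K2" "n' / 2" "n' / 2 * log_mean"] \<open>1 / K2 * (n' / 2 * 1) \<le> 1 / K2 * (n' / 2 * log_mean)\<close>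
    show ?thesis by simp
  qed
  have 5: "(1 - 1 / K2) * (n' / 2 * log_mean + p / 2) = (1 - 1 / K2) * (n' / 2 * log_mean) + (1 - 1 / K2) * (p / 2)"
    by (rule distrib_left)
  have 2: "(1 - 1 / K2) * (p / 2) \<le> p"
  proof -
    have "(1 - 1 / K2) * (p / 2) \<le> 1 * (p / 2)" using k p by (intro mult_right_mono) auto
    then show ?thesis using p by linarith
  qed
  have 3: "n' / 2 * log_mean \<le> (\<integral>x. loss x \<partial>G) + D' / 2"
    unfolding loss_mean_eq using N_inv_mean N_eq by argo
  have 4: "0 \<le> n' * exp (- n' / (4 * K2\<^sup>2))" by simp
  show thesis
  proof (rule that[of "\<lambda>_. 1 / K2"])
    show "1 - r / n' - 1 / K2 \<le> deficit K2 r" if "0 \<le> r" for r using that by (simp add: deficit_def)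
    show "integrable G (\<lambda>x. (1 - 1 / K2) * (n' / 2 * ln (O.W x / N) + p / 2) + 1 / K2 * n' / 2)"
      using h by (rule integrable.intros)
    show "(\<integral>x. (1 - 1 / K2) * (n' / 2 * ln (O.W x / N) + p / 2) + 1 / K2 * n' / 2 \<partial>G)
      \<le> (\<integral>x. loss x \<partial>G) + D' / 2 + p + n' * exp (- n' / (4 * K2\<^sup>2))"
      unfolding has_bochner_integral_integral_eq[OF h] using 1 2 3 4 5 by linarith
  qed simp
qed


lemma fisher_representation:
  fixes h :: "real \<Rightarrow> real"
  assumes h: "h \<in> borel_measurable borel" and i: "integrable (fisher (Suc D) (n - Suc D)) h"
  defines "F \<equiv> \<lambda>x. (U.W x / real (Suc D)) / (V.W x / (N - 1))"
  shows "has_bochner_integral G (\<lambda>x. h (F x)) (\<integral>f. h f \<partial>fisher (Suc D) (n - Suc D))"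
proof -
  have J: "{..<Suc D} \<union> {Suc D..<n} = {..<n}" using dim_bound by auto
  have c: "real (n - Suc D) = N - 1" using dim_bound by auto
  have fi: "fisher (Suc D) (n - Suc D) = distr G borel F"
    using fisher_eq_distr[of "{..<Suc D}" "{Suc D..<n}"]
    unfolding J F_def offset_sq_def card_lessThan card_atLeastLessThan c add_0_right by (simp add: ivl_disj_int)
  have m: "F \<in> borel_measurable G" unfolding F_def by measurable
  have "integrable G (\<lambda>x. h (F x))" using i unfolding fi integrable_distr_eq[OF m h] .
  moreover have "(\<integral>f. h f \<partial>fisher (Suc D) (n - Suc D)) = (\<integral>x. h (F x) \<partial>G)"
    unfolding fi by (rule integral_distr[OF m h])
  ultimately show ?thesis by (simp only: has_bochner_integral_integrable)
qed

text \<open>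
  Dividing \<open>U\<close> and \<open>V\<close> by their degrees of freedom \<open>D + 1\<close> and \<open>N - 1\<close> turns the excess
  into \<open>k * max 0 (F - z)\<close> with \<open>F\<close> Fisher distributed. The constant 5/4 is half the largest value
  of \<open>N / (N - 3)\<close> for \<open>N \<ge> 5\<close>.
\<close>

lemma excess_bound:
  fixes K1 K2 p :: real
  assumes K1: "1 < K1" and K2: "1 < K2"
  defines "E \<equiv> \<lambda>x. max 0 (K1 * U.W x * N / V.W x - D' - (1 - 1 / K2) * p)"
    and "Lam \<equiv> Fish (D + 1) (n - D - 1) ((N - 1) / (K1 * N) * ((K2 * D' + (K2 - 1) * p) / (K2 * (D' + 1))))"
  shows "integrable G E" and "(\<integral>x. E x \<partial>G) / 2 \<le> 5 * K1 / 4 * ((D' + 1) * Lam)"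
proof -
  define z where "z = (N - 1) / (K1 * N) * ((K2 * D' + (K2 - 1) * p) / (K2 * (D' + 1)))"
  define k where "k = K1 * N * (D' + 1) / (N - 1)"
  let ?F = "\<lambda>x. (U.W x / real (Suc D)) / (V.W x / (N - 1))"
  have N5: "5 \<le> N" by (rule N_ge)
  have k: "0 < k" unfolding k_def using N5 K1 by (intro divide_pos_pos mult_pos_pos) auto
  have kz: "k * z = D' + (1 - 1 / K2) * p"
  proof -
    have "A * M * e / y * (y / (A * M) * ((B * d + (B - 1) * p) / (B * e))) = d + (1 - 1 / B) * p"
      if "A \<noteq> 0" "M \<noteq> 0" "e \<noteq> 0" "y \<noteq> 0" "B \<noteq> 0" for A M e y B d :: real
      using that by (simp add: field_simps)
    from this[of K1 N "D' + 1" "N - 1" K2 D'] show ?thesis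
      unfolding k_def z_def using N5 K1 K2 by linarith
  qed
  have kF: "k * ?F x = K1 * U.W x * N / V.W x" for x
  proof -
    have "A * M * e / y * ((u / e) / (v / y)) = A * u * M / v" if "e \<noteq> 0" "y \<noteq> 0" for A M e y u v :: real
      using that by simp
    from this[of "D' + 1" "N - 1" K1 N "U.W x" "V.W x"] show ?thesis
      unfolding k_def of_nat_Suc using N5 by (simp only: add.commute[of 1])
  qed
  have kmax: "k * max 0 t = max 0 (k * t)" for t
    using k by (auto simp: max_def mult_le_0_iff zero_le_mult_iff)
  have E: "E = (\<lambda>x. k * max 0 (?F x - z))"
    unfolding kmax right_diff_distrib kF kz E_def by (simp only: diff_diff_eq)
  have d1: "1 \<le> Suc D" and d3: "3 \<le> n - Suc D" using dim_bound by auto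
  have h: "has_bochner_integral G E (k * (\<integral>f. max 0 (f - z) \<partial>fisher (Suc D) (n - Suc D)))"
    unfolding E
    by (intro has_bochner_integral_mult_right fisher_representation[where h = "\<lambda>f. max 0 (f - z)"]
        Fish_excess_integrable[OF d1 d3]) measurable
  show "integrable G E" using h by (rule integrable.intros)
  have Lam: "Lam = Fish (Suc D) (n - Suc D) z" by (simp add: Lam_def z_def)
  have L0: "0 \<le> Lam" unfolding Lam by (rule Fish_nonneg[OF d1 d3])
  have c: "real (n - Suc D) = N - 1" using dim_bound by auto
  have mean: "(\<integral>f. f \<partial>fisher (Suc D) (n - Suc D)) \<le> (N - 1) / (N - 3)"
    using fisher_mean(3)[OF d1 d3] unfolding c by (simp add: diff_diff_eq)
  have "(\<integral>x. E x \<partial>G) = k * (Lam * (\<integral>f. f \<partial>fisher (Suc D) (n - Suc D)))"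
    unfolding has_bochner_integral_integral_eq[OF h] Fish_mult_mean[OF d1 d3] Lam ..
  also have "\<dots> \<le> k * (Lam * ((N - 1) / (N - 3)))"
    using k L0 mean by (intro mult_left_mono) auto
  also have "\<dots> = (K1 * ((D' + 1) * Lam)) * (N / (N - 3))"
  proof -
    have "A * M * e / y * (l * (y / w)) = (A * (e * l)) * (M / w)" if "y \<noteq> 0" for A M e y l w :: real
      using that by simp
    moreover have "N - 1 \<noteq> 0" using N5 by linarith
    ultimately show ?thesis unfolding k_def by blast
  qed
  also have "\<dots> \<le> (K1 * ((D' + 1) * Lam)) * (5 / 2)"
  proof (rule mult_left_mono)
    have "M / (M - 3) \<le> 5 / 2" if "5 \<le> M" for M :: real
      using that by (simp add: field_simps)
    from this[OF N5] show "N / (N - 3) \<le> 5 / 2" .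
    show "0 \<le> K1 * ((D' + 1) * Lam)" using K1 L0 by simp
  qed
  finally show "(\<integral>x. E x \<partial>G) / 2 \<le> 5 * K1 / 4 * ((D' + 1) * Lam)" by simp
qed

text \<open>
  The least integer that is at least \<open>N / 4\<close>; from \<open>N = 5\<close> on it stays below \<open>N / 2\<close>, so the
  inverse moment of this order is finite.
\<close>

definition moment_order :: nat where "moment_order = (n - D + 3) div 4"

lemma moment_order_ge: "N / 4 \<le> real moment_order"
proof -
  have "n - D \<le> 4 * moment_order" unfolding moment_order_def by presburger
  then have "N \<le> real (4 * moment_order)" by (rule of_nat_mono)
  then have "N \<le> 4 * real moment_order" by (simp only: of_nat_mult of_nat_numeral)
  then show ?thesis by simp
qed

text \<open>
  Each factor \<open>N / (N - 2 j)\<close> is at most 3, except for \<open>N = 5\<close>, where the two factors 5/3 and 5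
  still have a product below 9.
\<close>

lemma ratio_moment:
  shows "integrable G (\<lambda>x. (N / O.W x) ^ moment_order)"
    and "(\<integral>x. (N / O.W x) ^ moment_order \<partial>G) \<le> 3 ^ moment_order"
proof -
  let ?q = moment_order
  have q2: "2 * ?q < n - D" unfolding moment_order_def using dim_bound by presburger
  have "real (2 * ?q) < N" using q2 by (rule of_nat_less_iff[THEN iffD2])
  then have q2': "2 * real ?q < O.N" unfolding card_eq by (simp only: of_nat_mult of_nat_numeral)
  have eq: "(N / O.W x) ^ ?q = N ^ ?q * (1 / O.W x ^ ?q)" for x by (simp add: power_divide)
  show "integrable G (\<lambda>x. (N / O.W x) ^ ?q)"
    unfolding eq by (intro integrable_mult_right O.inverse_moment(1)[OF q2' O_ne])
  have "(\<integral>x. (N / O.W x) ^ ?q \<partial>G) = N ^ ?q * (\<integral>x. 1 / O.W x ^ ?q \<partial>G)"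
    unfolding eq by (rule integral_mult_right_zero)
  also have "\<dots> \<le> N ^ ?q * (\<Prod>j=1..?q. 1 / (N - 2 * real j))"
    by (rule mult_left_mono[OF O.inverse_moment(2)[OF q2' O_ne, unfolded card_eq]]) (rule zero_le_power, rule of_nat_0_le_iff)
  also have "\<dots> = (\<Prod>j=1..?q. N / (N - 2 * real j))"
    unfolding prod_dividef prod_constant by simp
  also have "\<dots> \<le> 3 ^ ?q"
  proof (cases "n - D = 5")
    case True
    have q: "?q = 2" unfolding moment_order_def True by simp
    have two: "(\<Prod>j=1..2. f j) = f 1 * f 2" for f :: "nat \<Rightarrow> real"
      by (simp add: numeral_2_eq_2)
    have N: "N = 5" unfolding True by simp
    show ?thesis unfolding q N two by simp
  next
    case False
    then have "6 \<le> n - D" using dim_bound by linarith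
    moreover have "3 * ((k + 3) div 4) \<le> k" if "6 \<le> k" for k :: nat using that by presburger
    ultimately have "3 * ?q \<le> n - D" unfolding moment_order_def by blast
    then have "real (3 * ?q) \<le> N" by (rule of_nat_mono)
    then have q3: "3 * real ?q \<le> N" by (simp only: of_nat_mult of_nat_numeral)
    have "(\<Prod>j=1..?q. N / (N - 2 * real j)) \<le> (\<Prod>j=1..?q. 3)"
    proof (rule prod_mono)
      fix j assume "j \<in> {1..?q}"
      then have j: "real j \<le> real ?q" by simp
      have "0 < M - 2 * t" if "t \<le> r" "3 * r \<le> M" "5 \<le> M" for M t r :: real
        using that by linarith
      note pos = this[OF j q3 N_ge]
      have "M \<le> 3 * (M - 2 * t)" if "t \<le> r" "3 * r \<le> M" for M t r :: real
        using that by argo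
      note le = this[OF j q3]
      have "0 \<le> N" by simp
      with le show "0 \<le> N / (N - 2 * real j) \<and> N / (N - 2 * real j) \<le> 3"
        using pos_divide_le_eq[OF pos, of N 3] divide_nonneg_pos[OF _ pos, of N] by blast
    qed
    moreover have "(\<Prod>j=1..q. 3 :: real) = 3 ^ q" for q :: nat by simp
    ultimately show ?thesis by (simp only:)
  qed
  finally show "(\<integral>x. (N / O.W x) ^ ?q \<partial>G) \<le> 3 ^ ?q" .
qed

end

section \<open>Orthonormal coordinates adapted to a model\<close>

lemma orth_proj_eqI:
  assumes S: "subspace S" and p: "p \<in> S" "\<And>x. x \<in> S \<Longrightarrow> orthogonal (y - p) x"
  shows "orth_proj S y = p"
  unfolding orth_proj_def
proof (rule the_equality)
  show "p \<in> S \<and> (\<forall>x\<in>S. orthogonal (y - p) x)" using p by blast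
  fix q assume q: "q \<in> S \<and> (\<forall>x\<in>S. orthogonal (y - q) x)"
  have "q - p \<in> S" using S p(1) q by (intro subspace_diff) auto
  then have "(y - p) \<bullet> (q - p) = 0" "(y - q) \<bullet> (q - p) = 0"
    using p(2) q by (auto simp: orthogonal_def)
  then have "(q - p) \<bullet> (q - p) = 0" by (simp add: inner_diff_left)
  then show "q = p" by simp
qed

lemma orthonormal_enumeration:
  fixes S :: "'a::euclidean_space set"
  assumes "subspace S"
  obtains f :: "nat \<Rightarrow> 'a" where "\<And>i. i < dim S \<Longrightarrow> f i \<in> S"
    and "\<And>i j. i < dim S \<Longrightarrow> j < dim S \<Longrightarrow> f i \<bullet> f j = (if i = j then 1 else 0)"
proof -
  obtain B where B: "B \<subseteq> S" "pairwise orthogonal B" "\<And>x. x \<in> B \<Longrightarrow> norm x = 1"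
      "independent B" "card B = dim S" "span B = S"
    using orthonormal_basis_subspace[OF assms] by metis
  have "finite B" using B(4) by (rule independent_imp_finite)
  then obtain f where f: "bij_betw f {..<dim S} B"
    using ex_bij_betw_nat_finite B(5) by (metis atLeast0LessThan)
  have fB: "i < dim S \<Longrightarrow> f i \<in> B" for i using f by (auto simp: bij_betw_def)
  show thesis
  proof (rule that[of f])
    show "f i \<in> S" if "i < dim S" for i using fB[OF that] B(1) by blast
    show "f i \<bullet> f j = (if i = j then 1 else 0)" if ij: "i < dim S" "j < dim S" for i j
    proof (cases "i = j")
      case True
      have "norm (f i) = 1" by (rule B(3)[OF fB[OF ij(1)]])
      then show ?thesis using True by (simp add: norm_eq_1)
    next
      case False
      then have "f i \<noteq> f j" using f ij by (auto simp: bij_betw_def inj_on_def)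
      then have "orthogonal (f i) (f j)" using B(2) fB ij by (auto simp: pairwise_def)
      then show ?thesis using False by (simp add: orthogonal_def)
    qed
  qed
qed

text \<open>
  After a basis of \<open>S\<close> comes a unit vector along the component of \<open>\<mu>\<close> orthogonal to \<open>S\<close> (any
  unit vector orthogonal to \<open>S\<close> if that component vanishes), then a basis of what is left.
\<close>

lemma adapted_orthonormal_basis:
  fixes S :: "'a::euclidean_space set" and \<mu> :: 'a
  assumes S: "subspace S" and D: "dim S < DIM('a)"
  obtains e :: "nat \<Rightarrow> 'a" where
    "\<And>i j. i < DIM('a) \<Longrightarrow> j < DIM('a) \<Longrightarrow> e i \<bullet> e j = (if i = j then 1 else 0)"
    and "\<And>i. i < dim S \<Longrightarrow> e i \<in> S"
    and "\<And>x i. x \<in> S \<Longrightarrow> dim S \<le> i \<Longrightarrow> i < DIM('a) \<Longrightarrow> x \<bullet> e i = 0"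
    and "\<And>i. dim S < i \<Longrightarrow> i < DIM('a) \<Longrightarrow> \<mu> \<bullet> e i = 0"
proof -
  have spS: "span S = S" using S by (simp add: span_eq_iff)
  obtain y z where yz: "y \<in> S" "\<And>w. w \<in> S \<Longrightarrow> orthogonal z w" "\<mu> = y + z"
    using orthogonal_subspace_decomp_exists[of S \<mu>] unfolding spS by metis
  have "\<exists>u. norm u = 1 \<and> (\<forall>w\<in>S. orthogonal w u) \<and> (\<exists>c. z = c *\<^sub>R u)"
  proof (cases "z = 0")
    case False
    then show ?thesis
      using yz(2) by (intro exI[of _ "z /\<^sub>R norm z"] conjI ballI exI[of _ "norm z"])
        (auto simp: orthogonal_def inner_commute)
  next
    case True
    let ?C = "{y \<in> UNIV. \<forall>x\<in>S. orthogonal x y}"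
    have "dim ?C + dim S = DIM('a)"
      using dim_subspace_orthogonal_to_vectors[OF S subspace_UNIV] by simp
    then have "dim ?C \<noteq> 0" using D by linarith
    then have "\<not> ?C \<subseteq> {0}" by (subst dim_eq_0[symmetric])
    then obtain w where w: "w \<noteq> 0" "w \<in> ?C" unfolding subset_iff singleton_iff by metis
    then show ?thesis using True
      by (intro exI[of _ "w /\<^sub>R norm w"] conjI ballI exI[of _ 0]) (auto simp: orthogonal_def)
  qed
  then obtain u c where u: "norm u = 1" "\<And>w. w \<in> S \<Longrightarrow> orthogonal w u" "z = c *\<^sub>R u" by blast
  have uu: "u \<bullet> u = 1" using u(1) by (simp add: norm_eq_1)
  have uS: "u \<notin> S" using u(2)[of u] uu by (auto simp: orthogonal_def)
  define T where "T = {y \<in> UNIV. \<forall>x\<in>span (insert u S). orthogonal x y}"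
  have subT: "subspace T" unfolding T_def by (auto simp: subspace_def orthogonal_def inner_right_distrib)
  have dimT: "dim T + (dim S + 1) = DIM('a)"
    using dim_subspace_orthogonal_to_vectors[OF subspace_span subspace_UNIV, of "insert u S"] uS spS
    unfolding T_def by (simp add: dim_insert)
  obtain f where f: "\<And>i. i < dim S \<Longrightarrow> f i \<in> S"
    "\<And>i j. i < dim S \<Longrightarrow> j < dim S \<Longrightarrow> f i \<bullet> f j = (if i = j then 1 else 0)"
    using orthonormal_enumeration[OF S] by blast
  obtain g where g: "\<And>i. i < dim T \<Longrightarrow> g i \<in> T"
    "\<And>i j. i < dim T \<Longrightarrow> j < dim T \<Longrightarrow> g i \<bullet> g j = (if i = j then 1 else 0)"
    using orthonormal_enumeration[OF subT] by blast
  have gS: "x \<bullet> g i = 0" if "x \<in> S" "i < dim T" for x i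
    using g(1)[OF that(2)] that(1) unfolding T_def orthogonal_def by (auto intro: span_base)
  have gu: "u \<bullet> g i = 0" if "i < dim T" for i
    using g(1)[OF that] unfolding T_def orthogonal_def by (auto intro: span_base)
  have Su: "x \<bullet> u = 0" if "x \<in> S" for x using u(2)[OF that] by (simp add: orthogonal_def)
  define e where "e i = (if i < dim S then f i else if i = dim S then u else g (i - dim S - 1))" for i
  have ef: "e i = f i" if "i < dim S" for i using that by (simp add: e_def)
  have eu: "e (dim S) = u" by (simp add: e_def)
  have eg: "e i = g (i - dim S - 1)" "i - dim S - 1 < dim T" if "dim S < i" "i < DIM('a)" for i
    using that dimT by (auto simp: e_def)
  have i_cases: "i < dim S \<or> i = dim S \<or> dim S < i" for i by linarith
  have gg: "g (i - dim S - 1) \<bullet> g (j - dim S - 1) = (if i = j then 1 else 0)"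
    if "dim S < i" "i < DIM('a)" "dim S < j" "j < DIM('a)" for i j
  proof -
    have "i - dim S - 1 = j - dim S - 1 \<longleftrightarrow> i = j" using that by linarith
    then show ?thesis using g(2)[OF eg(2)[OF that(1,2)] eg(2)[OF that(3,4)]] by presburger
  qed
  show thesis
  proof (rule that[of e])
    show "e i \<bullet> e j = (if i = j then 1 else 0)" if ij: "i < DIM('a)" "j < DIM('a)" for i j
    proof -
      have sym: "e i \<bullet> e j = e j \<bullet> e i" by (rule inner_commute)
      from i_cases[of i] i_cases[of j] show ?thesis
      proof (elim disjE)
        assume i: "i < dim S" and j: "j < dim S"
        show ?thesis by (simp add: ef[OF i] ef[OF j] f(2)[OF i j])
      next
        assume i: "i < dim S" and j: "j = dim S"
        show ?thesis using Su[OF f(1)[OF i]] i by (simp add: ef[OF i] j eu)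
      next
        assume i: "i < dim S" and j: "dim S < j"
        show ?thesis using gS[OF f(1)[OF i] eg(2)[OF j ij(2)]] i j by (simp add: ef[OF i] eg(1)[OF j ij(2)])
      next
        assume i: "i = dim S" and j: "j < dim S"
        show ?thesis unfolding sym using Su[OF f(1)[OF j]] j by (simp add: ef[OF j] i eu)
      next
        assume i: "i = dim S" and j: "j = dim S"
        show ?thesis by (simp add: i j eu uu)
      next
        assume i: "i = dim S" and j: "dim S < j"
        show ?thesis using gu[OF eg(2)[OF j ij(2)]] j by (simp add: i eu eg(1)[OF j ij(2)])
      next
        assume i: "dim S < i" and j: "j < dim S"
        show ?thesis unfolding sym using gS[OF f(1)[OF j] eg(2)[OF i ij(1)]] i j by (simp add: ef[OF j] eg(1)[OF i ij(1)])
      next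
        assume i: "dim S < i" and j: "j = dim S"
        show ?thesis unfolding sym using gu[OF eg(2)[OF i ij(1)]] i by (simp add: j eu eg(1)[OF i ij(1)])
      next
        assume i: "dim S < i" and j: "dim S < j"
        show ?thesis unfolding eg(1)[OF i ij(1)] eg(1)[OF j ij(2)] by (rule gg[OF i ij(1) j ij(2)])
      qed
    qed
    show "e i \<in> S" if "i < dim S" for i using f(1) that by (simp add: ef)
    show "x \<bullet> e i = 0" if "x \<in> S" "dim S \<le> i" "i < DIM('a)" for x i
    proof (cases "i = dim S")
      case True then show ?thesis using Su[OF that(1)] by (simp add: eu)
    next
      case False
      then have "dim S < i" using that by simp
      from eg[OF this that(3)] gS[OF that(1)] show ?thesis by simp
    qed
    show "\<mu> \<bullet> e i = 0" if "dim S < i" "i < DIM('a)" for i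
      unfolding yz(3) u(3) eg(1)[OF that] using gS[OF yz(1) eg(2)[OF that]] gu[OF eg(2)[OF that]]
      by (simp add: inner_left_distrib)
  qed
qed

lemma distr_iid_vector:
  fixes \<epsilon> :: "'n::finite \<Rightarrow> 'w \<Rightarrow> real"
  assumes M: "prob_space M" and ind: "prob_space.indep_vars M (\<lambda>_. borel) \<epsilon> UNIV"
    and dist: "\<And>i. distributed M lborel (\<epsilon> i) std_normal_density"
  shows "(\<lambda>\<omega>. \<chi> i. \<epsilon> i \<omega>) \<in> M \<rightarrow>\<^sub>M borel"
    and "distr M borel (\<lambda>\<omega>. \<chi> i. \<epsilon> i \<omega>) = (gauss_vec :: (real ^ 'n) measure)"
proof -
  interpret prob_space M by (rule M)
  have rv [measurable]: "\<epsilon> i \<in> borel_measurable M" for i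
    using distributed_measurable[OF dist[of i]] by simp
  have d1: "distr M borel (\<epsilon> i) = std_gauss" for i
  proof -
    have "distr M borel (\<epsilon> i) = distr M lborel (\<epsilon> i)" by (rule distr_cong) simp_all
    then show ?thesis using distributed_distr_eq_density[OF dist[of i]] by simp
  qed
  have joint: "distr M (Pi\<^sub>M UNIV (\<lambda>_. borel)) (\<lambda>\<omega>. \<lambda>i\<in>UNIV. \<epsilon> i \<omega>) = gauss UNIV"
    using ind indep_vars_iff_distr_eq_PiM'[where I = UNIV and M' = "\<lambda>_. borel" and X = \<epsilon>] by (simp add: d1)
  define \<iota> where "\<iota> b = (THE i. b = axis i (1::real))" for b :: "real ^ 'n"
  have \<iota>: "\<iota> (axis i 1) = i" for i :: 'n
    unfolding \<iota>_def by (rule the_equality) (auto simp: axis_eq_axis)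
  have Basis_eq: "(Basis :: (real ^ 'n) set) = range (\<lambda>i. axis i 1)"
    by (auto simp: Basis_vec_def)
  have inj_axis: "inj (\<lambda>i :: 'n. axis i (1::real))" by (auto intro!: injI simp: axis_eq_axis)
  have vec_sum: "(\<Sum>b\<in>Basis. x (\<iota> b) *\<^sub>R b) = (\<chi> i. x i)" for x :: "'n \<Rightarrow> real"
  proof -
    have "(\<Sum>b\<in>Basis. x (\<iota> b) *\<^sub>R b) = (\<Sum>i\<in>UNIV. x i *\<^sub>R axis i 1)"
      unfolding Basis_eq by (subst sum.reindex[OF inj_axis]) (simp add: \<iota>)
    also have "\<dots> = (\<chi> i. x i)"
      by (simp add: vec_eq_iff sum_component axis_def if_distrib cong: if_cong)
    finally show ?thesis .
  qed
  have reindex: "gauss (Basis :: (real ^ 'n) set)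
      = distr (gauss UNIV) (gauss Basis) (\<lambda>\<omega>. \<lambda>b\<in>Basis. \<omega> (\<iota> b))"
    by (intro distr_PiM_reindex[symmetric]) (auto simp: Basis_eq inj_on_def \<iota>)
  have m1: "(\<lambda>f. \<Sum>b\<in>Basis. f b *\<^sub>R b) \<in> gauss (Basis :: (real ^ 'n) set) \<rightarrow>\<^sub>M borel"
    by (intro borel_measurable_sum borel_measurable_scaleR gauss_coord_measurable borel_measurable_const)
  have m2: "(\<lambda>\<omega>. \<lambda>b\<in>Basis. \<omega> (\<iota> b)) \<in> gauss UNIV \<rightarrow>\<^sub>M gauss (Basis :: (real ^ 'n) set)"
    by (intro measurable_restrict measurable_component_singleton) simp
  have comp: "(\<lambda>f. \<Sum>b\<in>Basis. f b *\<^sub>R b) \<circ> (\<lambda>\<omega>. \<lambda>b\<in>Basis. \<omega> (\<iota> b)) = (\<lambda>x :: 'n \<Rightarrow> real. (\<chi> i. x i) :: real ^ 'n)"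
    unfolding vec_sum[symmetric] by (auto simp: fun_eq_iff intro!: sum.cong)
  have law: "distr (gauss UNIV) borel (\<lambda>x. \<chi> i. x i) = (gauss_vec :: (real ^ 'n) measure)"
    unfolding gauss_Basis_distr[symmetric] comp[symmetric] distr_distr[OF m1 m2, symmetric]
    by (rule arg_cong[where f = "\<lambda>L. distr L borel _", OF reindex[symmetric]])
  have m3: "(\<lambda>x :: 'n \<Rightarrow> real. (\<chi> i. x i) :: real ^ 'n) \<in> Pi\<^sub>M UNIV (\<lambda>_. borel) \<rightarrow>\<^sub>M borel"
    using measurable_comp[OF m2 m1] unfolding comp by (simp only: measurable_cong_sets[OF sets_gauss refl])
  have m4: "(\<lambda>\<omega>. \<lambda>i\<in>UNIV. \<epsilon> i \<omega>) \<in> M \<rightarrow>\<^sub>M Pi\<^sub>M UNIV (\<lambda>_. borel)" by measurable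
  have c2: "(\<lambda>x. \<chi> i. x i) \<circ> (\<lambda>\<omega>. \<lambda>i\<in>UNIV. \<epsilon> i \<omega>) = (\<lambda>\<omega>. \<chi> i. \<epsilon> i \<omega>)" by (auto simp: fun_eq_iff)
  show "(\<lambda>\<omega>. \<chi> i. \<epsilon> i \<omega>) \<in> M \<rightarrow>\<^sub>M borel"
    using measurable_comp[OF m4 m3] unfolding c2 .
  show "distr M borel (\<lambda>\<omega>. \<chi> i. \<epsilon> i \<omega>) = (gauss_vec :: (real ^ 'n) measure)"
    unfolding c2[symmetric] distr_distr[OF m3 m4, symmetric] joint law ..
qed

section \<open>Comparison of the selected model with a fixed one\<close>

text \<open>
  The deterministic heart of the comparison, for the selected model. A fraction \<open>1 / K1\<close> of the loss
  is given away. It absorbs \<open>d\<close> times the nonnegative term \<open>\<psi>\<close>, as \<open>d \<le> 1 / K2 \<le> 1 / K1\<close>,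
  and, through \<open>b\<^sup>2 / K1\<close>, the cross term between bias and noise. What remains of the
  logarithm has weight \<open>1 - d \<ge> 1 - 1 / K2\<close> and is compared by the criterion; all terms in
  \<open>1 / W\<close> combine to \<open>K1 U N / V\<close>, up to the part of \<open>1 - r / n\<close> not covered by
  \<open>d\<close>.
\<close>

lemma kullback_pathwise_bound:
  fixes n N D K1 K2 p d g W V U Q x b B r loss :: real
  assumes n: "n = N + D" and N: "0 < N" and n0: "0 < n" and V: "0 < V" and Q: "0 \<le> Q"
    and W: "W = (x + b)\<^sup>2 + V" and U: "U = Q + x\<^sup>2" and r: "r = Q + x\<^sup>2 + V"
    and K: "1 < K1" "K1 \<le> K2" and p: "0 \<le> p"
    and d: "d \<le> 1 / K2" and g: "1 - r / n - d \<le> g"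
    and B: "n / 2 * ln (W / N) + p / 2 \<le> B"
    and loss: "loss = n / 2 * (ln (W / N) + N / W - 1) + (b\<^sup>2 + Q) * N / (2 * W)"
  shows "(1 - 1 / K1) * loss \<le> ((1 - d) * B + d * n / 2)
      + max 0 (K1 * U * N / V - D - (1 - 1 / K2) * p) / 2 + n / 2 * (g * (N / W))"
proof -
  have W0: "0 < W" "V \<le> W" using V by (auto simp: W add_nonneg_pos)
  define y where "y = N / (2 * W)"
  have y0: "0 < y" using N W0 by (simp add: y_def)
  have yW: "y * W = N / 2" and NW: "N / W = 2 * y" using W0 by (auto simp: y_def)
  define l where "l = ln (W / N)"
  define \<psi> where "\<psi> = l + 2 * y - 1"
  have \<psi>0: "0 \<le> \<psi>"
  proof -
    have "ln (N / W) \<le> N / W - 1" using N W0 by (intro ln_le_minus_one) auto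
    moreover have "ln (N / W) = - l" using N W0 by (simp add: l_def ln_div)
    ultimately show ?thesis unfolding \<psi>_def NW by linarith
  qed
  define k where "k = 1 / K1"
  have k: "0 < k" "k < 1" "K1 * k = 1" using K by (auto simp: k_def)
  have k2: "1 / K2 \<le> k" unfolding k_def using K by (intro divide_left_mono) auto
  have k2': "1 / K2 < 1" using K by simp
  define c where "c = b\<^sup>2 + Q"
  have c0: "0 \<le> c" using Q by (simp add: c_def)
  have loss': "loss = n / 2 * \<psi> + c * y"
    unfolding loss \<psi>_def l_def NW c_def y_def by simp
  \<comment> \<open>the part of the loss given away pays for the multiplier d\<close>
  have "d * (n / 2 * \<psi>) \<le> k * (n / 2 * \<psi>)"
    using d k2 \<psi>0 n0 by (intro mult_right_mono mult_nonneg_nonneg) auto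
  moreover have "(1 - k) * (A + C) \<le> (1 - d) * A + (1 - k) * C" if "d * A \<le> k * A" for A C :: real
    using that by (simp add: algebra_simps)
  ultimately have 1: "(1 - k) * loss \<le> (1 - d) * (n / 2 * \<psi>) + (1 - k) * (c * y)"
    unfolding loss' by blast
  have d1: "1 - 1 / K2 \<le> 1 - d" "0 \<le> 1 - d" using d k2' by auto
  have 2: "(1 - d) * (n / 2 * l) \<le> (1 - d) * B - (1 - 1 / K2) * (p / 2)"
  proof -
    have "(1 - d) * (n / 2 * l + p / 2) \<le> (1 - d) * B"
      using B d1 unfolding l_def by (intro mult_left_mono) auto
    moreover have "(1 - 1 / K2) * (p / 2) \<le> (1 - d) * (p / 2)" using d1 p by (intro mult_right_mono) auto
    ultimately show ?thesis by (simp add: distrib_left)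
  qed
  have 3: "(1 - d) * n \<le> r + n * g"
  proof -
    have "n * (1 - r / n - d) \<le> n * g" using g n0 by (intro mult_left_mono) auto
    then show ?thesis using n0 by (simp add: algebra_simps)
  qed
  \<comment> \<open>complete the square in x + b / K1, and use K1 + 1 / K1 >= 2\<close>
  have cross: "(1 - k) * c + r - W \<le> K1 * U"
  proof -
    have "0 \<le> K1 * (x + k * b)\<^sup>2" using K by simp
    also have "K1 * (x + k * b)\<^sup>2 = K1 * x\<^sup>2 + 2 * (K1 * k) * (x * b) + (K1 * k) * k * b\<^sup>2"
      by (simp add: power2_eq_square algebra_simps)
    finally have sq: "0 \<le> K1 * x\<^sup>2 + 2 * (x * b) + k * b\<^sup>2" unfolding k(3) by simp
    have "0 \<le> (K1 - 1)\<^sup>2 * k" using k by simp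
    also have "(K1 - 1)\<^sup>2 * k = K1 * (K1 * k) - 2 * (K1 * k) + k" by (simp add: power2_eq_square algebra_simps)
    finally have "2 - k \<le> K1" unfolding k(3) by simp
    from mult_right_mono[OF this Q] have q: "(2 - k) * Q \<le> K1 * Q" .
    have "(1 - k) * c + r - W = (2 - k) * Q - 2 * (x * b) - k * b\<^sup>2"
      unfolding c_def r W by (simp add: power2_eq_square algebra_simps)
    then show ?thesis unfolding U using sq q by (simp add: distrib_left)
  qed
  have U0: "0 \<le> U" unfolding U using Q by simp
  have "y * ((1 - k) * c + r - W) \<le> y * (K1 * U)" using cross y0 by (intro mult_left_mono) auto
  also have "\<dots> \<le> K1 * U * N / (2 * V)"
  proof -
    have "y \<le> N / (2 * V)" unfolding y_def using W0 V N by (intro divide_left_mono) auto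
    then have "y * (K1 * U) \<le> N / (2 * V) * (K1 * U)" using K U0 by (intro mult_right_mono) auto
    then show ?thesis by (simp add: ac_simps)
  qed
  finally have 4: "y * ((1 - k) * c + r - W) \<le> K1 * U * N / V / 2" by simp
  have 5: "y * ((1 - d) * n) \<le> y * (r + n * g)" using 3 y0 by (intro mult_left_mono) auto
  have "(1 - d) * (n / 2 * \<psi>) + (1 - k) * (c * y)
      = (1 - d) * (n / 2 * l) + y * ((1 - d) * n) - (1 - d) * (n / 2) + y * ((1 - k) * c)"
    unfolding \<psi>_def by (simp add: algebra_simps)
  also have "\<dots> \<le> (1 - d) * B - (1 - 1 / K2) * (p / 2) + y * (r + n * g) - (1 - d) * (n / 2) + y * ((1 - k) * c)"
    using 2 5 by linarith
  also have "\<dots> = (1 - d) * B + d * n / 2 - (1 - 1 / K2) * p / 2 + y * ((1 - k) * c + r - W) + n / 2 * (g * (2 * y)) - D / 2"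
  proof -
    have "y * (r + n * g) + y * ((1 - k) * c) = y * ((1 - k) * c + r - W) + N / 2 + n / 2 * (g * (2 * y))"
      unfolding yW[symmetric] by (simp add: algebra_simps)
    moreover have "(1 - d) * (n / 2) = n / 2 - d * n / 2" by (simp add: left_diff_distrib)
    moreover have "n / 2 = N / 2 + D / 2" by (simp add: n)
    ultimately show ?thesis by linarith
  qed
  also have "\<dots> \<le> (1 - d) * B + d * n / 2 + (K1 * U * N / V - D - (1 - 1 / K2) * p) / 2 + n / 2 * (g * (2 * y))"
    using 4 by (simp add: diff_divide_distrib)
  also have "\<dots> \<le> (1 - d) * B + d * n / 2 + max 0 (K1 * U * N / V - D - (1 - 1 / K2) * p) / 2 + n / 2 * (g * (2 * y))"
    by (intro add_right_mono add_left_mono divide_right_mono) auto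
  finally show ?thesis using 1 unfolding k_def[symmetric] NW by linarith
qed

text \<open>
  Young's inequality with conjugate exponents, in the form that bounds a number by its power with a
  free scale \<open>t\<close>.
\<close>

lemma power_mean_young:
  fixes x t s :: real
  assumes "0 \<le> x" "0 < t" "1 \<le> s"
  shows "x \<le> t * (1 - 1 / s) + x powr s * t powr (1 - s) / s"
proof (cases "x = 0")
  case True
  then show ?thesis using assms by simp
next
  case False
  then have x: "0 < x" using assms by simp
  have "(x powr s * t powr (1 - s)) powr (1 / s) * t powr (1 - 1 / s)
      \<le> 1 / s * (x powr s * t powr (1 - s)) + (1 - 1 / s) * t"
    using assms x by (intro Youngs_inequality_0) auto
  moreover have "(x powr s * t powr (1 - s)) powr (1 / s) * t powr (1 - 1 / s) = x"
  proof -
    have "(x powr s * t powr (1 - s)) powr (1 / s) = x * t powr ((1 - s) / s)"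
      using x assms by (simp add: powr_mult powr_powr)
    moreover have "t powr ((1 - s) / s) * t powr (1 - 1 / s) = 1"
      using assms by (simp add: powr_add[symmetric] field_simps)
    ultimately show ?thesis by (simp add: mult.assoc)
  qed
  ultimately show ?thesis by (simp add: mult.commute)
qed

text \<open>
  Passage from the regression model to \<open>gaussian_model\<close>: expand noise, mean and observation in the
  adapted basis, after dividing by \<open>\<sigma>\<close>. A different \<open>X\<close> is obtained for each model, but the noise
  level is common to all of them.
\<close>

lemma gaussian_coordinates:
  fixes M :: "'w measure" and \<epsilon> :: "'n::finite \<Rightarrow> 'w \<Rightarrow> real" and S :: "(real ^ 'n) set"
    and \<mu> :: "real ^ 'n"
  assumes M: "prob_space M" and ind: "prob_space.indep_vars M (\<lambda>_. borel) \<epsilon> UNIV"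
    and dist: "\<And>i. distributed M lborel (\<epsilon> i) std_normal_density"
    and \<sigma>: "0 < \<sigma>" and S: "subspace S" and D: "dim S + 5 \<le> CARD('n)"
    and Y: "\<And>\<omega>. Y \<omega> = (\<chi> i. \<mu> $ i + \<sigma> * \<epsilon> i \<omega>)"
  obtains X b where "X \<in> M \<rightarrow>\<^sub>M gauss {..<CARD('n)}"
    and "distr M (gauss {..<CARD('n)}) X = gauss {..<CARD('n)}"
    and "\<And>\<omega>. (norm (\<chi> i. \<epsilon> i \<omega>))\<^sup>2 = offset_sq {..<CARD('n)} (\<lambda>_. 0) (X \<omega>)"
    and "\<And>\<omega>. (norm (Y \<omega> - orth_proj S (Y \<omega>)))\<^sup>2
      = \<sigma>\<^sup>2 * offset_sq {dim S..<CARD('n)} (gaussian_model.offset (dim S) b) (X \<omega>)"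
    and "\<And>\<omega>. kullback (\<mu>, \<sigma>\<^sup>2) (estimator S (Y \<omega>)) = gaussian_model.loss CARD('n) (dim S) b (X \<omega>)"
proof -
  let ?n = "CARD('n)" and ?D = "dim S"
  interpret model: gaussian_model ?n ?D b for b by unfold_locales (rule D)
  define E where "E \<omega> = (\<chi> i. \<epsilon> i \<omega>)" for \<omega>
  have dimn: "DIM(real ^ 'n) = ?n" by simp
  have Dn: "?D < DIM(real ^ 'n)" using D by simp
  obtain e where e: "\<And>i j. i < ?n \<Longrightarrow> j < ?n \<Longrightarrow> e i \<bullet> e j = (if i = j then 1 else 0)"
    and eS: "\<And>i. i < ?D \<Longrightarrow> e i \<in> S" and eC: "\<And>x i. x \<in> S \<Longrightarrow> ?D \<le> i \<Longrightarrow> i < ?n \<Longrightarrow> x \<bullet> e i = 0"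
    and e\<mu>: "\<And>i. ?D < i \<Longrightarrow> i < ?n \<Longrightarrow> \<mu> \<bullet> e i = 0"
    using adapted_orthonormal_basis[OF S Dn, of \<mu>] unfolding dimn by blast
  have expand: "x = (\<Sum>j<?n. (x \<bullet> e j) *\<^sub>R e j)" and norm2: "(norm x)\<^sup>2 = (\<Sum>j<?n. (x \<bullet> e j)\<^sup>2)" for x
    using orthonormal_expansion[where e = e, of x] e unfolding dimn by blast+
  define X where "X \<omega> = (\<lambda>j\<in>{..<?n}. E \<omega> \<bullet> e j)" for \<omega>
  define b where "b = (\<mu> \<bullet> e ?D) / \<sigma>"
  have Xj: "X \<omega> j = E \<omega> \<bullet> e j" if "j < ?n" for \<omega> j using that by (simp add: X_def)
  have YE: "Y \<omega> = \<mu> + \<sigma> *\<^sub>R E \<omega>" for \<omega> by (simp add: Y E_def vec_eq_iff)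
  have Yj: "Y \<omega> \<bullet> e j = \<mu> \<bullet> e j + \<sigma> * X \<omega> j" if "j < ?n" for \<omega> j
    using that by (simp add: YE inner_left_distrib Xj)
  have off: "\<mu> \<bullet> e j = \<sigma> * gaussian_model.offset ?D b j" if "?D \<le> j" "j < ?n" for j
    using that e\<mu>[of j] \<sigma> by (cases "j = ?D") (auto simp: model.offset_def b_def)
  define p where "p \<omega> = (\<Sum>j<?D. (Y \<omega> \<bullet> e j) *\<^sub>R e j)" for \<omega>
  have pj: "p \<omega> \<bullet> e j = (if j < ?D then Y \<omega> \<bullet> e j else 0)" if "j < ?n" for \<omega> j
  proof -
    have "p \<omega> \<bullet> e j = (\<Sum>i<?D. (Y \<omega> \<bullet> e i) * (e i \<bullet> e j))" by (simp add: p_def inner_sum_left)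
    also have "\<dots> = (\<Sum>i<?D. if i = j then Y \<omega> \<bullet> e j else 0)"
      using that D by (intro sum.cong) (auto simp: e)
    finally show ?thesis by (simp add: sum.delta)
  qed
  have proj: "orth_proj S (Y \<omega>) = p \<omega>" for \<omega>
  proof (rule orth_proj_eqI[OF S])
    show "p \<omega> \<in> S" unfolding p_def using S eS by (intro subspace_sum subspace_scale) auto
    fix x assume x: "x \<in> S"
    have "(Y \<omega> - p \<omega>) \<bullet> x = (\<Sum>j<?n. ((Y \<omega> - p \<omega>) \<bullet> e j) * (x \<bullet> e j))"
      by (subst expand[of x]) (simp add: inner_sum_right mult.commute)
    also have "\<dots> = 0"
    proof (intro sum.neutral ballI)
      fix j assume "j \<in> {..<?n}"
      then have j: "j < ?n" by simp
      show "((Y \<omega> - p \<omega>) \<bullet> e j) * (x \<bullet> e j) = 0"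
        using eC[OF x _ j] by (cases "j < ?D") (simp_all add: inner_diff_left pj[OF j])
    qed
    finally show "orthogonal (Y \<omega> - p \<omega>) x" by (simp add: orthogonal_def)
  qed
  have split: "{..<?n} = {..<?D} \<union> {?D..<?n}" using D by auto
  have split_sum: "(\<Sum>j<?n. h j) = (\<Sum>j<?D. h j) + (\<Sum>j\<in>{?D..<?n}. h j)" for h :: "nat \<Rightarrow> real"
    unfolding split by (rule sum.union_disjoint) auto
  have resid: "(norm (Y \<omega> - orth_proj S (Y \<omega>)))\<^sup>2 = \<sigma>\<^sup>2 * model.O.W b (X \<omega>)" for \<omega>
  proof -
    have "(norm (Y \<omega> - p \<omega>))\<^sup>2 = (\<Sum>j<?D. 0) + (\<Sum>j\<in>{?D..<?n}. \<sigma>\<^sup>2 * (X \<omega> j + gaussian_model.offset ?D b j)\<^sup>2)"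
      unfolding norm2 split_sum
    proof (intro arg_cong2[where f = "(+)"] sum.cong refl)
      fix j assume "j \<in> {..<?D}"
      then show "((Y \<omega> - p \<omega>) \<bullet> e j)\<^sup>2 = 0" using D by (simp add: inner_diff_left pj)
    next
      fix j assume "j \<in> {?D..<?n}"
      then have j: "?D \<le> j" "j < ?n" by auto
      have "(Y \<omega> - p \<omega>) \<bullet> e j = \<sigma> * (X \<omega> j + gaussian_model.offset ?D b j)"
        using j by (simp add: inner_diff_left pj Yj off distrib_left)
      then show "((Y \<omega> - p \<omega>) \<bullet> e j)\<^sup>2 = \<sigma>\<^sup>2 * (X \<omega> j + gaussian_model.offset ?D b j)\<^sup>2"
        by (simp add: power_mult_distrib)
    qed
    then show ?thesis unfolding proj offset_sq_def by (simp add: sum_distrib_left)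
  qed
  have bias: "(norm (\<mu> - orth_proj S (Y \<omega>)))\<^sup>2 = \<sigma>\<^sup>2 * (b\<^sup>2 + model.Q.W (X \<omega>))" for \<omega>
  proof -
    have "(norm (\<mu> - p \<omega>))\<^sup>2 = (\<Sum>j<?D. \<sigma>\<^sup>2 * (X \<omega> j)\<^sup>2) + (\<Sum>j\<in>{?D..<?n}. if j = ?D then \<sigma>\<^sup>2 * b\<^sup>2 else 0)"
      unfolding norm2 split_sum
    proof (intro arg_cong2[where f = "(+)"] sum.cong refl)
      fix j assume "j \<in> {..<?D}"
      then have j: "j < ?D" "j < ?n" using D by auto
      have "(\<mu> - p \<omega>) \<bullet> e j = - (\<sigma> * X \<omega> j)" using j by (simp add: inner_diff_left pj Yj)
      then show "((\<mu> - p \<omega>) \<bullet> e j)\<^sup>2 = \<sigma>\<^sup>2 * (X \<omega> j)\<^sup>2" by (simp add: power_mult_distrib)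
    next
      fix j assume "j \<in> {?D..<?n}"
      then have j: "?D \<le> j" "j < ?n" by auto
      have "(\<mu> - p \<omega>) \<bullet> e j = \<sigma> * gaussian_model.offset ?D b j"
        using j by (simp add: inner_diff_left pj off)
      then show "((\<mu> - p \<omega>) \<bullet> e j)\<^sup>2 = (if j = ?D then \<sigma>\<^sup>2 * b\<^sup>2 else 0)"
        by (simp add: power_mult_distrib model.offset_def)
    qed
    then show ?thesis unfolding proj offset_sq_def using D by (simp add: sum_distrib_left distrib_left)
  qed
  have law: "distr M borel E = (gauss_vec :: (real ^ 'n) measure)" and mE: "E \<in> M \<rightarrow>\<^sub>M borel"
    using distr_iid_vector[OF M ind dist] unfolding E_def[abs_def] by auto
  have mc: "(\<lambda>x. \<lambda>j\<in>{..<?n}. x \<bullet> e j) \<in> borel \<rightarrow>\<^sub>M gauss {..<?n}"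
    unfolding measurable_cong_sets[OF refl sets_gauss] by measurable
  have Xc: "X = (\<lambda>x. \<lambda>j\<in>{..<?n}. x \<bullet> e j) \<circ> E" by (auto simp: X_def fun_eq_iff)
  show thesis
  proof (rule that[of X b])
    show "X \<in> M \<rightarrow>\<^sub>M gauss {..<?n}" unfolding Xc by (rule measurable_comp[OF mE mc])
    have "distr M (gauss {..<?n}) X = distr gauss_vec (gauss {..<?n}) (\<lambda>x. \<lambda>j\<in>{..<?n}. x \<bullet> e j)"
      unfolding Xc law[symmetric] by (rule distr_distr[OF mc mE, symmetric])
    also have "\<dots> = distr gauss_vec (Pi\<^sub>M {..<?n} (\<lambda>_. borel)) (\<lambda>x. \<lambda>j\<in>{..<?n}. x \<bullet> e j)"
      by (rule distr_cong) (simp_all only: sets_gauss)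
    also have "\<dots> = gauss {..<?n}"
      using gauss_vec_orthonormal_coordinates[of e] e unfolding dimn by blast
    finally show "distr M (gauss {..<?n}) X = gauss {..<?n}" .
    show "(norm (\<chi> i. \<epsilon> i \<omega>))\<^sup>2 = offset_sq {..<?n} (\<lambda>_. 0) (X \<omega>)" for \<omega>
      unfolding E_def[symmetric] norm2 offset_sq_def by (intro sum.cong) (simp_all add: Xj)
    show "(norm (Y \<omega> - orth_proj S (Y \<omega>)))\<^sup>2
      = \<sigma>\<^sup>2 * offset_sq {?D..<?n} (gaussian_model.offset ?D b) (X \<omega>)" for \<omega> by (rule resid)
    show "kullback (\<mu>, \<sigma>\<^sup>2) (estimator S (Y \<omega>)) = gaussian_model.loss ?n ?D b (X \<omega>)" for \<omega>
    proof -
      have rd: "real (residual_dim S) = model.N" by (simp add: residual_dim_def)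
      \<comment> \<open>also valid for w = 0, where both sides use division by zero and ln 0\<close>
      have "m / 2 * (ln (s * w / k / s) + s / (s * w / k) - 1 + s * c / (m * (s * w / k)))
          = m / 2 * (ln (w / k) + k / w - 1) + c * k / (2 * w)"
        if "0 < s" "0 < m" for m s w k c :: real
        using that by (cases "w = 0"; cases "k = 0") (simp_all add: field_simps)
      note alg = this[of "\<sigma>\<^sup>2" "real ?n"]
      show ?thesis
        unfolding estimator_def kullback.simps resid bias rd model.loss_def
        by (rule alg) (use \<sigma> in simp_all)
    qed
  qed
qed

lemma has_bochner_integral_pullback:
  fixes h :: "'b \<Rightarrow> real"
  assumes X: "X \<in> M \<rightarrow>\<^sub>M L" and law: "distr M L X = L" and h: "has_bochner_integral L h v"
  shows "has_bochner_integral M (\<lambda>\<omega>. h (X \<omega>)) v"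
proof -
  have "h \<in> borel_measurable L" using h by (auto dest: borel_measurable_has_bochner_integral)
  moreover have "integrable L h" "integral\<^sup>L L h = v" using h by (auto simp: has_bochner_integral_iff)
  ultimately show ?thesis
    using integrable_distr_eq[OF X, of h] integral_distr[OF X, of h]
    unfolding law has_bochner_integral_iff by simp
qed

lemma (in gaussian_model) loss_pathwise:
  assumes V: "0 < V.W x" and K: "1 < K1" "K1 \<le> K2" and p: "0 \<le> p"
    and d: "d \<le> 1 / K2" and g: "1 - R.W x / n' - d \<le> g"
    and B: "n' / 2 * ln (O.W x / N) + p / 2 \<le> B"
  shows "(1 - 1 / K1) * loss x \<le> ((1 - d) * B + d * n' / 2)
      + max 0 (K1 * U.W x * N / V.W x - D' - (1 - 1 / K2) * p) / 2 + n' / 2 * (g * (N / O.W x))"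
proof (rule kullback_pathwise_bound[where Q = "Q.W x" and x = "x D" and b = b and r = "R.W x"])
  have s1: "{D..<n} = insert D {Suc D..<n}" and s2: "{..<Suc D} = insert D {..<D}"
    and s3: "{..<n} = {..<D} \<union> {D..<n}" using dim_bound by auto
  have "(\<Sum>i\<in>{Suc D..<n}. (x i + offset i)\<^sup>2) = (\<Sum>i\<in>{Suc D..<n}. (x i + 0)\<^sup>2)"
    by (intro sum.cong) (auto simp: offset_def)
  then show "O.W x = (x D + b)\<^sup>2 + V.W x"
    unfolding offset_sq_def s1 by (simp add: offset_def)
  show "U.W x = Q.W x + (x D)\<^sup>2" unfolding offset_sq_def s2 by simp
  have "R.W x = Q.W x + (\<Sum>i\<in>{D..<n}. (x i)\<^sup>2)"
    unfolding offset_sq_def s3 by (subst sum.union_disjoint) auto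
  then show "R.W x = Q.W x + (x D)\<^sup>2 + V.W x" unfolding offset_sq_def s1 by simp
  show "n' = N + D'" by (rule N_eq)
  show "0 < N" "0 < n'" using dim_bound by auto
  show "loss x = n' / 2 * (ln (O.W x / N) + N / O.W x - 1) + (b\<^sup>2 + Q.W x) * N / (2 * O.W x)"
    by (rule loss_def)
qed (use assms in simp_all)

text \<open>
  Hoelder's inequality for \<open>g\<close> times the maximum of the \<open>Z k\<close>, with exponent \<open>p\<close>, the maximum being bounded
  by the sum of the powers, which gives the factor \<open>card I powr (1 / p)\<close>. Young's inequality with the
  optimal scale \<open>t\<close> yields the sharp constant and an explicit integrable majorant \<open>H\<close>; a second use
  passes from the exponent \<open>p\<close> to the integers \<open>q k\<close>, at which moments are known.
\<close>

lemma truncated_maximum_bound: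
  fixes Z :: "'i \<Rightarrow> 'w \<Rightarrow> real" and g :: "'w \<Rightarrow> real" and q :: "'i \<Rightarrow> nat"
  assumes M: "prob_space M" and I: "finite I" "I \<noteq> {}" and C: "0 < C" and \<pi>: "0 < \<pi>" and p: "1 \<le> p"
    and g: "integrable M g" "\<And>\<omega>. 0 \<le> g \<omega>" "\<And>\<omega>. g \<omega> \<le> 1" "(\<integral>\<omega>. g \<omega> \<partial>M) \<le> \<pi>"
    and Z: "\<And>k \<omega>. k \<in> I \<Longrightarrow> 0 \<le> Z k \<omega>" and pq: "\<And>k. k \<in> I \<Longrightarrow> p \<le> real (q k)"
    and mom: "\<And>k. k \<in> I \<Longrightarrow> integrable M (\<lambda>\<omega>. Z k \<omega> ^ q k)"
      "\<And>k. k \<in> I \<Longrightarrow> (\<integral>\<omega>. Z k \<omega> ^ q k \<partial>M) \<le> C ^ q k"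
  obtains H where "integrable M H" and "\<And>k \<omega>. k \<in> I \<Longrightarrow> g \<omega> * Z k \<omega> \<le> H \<omega>"
    and "(\<integral>\<omega>. H \<omega> \<partial>M) \<le> C * (real (card I) powr (1 / p) * \<pi> powr (1 - 1 / p))"
proof -
  interpret prob_space M by (rule M)
  have cI: "0 < real (card I)" using I by (simp add: card_gt_0_iff)
  have p0: "0 < p" using p by simp
  define t where "t = C * (real (card I) / \<pi>) powr (1 / p)"
  have t: "0 < t" using C cI \<pi> by (simp add: t_def)
  \<comment> \<open>majorant of the p-th power of Z k by its power of order q k\<close>
  define h where "h k \<omega> = C powr p * (1 - p / real (q k)) + Z k \<omega> ^ q k * (C powr (p - real (q k)) * (p / real (q k)))" for k \<omega>
  have q0: "0 < real (q k)" if "k \<in> I" for k using pq[OF that] p0 by linarith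
  have Zp: "Z k \<omega> powr p \<le> h k \<omega>" if k: "k \<in> I" for k \<omega>
  proof -
    have "Z k \<omega> powr p \<le> C powr p * (1 - 1 / (real (q k) / p))
        + (Z k \<omega> powr p) powr (real (q k) / p) * (C powr p) powr (1 - real (q k) / p) / (real (q k) / p)"
      using C pq[OF k] p0 by (intro power_mean_young) auto
    moreover have "(Z k \<omega> powr p) powr (real (q k) / p) = Z k \<omega> ^ q k"
    proof (cases "Z k \<omega> = 0")
      case True
      then show ?thesis using q0[OF k] by simp
    next
      case False
      then have "0 < Z k \<omega>" using Z[OF k, of \<omega>] by simp
      then show ?thesis using p0 by (simp add: powr_powr powr_realpow)
    qed
    moreover have "(C powr p) powr (1 - real (q k) / p) = C powr (p - real (q k))"
      using p0 by (simp add: powr_powr right_diff_distrib)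
    ultimately show ?thesis unfolding h_def by simp
  qed
  have hi: "has_bochner_integral M (h k) (C powr p * (1 - p / real (q k))
      + (\<integral>\<omega>. Z k \<omega> ^ q k \<partial>M) * (C powr (p - real (q k)) * (p / real (q k))))" if "k \<in> I" for k
  proof -
    have c: "has_bochner_integral M (\<lambda>_. c) c" for c :: real
      using has_bochner_integral_integrable[of M "\<lambda>_. c"] prob_space by simp
    show ?thesis unfolding h_def
      by (intro has_bochner_integral_add has_bochner_integral_mult_left has_bochner_integral_integrable c mom(1) that)
  qed
  have h_mean: "(\<integral>\<omega>. h k \<omega> \<partial>M) \<le> C powr p" if k: "k \<in> I" for k
  proof -
    have "(\<integral>\<omega>. Z k \<omega> ^ q k \<partial>M) * (C powr (p - real (q k)) * (p / real (q k)))
        \<le> C powr real (q k) * (C powr (p - real (q k)) * (p / real (q k)))"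
      using mom(2)[OF k] p0 C by (intro mult_right_mono) (auto simp: powr_realpow)
    also have "\<dots> = C powr p * (p / real (q k))"
      by (simp add: powr_add[symmetric] mult.assoc[symmetric])
    finally show ?thesis
      unfolding has_bochner_integral_integral_eq[OF hi[OF k]] by (simp add: right_diff_distrib)
  qed
  define H where "H \<omega> = t * (1 - 1 / p) * g \<omega> + t powr (1 - p) / p * (\<Sum>k\<in>I. h k \<omega>)" for \<omega>
  have h0: "0 \<le> h k \<omega>" if "k \<in> I" for k \<omega> using Zp[OF that, of \<omega>] by (rule order_trans[rotated]) simp
  have dom: "g \<omega> * Z k \<omega> \<le> H \<omega>" if k: "k \<in> I" for k \<omega>
  proof -
    have "g \<omega> * Z k \<omega> \<le> g \<omega> * (t * (1 - 1 / p) + Z k \<omega> powr p * t powr (1 - p) / p)"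
      using g(2) Z[OF k] t p by (intro mult_left_mono power_mean_young) auto
    also have "\<dots> = t * (1 - 1 / p) * g \<omega> + g \<omega> * (Z k \<omega> powr p) * (t powr (1 - p) / p)"
      by (simp add: distrib_left mult_ac)
    also have "g \<omega> * (Z k \<omega> powr p) * (t powr (1 - p) / p) \<le> (\<Sum>k\<in>I. h k \<omega>) * (t powr (1 - p) / p)"
    proof (rule mult_right_mono)
      have "g \<omega> * (Z k \<omega> powr p) \<le> 1 * (Z k \<omega> powr p)" using g(3) by (intro mult_right_mono) auto
      also have "\<dots> \<le> h k \<omega>" using Zp[OF k] by simp
      also have "\<dots> \<le> (\<Sum>k\<in>I. h k \<omega>)" using I(1) k h0 by (intro member_le_sum) auto
      finally show "g \<omega> * (Z k \<omega> powr p) \<le> (\<Sum>k\<in>I. h k \<omega>)" .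
    qed (use p0 in simp)
    finally show ?thesis unfolding H_def by (simp add: mult.commute)
  qed
  have Hi: "has_bochner_integral M H (t * (1 - 1 / p) * (\<integral>\<omega>. g \<omega> \<partial>M) + t powr (1 - p) / p * (\<Sum>k\<in>I. \<integral>\<omega>. h k \<omega> \<partial>M))"
    unfolding H_def using hi
    by (intro has_bochner_integral_add has_bochner_integral_mult_right has_bochner_integral_sum
        has_bochner_integral_integrable g(1)) (auto intro: integrable.intros)
  have "t * (1 - 1 / p) * (\<integral>\<omega>. g \<omega> \<partial>M) \<le> t * (1 - 1 / p) * \<pi>"
    using t p g(4) by (intro mult_left_mono) auto
  moreover have "t powr (1 - p) / p * (\<Sum>k\<in>I. \<integral>\<omega>. h k \<omega> \<partial>M) \<le> t powr (1 - p) / p * (real (card I) * C powr p)"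
    using p0 sum_mono[OF h_mean, of I] by (intro mult_left_mono) auto
  moreover have "t powr (1 - p) * (real (card I) * C powr p) = t * \<pi>"
  proof -
    have "t powr p = C powr p * (real (card I) / \<pi>)"
      unfolding t_def using C cI \<pi> p0 by (simp add: powr_mult powr_powr)
    moreover have "t powr (1 - p) = t / t powr p" using t by (simp add: powr_diff)
    ultimately show ?thesis using C cI \<pi> by simp
  qed
  ultimately have "(\<integral>\<omega>. H \<omega> \<partial>M) \<le> t * (1 - 1 / p) * \<pi> + t * \<pi> / p"
    unfolding has_bochner_integral_integral_eq[OF Hi] by simp
  also have "\<dots> = t * \<pi>" using p0 by (simp add: field_simps)
  also have "\<dots> = C * (real (card I) powr (1 / p) * \<pi> powr (1 - 1 / p))"
    unfolding t_def using cI \<pi> by (simp add: powr_divide powr_diff)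
  finally have "(\<integral>\<omega>. H \<omega> \<partial>M) \<le> C * (real (card I) powr (1 / p) * \<pi> powr (1 - 1 / p))" .
  with dom integrable.intros[OF Hi] show thesis by (intro that) auto
qed

section \<open>The risk of the selected estimator\<close>

theorem theorem3:
  fixes M :: "'w measure"
    and \<epsilon> :: "'n::finite \<Rightarrow> 'w \<Rightarrow> real"
    and \<mu> :: "real ^ 'n" and \<sigma> :: real
    and Y :: "'w \<Rightarrow> real ^ 'n"
    and \<theta> :: "'n param"
    and I :: "'i set" and S :: "'i \<Rightarrow> (real ^ 'n) set"
    and K1 K2 :: real
    and pen :: "'i \<Rightarrow> real"
    and mhat :: "'w \<Rightarrow> 'i"
    and \<theta>hat :: "'i \<Rightarrow> 'w \<Rightarrow> 'n param"
    and \<theta>tilde :: "'w \<Rightarrow> 'n param"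
  assumes "prob_space M"
    and "prob_space.indep_vars M (\<lambda>_. borel) \<epsilon> UNIV"
    and "\<And>i. distributed M lborel (\<epsilon> i) std_normal_density"
    and "\<sigma> > 0"
    and Y: "\<And>\<omega>. Y \<omega> = (\<chi> i. \<mu> $ i + \<sigma> * \<epsilon> i \<omega>)"
    and \<theta>: "\<theta> = (\<mu>, \<sigma>\<^sup>2)"
    and "finite I" and "I \<noteq> {}"
    and "\<And>m. m \<in> I \<Longrightarrow> subspace (S m)"
    and "\<And>m. m \<in> I \<Longrightarrow> dim (S m) + 5 \<le> CARD('n)"
    and "K1 > 1" and "K2 \<ge> K1"
    and "\<And>m. m \<in> I \<Longrightarrow> pen m \<ge> 0"
    and "mhat \<in> M \<rightarrow>\<^sub>M count_space I"
    and "AE \<omega> in M. \<forall>m\<in>I. crit S pen (Y \<omega>) (mhat \<omega>) \<le> crit S pen (Y \<omega>) m"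
    and \<theta>hat: "\<And>m \<omega>. \<theta>hat m \<omega> = estimator (S m) (Y \<omega>)"
    and \<theta>tilde: "\<And>\<omega>. \<theta>tilde \<omega> = \<theta>hat (mhat \<omega>) \<omega>"
  shows "integrable M (\<lambda>\<omega>. kullback \<theta> (\<theta>tilde \<omega>))
    \<and> (\<forall>m\<in>I. integrable M (\<lambda>\<omega>. kullback \<theta> (\<theta>hat m \<omega>)))
    \<and> (LINT \<omega>|M. kullback \<theta> (\<theta>tilde \<omega>))
        \<le> K1 / (K1 - 1) *
          ((INF m\<in>I. (LINT \<omega>|M. kullback \<theta> (\<theta>hat m \<omega>))
                      + 9 / 4 * max (pen m) (real (dim (S m))))
            + \<Sigma>1 K2 I S + \<Sigma>2 K1 K2 I S pen)
    \<and> (\<forall>L :: 'i \<Rightarrow> real.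
          (\<forall>m\<in>I. L m \<ge> 0) \<longrightarrow> (\<forall>m\<in>I. pen m = penK K1 K2 S L m) \<longrightarrow>
          \<Sigma>2 K1 K2 I S pen
            \<le> 1.25 * K1 * (\<Sum>m\<in>I. (real (dim (S m)) + 1) * exp (- L m)))"
proof -
  interpret M: prob_space M by (rule assms(1))
  let ?n = "CARD('n)" and ?rn = "real CARD('n)"
  define D where "D m = dim (S m)" for m
  define N where "N m = real (?n - D m)" for m
  define \<alpha> where "\<alpha> = \<alpha>_min I S"
  define \<pi> where "\<pi> = exp (- ?rn / (4 * K2\<^sup>2))"
  have K1: "1 < K1" and K2: "1 < K2" and K12: "K1 \<le> K2" using assms(11,12) by auto
  have gm: "gaussian_model ?n (D m)" if "m \<in> I" for m
    unfolding gaussian_model_def D_def by (rule assms(10)[OF that])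
  have n0: "0 < ?rn" by simp
  have rd: "real (residual_dim (S m)) = N m" for m by (simp add: residual_dim_def N_def D_def)
  have N5: "5 \<le> N m" if "m \<in> I" for m
    unfolding N_def by (rule gaussian_model.N_ge[OF gm[OF that]])

  \<comment> \<open>each model is described in its own adapted coordinates, on the common space M\<close>
  define coord where "coord m Xb \<longleftrightarrow> fst Xb \<in> M \<rightarrow>\<^sub>M gauss {..<?n}
    \<and> distr M (gauss {..<?n}) (fst Xb) = gauss {..<?n}
    \<and> (\<forall>\<omega>. (norm (\<chi> i. \<epsilon> i \<omega>))\<^sup>2 = offset_sq {..<?n} (\<lambda>_. 0) (fst Xb \<omega>))
    \<and> (\<forall>\<omega>. (norm (Y \<omega> - orth_proj (S m) (Y \<omega>)))\<^sup>2
        = \<sigma>\<^sup>2 * offset_sq {D m..<?n} (gaussian_model.offset (D m) (snd Xb)) (fst Xb \<omega>))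
    \<and> (\<forall>\<omega>. kullback (\<mu>, \<sigma>\<^sup>2) (estimator (S m) (Y \<omega>)) = gaussian_model.loss ?n (D m) (snd Xb) (fst Xb \<omega>))"
    for m and Xb :: "('w \<Rightarrow> nat \<Rightarrow> real) \<times> real"
  have "\<forall>m\<in>I. \<exists>Xb. coord m Xb"
  proof
    fix m assume m: "m \<in> I"
    show "\<exists>Xb. coord m Xb"
      unfolding coord_def D_def
      by (rule gaussian_coordinates[OF assms(1-4) assms(9)[OF m] assms(10)[OF m] Y]) (rule exI[of _ "(_, _)"], auto)
  qed
  from bchoice[OF this] obtain Xb where "\<forall>m\<in>I. coord m (Xb m)" by blast
  then have co: "coord m (Xb m)" if "m \<in> I" for m using that by blast
  define X where "X m = fst (Xb m)" for m
  define b where "b m = snd (Xb m)" for m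
  have XM: "X m \<in> M \<rightarrow>\<^sub>M gauss {..<?n}" and law: "distr M (gauss {..<?n}) (X m) = gauss {..<?n}"
    if "m \<in> I" for m using co[OF that] unfolding coord_def X_def by blast+
  define r where "r \<omega> = (norm (\<chi> i. \<epsilon> i \<omega>))\<^sup>2" for \<omega>
  define W where "W m \<omega> = offset_sq {D m..<?n} (gaussian_model.offset (D m) (b m)) (X m \<omega>)" for m \<omega>
  define V where "V m \<omega> = offset_sq {Suc (D m)..<?n} (\<lambda>_. 0) (X m \<omega>)" for m \<omega>
  define U where "U m \<omega> = offset_sq {..<Suc (D m)} (\<lambda>_. 0) (X m \<omega>)" for m \<omega>
  have r_eq: "offset_sq {..<?n} (\<lambda>_. 0) (X m \<omega>) = r \<omega>" if "m \<in> I" for m \<omega>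
    using co[OF that] unfolding coord_def X_def r_def by metis
  have resid: "(norm (Y \<omega> - orth_proj (S m) (Y \<omega>)))\<^sup>2 = \<sigma>\<^sup>2 * W m \<omega>" if "m \<in> I" for m \<omega>
    using co[OF that] unfolding coord_def X_def W_def b_def by blast
  have loss_eq: "kullback \<theta> (\<theta>hat m \<omega>) = gaussian_model.loss ?n (D m) (b m) (X m \<omega>)" if "m \<in> I" for m \<omega>
    using co[OF that] unfolding coord_def X_def b_def \<theta> \<theta>hat by blast
  have r0: "0 \<le> r \<omega>" for \<omega> by (simp add: r_def)
  have AE_X: "AE \<omega> in M. P (X m \<omega>)" if "m \<in> I" "AE x in gauss {..<?n}. P x" for m P
    using AE_distrD[OF XM[OF that(1)], of P] that(2) unfolding law[OF that(1)] by blast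
  have W_pos: "AE \<omega> in M. 0 < W m \<omega>" and V_pos: "AE \<omega> in M. 0 < V m \<omega>" if m: "m \<in> I" for m
    unfolding W_def V_def
    by (rule AE_X[OF m gaussian_model.AE_pos[OF gm[OF m]]], rule AE_X[OF m gaussian_model.AE_V_pos[OF gm[OF m]]])

  have loss_bi: "has_bochner_integral M (\<lambda>\<omega>. kullback \<theta> (\<theta>hat m \<omega>))
      (\<integral>x. gaussian_model.loss ?n (D m) (b m) x \<partial>gauss {..<?n})" if m: "m \<in> I" for m
    unfolding loss_eq[OF m]
    by (rule has_bochner_integral_pullback[OF XM[OF m] law[OF m]])
       (rule has_bochner_integral_integrable[OF gaussian_model.loss_integrable[OF gm[OF m]]])
  have loss_int: "integrable M (\<lambda>\<omega>. kullback \<theta> (\<theta>hat m \<omega>))" if "m \<in> I" for m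
    by (rule integrable.intros[OF loss_bi[OF that]])

  have mhat_I: "mhat \<omega> \<in> I" if "\<omega> \<in> space M" for \<omega>
    using measurable_space[OF assms(14) that] by simp
  \<comment> \<open>the selected loss is a finite sum of losses of single models, each restricted to an event\<close>
  have sel_int: "integrable M (\<lambda>\<omega>. kullback \<theta> (\<theta>tilde \<omega>))"
  proof -
    have "integrable M (\<lambda>\<omega>. \<Sum>m\<in>I. indicator (mhat -` {m} \<inter> space M) \<omega> *\<^sub>R kullback \<theta> (\<theta>hat m \<omega>))"
    proof (intro Bochner_Integration.integrable_sum integrable_mult_indicator loss_int)
      fix m assume "m \<in> I"
      then show "mhat -` {m} \<inter> space M \<in> sets M" using assms(14) by (auto intro!: measurable_sets)
    qed
    moreover have "(\<Sum>m\<in>I. indicator (mhat -` {m} \<inter> space M) \<omega> *\<^sub>R kullback \<theta> (\<theta>hat m \<omega>)) = kullback \<theta> (\<theta>tilde \<omega>)"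
      if w: "\<omega> \<in> space M" for \<omega>
    proof -
      have "(\<Sum>m\<in>I. indicator (mhat -` {m} \<inter> space M) \<omega> *\<^sub>R kullback \<theta> (\<theta>hat m \<omega>))
          = (\<Sum>m\<in>I. if m = mhat \<omega> then kullback \<theta> (\<theta>hat m \<omega>) else 0)"
        using w by (intro sum.cong) (auto simp: indicator_def)
      then show ?thesis using mhat_I[OF w] assms(7) by (simp add: \<theta>tilde)
    qed
    ultimately show ?thesis by (subst Bochner_Integration.integrable_cong[OF refl]) auto
  qed

  \<comment> \<open>deficit of the common noise level; it does not depend on the model\<close>
  define g where "g \<omega> = gaussian_model.deficit ?n K2 (r \<omega>)" for \<omega>
  obtain m0 where m0: "m0 \<in> I" using assms(8) by blast
  have g01: "0 \<le> g \<omega>" "g \<omega> \<le> 1" for \<omega>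
    unfolding g_def by (rule gaussian_model.deficit_bounds[OF gm[OF m0] K2])+
  have g_bi: "has_bochner_integral M g (\<integral>x. gaussian_model.deficit ?n K2 (offset_sq {..<?n} (\<lambda>_. 0) x) \<partial>gauss {..<?n})"
  proof -
    have eq: "g = (\<lambda>\<omega>. gaussian_model.deficit ?n K2 (offset_sq {..<?n} (\<lambda>_. 0) (X m0 \<omega>)))"
      by (rule ext) (simp only: g_def r_eq[OF m0])
    show ?thesis unfolding eq
      by (rule has_bochner_integral_pullback[OF XM[OF m0] law[OF m0]])
         (rule has_bochner_integral_integrable[OF gaussian_model.deficit_integrable[OF gm[OF m0] K2]])
  qed
  have g_int: "integrable M g" by (rule integrable.intros[OF g_bi])
  have g_mean: "(\<integral>\<omega>. g \<omega> \<partial>M) \<le> \<pi>"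
    unfolding has_bochner_integral_integral_eq[OF g_bi] \<pi>_def
    by (rule gaussian_model.deficit_mean_bound[OF gm[OF m0] K2])

  define E where "E m \<omega> = max 0 (K1 * U m \<omega> * N m / V m \<omega> - real (D m) - (1 - 1 / K2) * pen m)" for m \<omega>
  have E_bi: "has_bochner_integral M (E m)
      (\<integral>x. max 0 (K1 * offset_sq {..<Suc (D m)} (\<lambda>_. 0) x * N m / offset_sq {Suc (D m)..<?n} (\<lambda>_. 0) x
          - real (D m) - (1 - 1 / K2) * pen m) \<partial>gauss {..<?n})" if m: "m \<in> I" for m
    unfolding E_def U_def V_def N_def
    by (rule has_bochner_integral_pullback[OF XM[OF m] law[OF m]])
       (rule has_bochner_integral_integrable[OF gaussian_model.excess_bound(1)[OF gm[OF m] K1 K2]])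
  have E_int: "integrable M (E m)" if "m \<in> I" for m by (rule integrable.intros[OF E_bi[OF that]])
  have E_mean: "(\<integral>\<omega>. E m \<omega> \<partial>M) / 2 \<le> 5 * K1 / 4 * ((real (dim (S m)) + 1) * \<Lambda> K1 K2 (S m) (pen m))"
    if m: "m \<in> I" for m
    unfolding has_bochner_integral_integral_eq[OF E_bi[OF m]] N_def \<Lambda>_def rd
    using gaussian_model.excess_bound(2)[OF gm[OF m] K1 K2, of "pen m"]
    by (simp add: residual_dim_def D_def)
  have E_sum: "(\<Sum>m\<in>I. (\<integral>\<omega>. E m \<omega> \<partial>M) / 2) \<le> \<Sigma>2 K1 K2 I S pen"
    unfolding \<Sigma>2_def sum_distrib_left by (intro sum_mono E_mean)

  \<comment> \<open>1 / p is the exponent of the number of models in the first remainder term\<close>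
  define p where "p = \<alpha> * ?rn / 4"
  have \<alpha>: "\<alpha> * ?rn \<le> N m" if "m \<in> I" for m
  proof -
    have "\<alpha> \<le> N m / ?rn"
      unfolding \<alpha>_def \<alpha>_min_def rd using assms(7) that by (intro Min_le) auto
    then show ?thesis using n0 by (simp add: field_simps)
  qed
  have \<alpha>5: "5 \<le> \<alpha> * ?rn"
  proof -
    have "\<alpha> \<in> (\<lambda>m. N m / ?rn) ` I"
      unfolding \<alpha>_def \<alpha>_min_def rd using assms(7,8) by (intro Min_in) auto
    then obtain m where "m \<in> I" "\<alpha> = N m / ?rn" by blast
    then show ?thesis using N5[of m] n0 by simp
  qed
  have p1: "1 \<le> p" unfolding p_def using \<alpha>5 by simp
  have \<alpha>0: "0 < \<alpha>"
  proof (rule ccontr)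
    assume "\<not> 0 < \<alpha>"
    then have "\<alpha> * ?rn \<le> 0" using n0 by (simp add: mult_nonpos_nonneg)
    with \<alpha>5 show False by linarith
  qed
  define q where "q m = gaussian_model.moment_order ?n (D m)" for m
  have pq: "p \<le> real (q m)" if m: "m \<in> I" for m
    using gaussian_model.moment_order_ge[OF gm[OF m]] \<alpha>[OF m] unfolding p_def q_def N_def by linarith
  have ratio_bi: "has_bochner_integral M (\<lambda>\<omega>. (N m / W m \<omega>) ^ q m)
      (\<integral>x. (N m / offset_sq {D m..<?n} (gaussian_model.offset (D m) (b m)) x) ^ q m \<partial>gauss {..<?n})" if m: "m \<in> I" for m
    unfolding W_def N_def q_def
    by (rule has_bochner_integral_pullback[OF XM[OF m] law[OF m]])
       (rule has_bochner_integral_integrable[OF gaussian_model.ratio_moment(1)[OF gm[OF m]]])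
  have ratio_mean: "(\<integral>\<omega>. (N m / W m \<omega>) ^ q m \<partial>M) \<le> 3 ^ q m" if m: "m \<in> I" for m
    unfolding has_bochner_integral_integral_eq[OF ratio_bi[OF m]] unfolding N_def q_def
    by (rule gaussian_model.ratio_moment(2)[OF gm[OF m]])
  have \<pi>0: "0 < \<pi>" by (simp add: \<pi>_def)
  obtain H where H: "integrable M H" "\<And>k \<omega>. k \<in> I \<Longrightarrow> g \<omega> * (N k / W k \<omega>) \<le> H \<omega>"
    and H_mean: "(\<integral>\<omega>. H \<omega> \<partial>M) \<le> 3 * (real (card I) powr (1 / p) * \<pi> powr (1 - 1 / p))"
  proof (rule truncated_maximum_bound[where Z = "\<lambda>k \<omega>. N k / W k \<omega>" and C = 3 and q = q,
        OF assms(1) assms(7) assms(8) _ \<pi>0 p1 g_int g01 g_mean])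
    show "0 \<le> N k / W k \<omega>" if "k \<in> I" for k \<omega>
      unfolding N_def W_def by simp
    show "integrable M (\<lambda>\<omega>. (N k / W k \<omega>) ^ q k)" if "k \<in> I" for k
      by (rule integrable.intros[OF ratio_bi[OF that]])
  qed (use pq ratio_mean in simp_all)

  \<comment> \<open>n Q enters with the factor 3 / 2 from H and 1 from the deficit, 5 / 2 in total\<close>
  define Q where "Q = exp (1 / (K2\<^sup>2 * \<alpha>)) * \<pi> * real (card I) powr (4 / (\<alpha> * ?rn))"
  have Q_eq: "real (card I) powr (1 / p) * \<pi> powr (1 - 1 / p) = Q"
  proof -
    have "1 / p = 4 / (\<alpha> * ?rn)" by (simp add: p_def)
    moreover have "\<pi> powr (1 - 1 / p) = exp (1 / (K2\<^sup>2 * \<alpha>)) * \<pi>"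
    proof -
      have "\<pi> powr (1 - 1 / p) = exp ((1 - 1 / p) * (- ?rn / (4 * K2\<^sup>2)))"
        by (simp add: powr_def \<pi>_def)
      also have "(1 - 1 / p) * (- ?rn / (4 * K2\<^sup>2)) = 1 / (K2\<^sup>2 * \<alpha>) + - ?rn / (4 * K2\<^sup>2)"
        using \<alpha>0 n0 K2 by (simp add: p_def field_simps)
      finally show ?thesis by (simp only: exp_add \<pi>_def)
    qed
    ultimately show ?thesis by (simp add: Q_def)
  qed
  have \<pi>Q: "\<pi> \<le> Q"
  proof -
    have "0 < card I" using assms(7,8) by (simp add: card_gt_0_iff)
    then have c: "1 \<le> real (card I)" by linarith
    have "1 \<le> exp (1 / (K2\<^sup>2 * \<alpha>))" using \<alpha>0 by simp
    moreover have "1 \<le> real (card I) powr (4 / (\<alpha> * ?rn))" using \<alpha>0 c by (intro ge_one_powr_ge_zero) auto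
    ultimately have "1 * 1 \<le> exp (1 / (K2\<^sup>2 * \<alpha>)) * real (card I) powr (4 / (\<alpha> * ?rn))" by (intro mult_mono) auto
    then have "1 * \<pi> \<le> (exp (1 / (K2\<^sup>2 * \<alpha>)) * real (card I) powr (4 / (\<alpha> * ?rn))) * \<pi>"
      using \<pi>0 by (intro mult_right_mono) auto
    then show ?thesis by (simp add: Q_def mult_ac)
  qed
  have \<Sigma>1_eq: "\<Sigma>1 K2 I S = 5 / 2 * (?rn * Q)"
    by (simp add: \<Sigma>1_def Q_def \<pi>_def \<alpha>_def)

  let ?T = "\<integral>\<omega>. kullback \<theta> (\<theta>tilde \<omega>) \<partial>M"
  let ?k = "1 - 1 / K1"
  have k0: "0 < ?k" using K1 by simp
  \<comment> \<open>expectation of the pathwise bound, against a fixed model m\<close>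
  have risk_bound: "?k * ?T \<le> (\<integral>\<omega>. kullback \<theta> (\<theta>hat m \<omega>) \<partial>M) + 9 / 4 * max (pen m) (real (dim (S m)))
      + \<Sigma>1 K2 I S + \<Sigma>2 K1 K2 I S pen" if m: "m \<in> I" for m
  proof -
    obtain d where d1: "\<And>r. 0 \<le> r \<Longrightarrow> d r \<le> 1 / K2"
      and d2: "\<And>r. 0 \<le> r \<Longrightarrow> 1 - r / ?rn - d r \<le> gaussian_model.deficit ?n K2 r"
      and d3: "integrable (gauss {..<?n}) (\<lambda>x. (1 - d (offset_sq {..<?n} (\<lambda>_. 0) x)) *
          (?rn / 2 * ln (offset_sq {D m..<?n} (gaussian_model.offset (D m) (b m)) x / N m) + pen m / 2)
          + d (offset_sq {..<?n} (\<lambda>_. 0) x) * ?rn / 2)"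
      and d4: "(\<integral>x. (1 - d (offset_sq {..<?n} (\<lambda>_. 0) x)) *
          (?rn / 2 * ln (offset_sq {D m..<?n} (gaussian_model.offset (D m) (b m)) x / N m) + pen m / 2)
          + d (offset_sq {..<?n} (\<lambda>_. 0) x) * ?rn / 2 \<partial>gauss {..<?n})
        \<le> (\<integral>x. gaussian_model.loss ?n (D m) (b m) x \<partial>gauss {..<?n}) + real (D m) / 2 + pen m + ?rn * \<pi>"
      by (rule gaussian_model.selection_target[OF gm[OF m] K2 assms(13)[OF m], where b = "b m", folded N_def \<pi>_def])
         (rule that)
    define B where "B \<omega> = ?rn / 2 * ln (W m \<omega> / N m) + pen m / 2" for \<omega>
    have T_bi: "has_bochner_integral M (\<lambda>\<omega>. (1 - d (r \<omega>)) * B \<omega> + d (r \<omega>) * ?rn / 2)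
        (\<integral>x. (1 - d (offset_sq {..<?n} (\<lambda>_. 0) x)) *
          (?rn / 2 * ln (offset_sq {D m..<?n} (gaussian_model.offset (D m) (b m)) x / N m) + pen m / 2)
          + d (offset_sq {..<?n} (\<lambda>_. 0) x) * ?rn / 2 \<partial>gauss {..<?n})"
      unfolding B_def W_def r_eq[OF m, symmetric]
      by (rule has_bochner_integral_pullback[OF XM[OF m] law[OF m] has_bochner_integral_integrable[OF d3]])
    have R_bi: "has_bochner_integral M
        (\<lambda>\<omega>. (1 - d (r \<omega>)) * B \<omega> + d (r \<omega>) * ?rn / 2 + (\<Sum>k\<in>I. 1 / 2 * E k \<omega>) + ?rn / 2 * H \<omega>)
        ((\<integral>\<omega>. (1 - d (r \<omega>)) * B \<omega> + d (r \<omega>) * ?rn / 2 \<partial>M) + (\<Sum>k\<in>I. 1 / 2 * (\<integral>\<omega>. E k \<omega> \<partial>M)) + ?rn / 2 * (\<integral>\<omega>. H \<omega> \<partial>M))"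
      by (intro has_bochner_integral_add has_bochner_integral_sum has_bochner_integral_mult_right
          has_bochner_integral_integrable E_int H(1) integrable.intros[OF T_bi])
    \<comment> \<open>the maxima over the unknown selected model k are replaced by sums and by H\<close>
    have pathwise: "AE \<omega> in M. ?k * kullback \<theta> (\<theta>tilde \<omega>)
        \<le> (1 - d (r \<omega>)) * B \<omega> + d (r \<omega>) * ?rn / 2 + (\<Sum>k\<in>I. 1 / 2 * E k \<omega>) + ?rn / 2 * H \<omega>"
    proof -
      have pos: "AE \<omega> in M. \<forall>k\<in>I. 0 < W k \<omega> \<and> 0 < V k \<omega>"
        using assms(7) W_pos V_pos by (intro AE_finite_allI) (auto simp: AE_conj_iff)
      show ?thesis
        using pos assms(15) AE_space
      proof eventually_elim
        case (elim \<omega>)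
        define k where "k = mhat \<omega>"
        have k: "k \<in> I" unfolding k_def by (rule mhat_I[OF elim(3)])
        have pos: "0 < W k \<omega>" "0 < V k \<omega>" "0 < W m \<omega>" using elim(1) k m by auto
        have crit_eq: "crit S pen (Y \<omega>) j = ?rn / 2 * ln (\<sigma>\<^sup>2) + (?rn / 2 * ln (W j \<omega> / N j) + pen j / 2)"
          if j: "j \<in> I" "0 < W j \<omega>" for j
        proof -
          have "0 < N j" using N5[OF j(1)] by linarith
          then have "ln (\<sigma>\<^sup>2 * (W j \<omega> / N j)) = ln (\<sigma>\<^sup>2) + ln (W j \<omega> / N j)"
            using j assms(4) by (intro ln_mult_pos) auto
          then show ?thesis unfolding crit_def resid[OF j(1)] rd by (simp add: distrib_left)
        qed
        have "crit S pen (Y \<omega>) k \<le> crit S pen (Y \<omega>) m" using elim(2) m unfolding k_def by blast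
        then have crit_le: "?rn / 2 * ln (W k \<omega> / N k) + pen k / 2 \<le> B \<omega>"
          unfolding crit_eq[OF k pos(1)] crit_eq[OF m pos(3)] B_def by linarith
        have "?k * kullback \<theta> (\<theta>hat k \<omega>) \<le> ((1 - d (r \<omega>)) * B \<omega> + d (r \<omega>) * ?rn / 2)
            + E k \<omega> / 2 + ?rn / 2 * (g \<omega> * (N k / W k \<omega>))"
          unfolding loss_eq[OF k] E_def U_def V_def W_def N_def
        proof (rule gaussian_model.loss_pathwise[OF gm[OF k]])
          show "0 < offset_sq {Suc (D k)..<?n} (\<lambda>_. 0) (X k \<omega>)" using pos(2) unfolding V_def .
          show "?rn / 2 * ln (offset_sq {D k..<?n} (gaussian_model.offset (D k) (b k)) (X k \<omega>) / real (?n - D k))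
              + pen k / 2 \<le> B \<omega>"
            using crit_le unfolding W_def N_def .
          show "1 - offset_sq {..<?n} (\<lambda>_. 0) (X k \<omega>) / ?rn - d (r \<omega>) \<le> g \<omega>"
            unfolding r_eq[OF k] g_def by (rule d2[OF r0])
          show "d (r \<omega>) \<le> 1 / K2" by (rule d1[OF r0])
          show "0 \<le> pen k" by (rule assms(13)[OF k])
        qed (rule K1, rule K12)
        moreover have "E k \<omega> / 2 \<le> (\<Sum>k\<in>I. 1 / 2 * E k \<omega>)"
        proof -
          have "1 / 2 * E k \<omega> \<le> (\<Sum>k\<in>I. 1 / 2 * E k \<omega>)"
            by (rule member_le_sum[OF k _ assms(7)]) (simp add: E_def)
          then show ?thesis by simp
        qed
        moreover have "?rn / 2 * (g \<omega> * (N k / W k \<omega>)) \<le> ?rn / 2 * H \<omega>"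
          by (intro mult_left_mono H(2)[OF k]) simp
        ultimately show ?case unfolding \<theta>tilde k_def[symmetric] by linarith
      qed
    qed
    have "?k * ?T = (\<integral>\<omega>. ?k * kullback \<theta> (\<theta>tilde \<omega>) \<partial>M)" by (rule integral_mult_right_zero[symmetric])
    also have "\<dots> \<le> (\<integral>\<omega>. (1 - d (r \<omega>)) * B \<omega> + d (r \<omega>) * ?rn / 2 + (\<Sum>k\<in>I. 1 / 2 * E k \<omega>) + ?rn / 2 * H \<omega> \<partial>M)"
      by (rule integral_mono_AE[OF integrable_mult_right[OF sel_int] integrable.intros[OF R_bi] pathwise])
    also have "\<dots> = (\<integral>\<omega>. (1 - d (r \<omega>)) * B \<omega> + d (r \<omega>) * ?rn / 2 \<partial>M) + (\<Sum>k\<in>I. (\<integral>\<omega>. E k \<omega> \<partial>M) / 2) + ?rn / 2 * (\<integral>\<omega>. H \<omega> \<partial>M)"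
      unfolding has_bochner_integral_integral_eq[OF R_bi] by simp
    finally have total: "?k * ?T \<le> (\<integral>\<omega>. (1 - d (r \<omega>)) * B \<omega> + d (r \<omega>) * ?rn / 2 \<partial>M)
        + (\<Sum>k\<in>I. (\<integral>\<omega>. E k \<omega> \<partial>M) / 2) + ?rn / 2 * (\<integral>\<omega>. H \<omega> \<partial>M)" .
    have target: "(\<integral>\<omega>. (1 - d (r \<omega>)) * B \<omega> + d (r \<omega>) * ?rn / 2 \<partial>M)
        \<le> (\<integral>\<omega>. kullback \<theta> (\<theta>hat m \<omega>) \<partial>M) + real (D m) / 2 + pen m + ?rn * \<pi>"
      unfolding has_bochner_integral_integral_eq[OF T_bi] has_bochner_integral_integral_eq[OF loss_bi[OF m]]
      by (rule d4)
    have "?rn / 2 * (\<integral>\<omega>. H \<omega> \<partial>M) \<le> ?rn / 2 * (3 * Q)"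
      using H_mean unfolding Q_eq by (intro mult_left_mono) auto
    then have 1: "?rn / 2 * (\<integral>\<omega>. H \<omega> \<partial>M) \<le> 3 / 2 * (?rn * Q)" by simp
    have 2: "?rn * \<pi> \<le> ?rn * Q" using \<pi>Q by (intro mult_left_mono) auto
    have 3: "real (D m) / 2 + pen m \<le> 9 / 4 * max (pen m) (real (dim (S m)))"
      using assms(13)[OF m] unfolding D_def by (simp add: max_def)
    show ?thesis
      using total target E_sum 1 2 3 unfolding \<Sigma>1_eq by linarith
  qed
  have INF_bound: "?T \<le> K1 / (K1 - 1) *
          ((INF m\<in>I. (LINT \<omega>|M. kullback \<theta> (\<theta>hat m \<omega>)) + 9 / 4 * max (pen m) (real (dim (S m))))
            + \<Sigma>1 K2 I S + \<Sigma>2 K1 K2 I S pen)"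
  proof -
    have "?k * ?T - \<Sigma>1 K2 I S - \<Sigma>2 K1 K2 I S pen
        \<le> (INF m\<in>I. (LINT \<omega>|M. kullback \<theta> (\<theta>hat m \<omega>)) + 9 / 4 * max (pen m) (real (dim (S m))))"
    proof (rule cINF_greatest[OF assms(8)])
      fix m assume "m \<in> I"
      from risk_bound[OF this] show "?k * ?T - \<Sigma>1 K2 I S - \<Sigma>2 K1 K2 I S pen
        \<le> (LINT \<omega>|M. kullback \<theta> (\<theta>hat m \<omega>)) + 9 / 4 * max (pen m) (real (dim (S m)))" by linarith
    qed
    then have "?k * ?T \<le> (INF m\<in>I. (LINT \<omega>|M. kullback \<theta> (\<theta>hat m \<omega>)) + 9 / 4 * max (pen m) (real (dim (S m))))
        + \<Sigma>1 K2 I S + \<Sigma>2 K1 K2 I S pen" by linarith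
    from mult_left_mono[OF this, of "K1 / (K1 - 1)"] K1
    have "K1 / (K1 - 1) * (?k * ?T) \<le> K1 / (K1 - 1) *
        ((INF m\<in>I. (LINT \<omega>|M. kullback \<theta> (\<theta>hat m \<omega>)) + 9 / 4 * max (pen m) (real (dim (S m))))
        + \<Sigma>1 K2 I S + \<Sigma>2 K1 K2 I S pen)" by simp
    moreover have "K1 / (K1 - 1) * (?k * ?T) = ?T"
    proof -
      have "K1 / (K1 - 1) * ?k = 1" using K1 by (simp add: field_simps)
      then show ?thesis by (simp only: mult.assoc[symmetric] mult_1_left)
    qed
    ultimately show ?thesis by linarith
  qed
  \<comment> \<open>the penalty is chosen so that the argument of Fish is at least EFish\<close>
  have penalty: "\<Sigma>2 K1 K2 I S pen \<le> 1.25 * K1 * (\<Sum>m\<in>I. (real (dim (S m)) + 1) * exp (- L m))"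
    if L0: "\<forall>m\<in>I. L m \<ge> 0" and penL: "\<forall>m\<in>I. pen m = penK K1 K2 S L m" for L
  proof -
    have "\<Lambda> K1 K2 (S m) (pen m) \<le> exp (- L m)" if m: "m \<in> I" for m
    proof -
      let ?D = "real (dim (S m))" and ?e = "EFish (dim (S m) + 1) (residual_dim (S m) - 1) (exp (- L m))"
      have d1: "1 \<le> dim (S m) + 1" and d3: "3 \<le> residual_dim (S m) - 1"
        using assms(10)[OF m] by (auto simp: residual_dim_def)
      have L: "0 < exp (- L m)" "exp (- L m) \<le> 1" using L0 m by auto
      have N0: "5 \<le> N m" by (rule N5[OF m])
      have "(K2 - 1) / K2 * pen m = max 0 (K1 * (?D + 1) * N m / (N m - 1) * ?e - ?D)"
        using penL m K2 unfolding penK_def rd by simp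
      then have pm: "K1 * (?D + 1) * N m / (N m - 1) * ?e - ?D \<le> (K2 - 1) / K2 * pen m" by simp
      have "?e \<le> (N m - 1) / (K1 * N m) * ((K2 * ?D + (K2 - 1) * pen m) / (K2 * (?D + 1)))"
      proof -
        define c where "c = (N m - 1) / (K1 * N m * (?D + 1))"
        have pos: "0 < N m - 1" "0 < K1 * N m * (?D + 1)" using N0 K1 by auto
        have c0: "0 < c" unfolding c_def using pos by (rule divide_pos_pos)
        have "c * (K1 * (?D + 1) * N m / (N m - 1) * ?e) \<le> c * (?D + (K2 - 1) / K2 * pen m)"
          using pm c0 by (intro mult_left_mono) auto
        moreover have "c * (K1 * (?D + 1) * N m / (N m - 1) * ?e) = ?e"
        proof -
          have "y / z * (z / y * e) = e" if "0 < y" "0 < z" for y z e :: real using that by simp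
          from this[OF pos, of ?e] show ?thesis unfolding c_def by (simp only: mult_ac)
        qed
        moreover have "c * (?D + (K2 - 1) / K2 * pen m)
            = (N m - 1) / (K1 * N m) * ((K2 * ?D + (K2 - 1) * pen m) / (K2 * (?D + 1)))"
        proof -
          have "?D + (K2 - 1) / K2 * pen m = (K2 * ?D + (K2 - 1) * pen m) / K2"
            using K2 by (simp add: add_divide_distrib)
          then show ?thesis unfolding c_def by (simp only: times_divide_times_eq mult_ac)
        qed
        ultimately show ?thesis by linarith
      qed
      then have "\<Lambda> K1 K2 (S m) (pen m) \<le> Fish (dim (S m) + 1) (residual_dim (S m) - 1) ?e"
        unfolding \<Lambda>_def rd by (rule Fish_antimono[OF d1 d3])
      also have "\<dots> = exp (- L m)" by (rule Fish_EFish[OF d1 d3 L])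
      finally show ?thesis .
    qed
    then have "(\<Sum>m\<in>I. (real (dim (S m)) + 1) * \<Lambda> K1 K2 (S m) (pen m)) \<le> (\<Sum>m\<in>I. (real (dim (S m)) + 1) * exp (- L m))"
      by (intro sum_mono mult_left_mono) auto
    then have "5 * K1 / 4 * (\<Sum>m\<in>I. (real (dim (S m)) + 1) * \<Lambda> K1 K2 (S m) (pen m))
        \<le> 5 * K1 / 4 * (\<Sum>m\<in>I. (real (dim (S m)) + 1) * exp (- L m))"
      using K1 by (intro mult_left_mono) auto
    then show ?thesis unfolding \<Sigma>2_def by simp
  qed
  show ?thesis
    using sel_int loss_int INF_bound penalty by blast
qed

end
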